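(* There is a linear-time algorithm that, given an instance of Ineq-Formula-Pair with a formula of size $s$ and lists of size $n$, computes two curves $P,Q$ in $\mathbb{R}^2$ with rational coordinates, each with $O(n\cdot s)$ vertices, such that the discrete Fr\'echet distance satisfies $d_F(P,Q)\le 1$ if and only if the Ineq-Formula-Pair instance is a yes-instance.
   Context: Ineq-Formula-Pair: given a formula $F(x_1,\dots,x_m)$ with AND/OR gates in which each input is used exactly once (size $s=m$), and $A,B\subseteq\{-M,\dots,M\}^m$ of size $n$ with $M\le n^{O(1)}$, decide whether there exist $a\in A,b\in B$ with $F([a_1\le b_1],\dots,[a_m\le b_m])=\mathsf{true}$, where $[a_i\le b_i]\in\{0,1\}$ indicates whether $a_i\le b_i$. For curves $P=(p_1,\dots,p_n)$, $Q=(q_1,\dots,q_m)$, $d_F(P,Q)$ is the minimal $\delta$ for which there are monotone non-decreasing onto maps $\phi:\{1,\dots,n+m\}\to\{1,\dots,n\}$, $\psi:\{1,\dots,n+m\}\to\{1,\dots,m\}$ with $\|p_{\phi(t)}-q_{\psi(t)}\|_2\le\delta$ for all $t$. *)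

theory Defs
  imports "HOL-Analysis.Analysis"
begin

subsection \<open>Ineq-Formula-Pair\<close>

datatype formula = Var nat | And formula formula | Or formula formula

fun leaves :: "formula \<Rightarrow> nat list" where
  "leaves (Var i) = [i]"
| "leaves (And f g) = leaves f @ leaves g"
| "leaves (Or f g) = leaves f @ leaves g"

fun sat :: "formula \<Rightarrow> (nat \<Rightarrow> bool) \<Rightarrow> bool" where
  "sat (Var i) x \<longleftrightarrow> x i"
| "sat (And f g) x \<longleftrightarrow> sat f x \<and> sat g x"
| "sat (Or f g) x \<longleftrightarrow> sat f x \<or> sat g x"

text \<open>The number \<open>k\<close> is the constant hidden in \<open>M \<le> n\<^bsup>O(1)\<^esup>\<close>. Inputs are numbered from 0.
  The two clauses on \<^term>\<open>leaves F\<close> say that each of the \<open>m\<close> inputs is used exactly once, so \<open>m\<close>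
  is also the size of the formula. The sets \<open>A\<close> and \<open>B\<close> are presented as lists of \<open>n\<close> vectors.\<close>

definition ineq_formula_pair ::
    "nat \<Rightarrow> nat \<Rightarrow> nat \<Rightarrow> nat \<Rightarrow> formula \<Rightarrow> int list list \<Rightarrow> int list list \<Rightarrow> bool" where
  "ineq_formula_pair k n m M F A B \<longleftrightarrow>
     n \<ge> 1 \<and> M \<le> n ^ k \<and>
     distinct (leaves F) \<and> set (leaves F) = {..<m} \<and>
     length A = n \<and> length B = n \<and>
     (\<forall>v \<in> set A \<union> set B. length v = m \<and> (\<forall>x \<in> set v. - int M \<le> x \<and> x \<le> int M))"

definition yes_instance :: "formula \<Rightarrow> int list list \<Rightarrow> int list list \<Rightarrow> bool" where
  "yes_instance F A B \<longleftrightarrow> (\<exists>a \<in> set A. \<exists>b \<in> set B. sat F (\<lambda>i. a ! i \<le> b ! i))"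

subsection \<open>Discrete Fr\'echet distance\<close>

definition traversal_within ::
    "'a::metric_space list \<Rightarrow> 'a list \<Rightarrow> real \<Rightarrow> (nat \<Rightarrow> nat) \<Rightarrow> (nat \<Rightarrow> nat) \<Rightarrow> bool" where
  "traversal_within P Q \<delta> \<phi> \<psi> \<longleftrightarrow>
     (let T = {..<length P + length Q} in
        mono_on T \<phi> \<and> \<phi> ` T = {..<length P} \<and>
        mono_on T \<psi> \<and> \<psi> ` T = {..<length Q} \<and>
        (\<forall>t \<in> T. dist (P ! \<phi> t) (Q ! \<psi> t) \<le> \<delta>))"

text \<open>For nonempty curves the minimum exists: only the finitely many distances between a vertex
  of \<open>P\<close> and a vertex of \<open>Q\<close> matter.\<close>

definition frechet_dist :: "'a::metric_space list \<Rightarrow> 'a list \<Rightarrow> real" where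
  "frechet_dist P Q = (LEAST \<delta>. \<exists>\<phi> \<psi>. traversal_within P Q \<delta> \<phi> \<psi>)"

subsection \<open>Word RAM\<close>

text \<open>Programs are while-programs over finitely many integer arrays (a scalar variable is cell 0
  of an array); the arrays can be interleaved in the memory of a random access machine, which
  costs only a constant factor. Every operation takes unit time. The parameter \<open>W\<close> is the largest
  absolute value that fits into a machine word: \<open>fits\<close> and \<open>exec\<close> admit no expression one of whose
  subterms overflows, so that an execution exceeding the word size has no result. For inputs of
  length \<open>N\<close>, words of \<open>O(log N)\<close> bits amount to \<open>W = N\<^bsup>c\<^esup>\<close> for a constant \<open>c\<close>.\<close>

type_synonym store = "nat \<Rightarrow> nat \<Rightarrow> int"

datatype binop = Add | Sub | Mul | Div | Mod | Leq

datatype expr = Const int | Read nat expr | Bin binop expr expr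

datatype com =
    Skip
  | Write nat expr expr
  | Seq com com
  | Cond expr com com
  | While expr com

fun apply_op :: "binop \<Rightarrow> int \<Rightarrow> int \<Rightarrow> int" where
  "apply_op Add x y = x + y"
| "apply_op Sub x y = x - y"
| "apply_op Mul x y = x * y"
| "apply_op Div x y = x div y"
| "apply_op Mod x y = x mod y"
| "apply_op Leq x y = (if x \<le> y then 1 else 0)"

fun val :: "store \<Rightarrow> expr \<Rightarrow> int" where
  "val \<sigma> (Const k) = k"
| "val \<sigma> (Read x e) = \<sigma> x (nat (val \<sigma> e))"
| "val \<sigma> (Bin f e1 e2) = apply_op f (val \<sigma> e1) (val \<sigma> e2)"

fun fits :: "int \<Rightarrow> store \<Rightarrow> expr \<Rightarrow> bool" where
  "fits W \<sigma> (Const k) \<longleftrightarrow> \<bar>k\<bar> \<le> W"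
| "fits W \<sigma> (Read x e) \<longleftrightarrow> fits W \<sigma> e \<and> 0 \<le> val \<sigma> e \<and> \<bar>val \<sigma> (Read x e)\<bar> \<le> W"
| "fits W \<sigma> (Bin f e1 e2) \<longleftrightarrow> fits W \<sigma> e1 \<and> fits W \<sigma> e2 \<and> \<bar>val \<sigma> (Bin f e1 e2)\<bar> \<le> W"

fun cost :: "expr \<Rightarrow> nat" where
  "cost (Const k) = 1"
| "cost (Read x e) = 1 + cost e"
| "cost (Bin f e1 e2) = 1 + cost e1 + cost e2"

text \<open>\<open>exec W p \<sigma> t \<sigma>'\<close>: started in \<open>\<sigma>\<close>, the program \<open>p\<close> halts after \<open>t\<close> steps in \<open>\<sigma>'\<close>. In
  conditions, every nonzero value counts as true.\<close>

inductive exec :: "int \<Rightarrow> com \<Rightarrow> store \<Rightarrow> nat \<Rightarrow> store \<Rightarrow> bool" for W where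
  Skip: "exec W Skip \<sigma> 1 \<sigma>"
| Write: "fits W \<sigma> e1 \<Longrightarrow> 0 \<le> val \<sigma> e1 \<Longrightarrow> fits W \<sigma> e2 \<Longrightarrow>
    exec W (Write x e1 e2) \<sigma> (1 + cost e1 + cost e2)
      (\<sigma>(x := (\<sigma> x)(nat (val \<sigma> e1) := val \<sigma> e2)))"
| Seq: "exec W p \<sigma> t \<sigma>' \<Longrightarrow> exec W q \<sigma>' t' \<sigma>'' \<Longrightarrow> exec W (Seq p q) \<sigma> (t + t') \<sigma>''"
| CondTrue: "fits W \<sigma> e \<Longrightarrow> val \<sigma> e \<noteq> 0 \<Longrightarrow> exec W p \<sigma> t \<sigma>' \<Longrightarrow>
    exec W (Cond e p q) \<sigma> (1 + cost e + t) \<sigma>'"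
| CondFalse: "fits W \<sigma> e \<Longrightarrow> val \<sigma> e = 0 \<Longrightarrow> exec W q \<sigma> t \<sigma>' \<Longrightarrow>
    exec W (Cond e p q) \<sigma> (1 + cost e + t) \<sigma>'"
| WhileTrue: "fits W \<sigma> e \<Longrightarrow> val \<sigma> e \<noteq> 0 \<Longrightarrow> exec W p \<sigma> t \<sigma>' \<Longrightarrow>
    exec W (While e p) \<sigma>' t' \<sigma>'' \<Longrightarrow> exec W (While e p) \<sigma> (1 + cost e + t + t') \<sigma>''"
| WhileFalse: "fits W \<sigma> e \<Longrightarrow> val \<sigma> e = 0 \<Longrightarrow> exec W (While e p) \<sigma> (1 + cost e) \<sigma>"

inductive_cases SkipE: "exec W Skip \<sigma> t \<sigma>'"
inductive_cases WriteE: "exec W (Write x e1 e2) \<sigma> t \<sigma>'"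
inductive_cases SeqE: "exec W (Seq p q) \<sigma> t \<sigma>'"
inductive_cases CondE: "exec W (Cond e p q) \<sigma> t \<sigma>'"
inductive_cases WhileE: "exec W (While e p) \<sigma> t \<sigma>'"

lemma exec_deterministic:
  "exec W p \<sigma> t \<sigma>' \<Longrightarrow> exec W p \<sigma> u \<tau> \<Longrightarrow> u = t \<and> \<tau> = \<sigma>'"
proof (induction arbitrary: u \<tau> rule: exec.induct)
  case (Seq p \<sigma> t \<sigma>' q t' \<sigma>'')
  from Seq.prems obtain t1 t2 \<tau>1 where
    *: "exec W p \<sigma> t1 \<tau>1" "exec W q \<tau>1 t2 \<tau>" "u = t1 + t2"
    by (rule SeqE)
  have "t1 = t \<and> \<tau>1 = \<sigma>'" by (rule Seq.IH(1)[OF *(1)])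
  with * Seq.IH(2) show ?case by simp
next
  case (WhileTrue \<sigma> e p t \<sigma>' t' \<sigma>'')
  from WhileTrue.prems WhileTrue.hyps(2) obtain t1 t2 \<tau>1 where
    *: "exec W p \<sigma> t1 \<tau>1" "exec W (While e p) \<tau>1 t2 \<tau>" "u = 1 + cost e + t1 + t2"
    by (auto elim: WhileE)
  have "t1 = t \<and> \<tau>1 = \<sigma>'" by (rule WhileTrue.IH(1)[OF *(1)])
  with * WhileTrue.IH(2) show ?case by simp
next
  case (CondTrue \<sigma> e p t \<sigma>' q)
  from CondTrue.prems CondTrue.hyps(2) obtain t1 where
    "exec W p \<sigma> t1 \<tau>" "u = 1 + cost e + t1"
    by (auto elim: CondE)
  with CondTrue.IH show ?case by simp
next
  case (CondFalse \<sigma> e q t \<sigma>' p)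
  from CondFalse.prems CondFalse.hyps(2) obtain t1 where
    "exec W q \<sigma> t1 \<tau>" "u = 1 + cost e + t1"
    by (auto elim: CondE)
  with CondFalse.IH show ?case by simp
next
  case (WhileFalse \<sigma> e p)
  from WhileFalse.prems WhileFalse.hyps(2) show ?case
    by (auto elim: WhileE)
next
  case (Skip \<sigma>)
  then show ?case by (auto elim: SkipE)
next
  case (Write \<sigma> e1 e2 x)
  from Write.prems show ?case by (auto elim: WriteE)
qed

subsection \<open>Input and output\<close>

text \<open>A formula is written in prefix notation, with -1 for AND and -2 for OR.\<close>

fun prefix_code :: "formula \<Rightarrow> int list" where
  "prefix_code (Var i) = [int i]"
| "prefix_code (And f g) = -1 # prefix_code f @ prefix_code g"
| "prefix_code (Or f g) = -2 # prefix_code f @ prefix_code g"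

definition encode ::
    "nat \<Rightarrow> nat \<Rightarrow> nat \<Rightarrow> formula \<Rightarrow> int list list \<Rightarrow> int list list \<Rightarrow> int list" where
  "encode n m M F A B = [int n, int m, int M] @ prefix_code F @ concat A @ concat B"

definition initial_store :: "int list \<Rightarrow> store" where
  "initial_store xs = (\<lambda>x i. if x = 0 \<and> i < length xs then xs ! i else 0)"

text \<open>An array holds a curve if cell 0 contains the number of vertices and vertex \<open>i\<close>
  occupies the cells \<open>4i+1, \<dots>, 4i+4\<close>: numerator and denominator of the first coordinate, then of
  the second. Fractions need not be reduced.\<close>

definition holds_curve :: "(nat \<Rightarrow> int) \<Rightarrow> (real^2) list \<Rightarrow> bool" where
  "holds_curve a P \<longleftrightarrow> a 0 = int (length P) \<and>
     (\<forall>i < length P. a (4*i + 2) > 0 \<and> a (4*i + 4) > 0 \<and>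
        P ! i = vector [of_int (a (4*i + 1)) / of_int (a (4*i + 2)),
                        of_int (a (4*i + 3)) / of_int (a (4*i + 4))])"

end

theory Submission
  imports Defs
begin

text \<open>
  Vertices are encoded by integer points: \<open>(x, y)\<close> stands for \<open>(x/D, y/D\<^sup>2)\<close> on the left curve and
  for \<open>(x/D, y/D\<^sup>2 - 1)\<close> on the right curve. For large \<open>D\<close> such vertices are within distance 1 iff
  \<open>(x - x')\<^sup>2 + 2 (y - y') < 0\<close>. Hence a left point with \<open>y = - r\<^sup>2/2\<close> and a right point with
  \<open>y' = r'\<^sup>2/2\<close> act like circles on the number line that are close iff their centers differ by less
  than \<open>sqrt (r\<^sup>2 + r'\<^sup>2)\<close>: circles spanned by nested intervals are close, those of disjoint intervals
  are not. Leaves of the formula are circles of radius almost 0, whose exact second coordinate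
  carries the entry of the vector.

  Distance at most 1 means that a monotone lattice path crosses the matrix of close pairs. AND is
  concatenation. For OR, the left curve visits the two subgadgets in order and the right curve
  in reverse order; interval points at which one curve waits let the path bypass one subgadget, but
  because of the reversal it has to cross the other one.

  The program walks through the formula with an explicit stack, once for every vector.
\<close>

section \<open>Traversals as lattice paths\<close>

text \<open>The squared distance of two vertices is
  \<open>1 + (D\<^sup>2 * e + dy\<^sup>2) / D\<^sup>4\<close> with
  \<open>e = dx\<^sup>2 + 2 * dy\<close>. As \<open>e\<close> is an integer, \<open>e < 0\<close>
  means \<open>e \<le> - 1\<close> and outweighs \<open>dy\<^sup>2\<close> as soon as
  \<open>\<bar>dy\<bar> \<le> D\<close>, and \<open>e > 0\<close> always separates; so real
  distances reduce to signs of integers, with no limit process. Circles with radii \<open>r\<close>,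
  \<open>r'\<close> have the threshold sqrt (\<open>r\<^sup>2 + r'\<^sup>2\<close>), which is at
  least the larger radius and strictly less than the sum. Nested intervals have centers closer than
  the larger radius, disjoint ones have centers at least the sum apart, so both cases are decided
  with room to spare.

  What shapes the construction is the word size. If every gate rescaled its subgadgets, the needed
  precision would grow with the depth of the formula. Here all gadgets share one number line, two
  units per symbol of the prefix code, and only sibling intervals have to be told apart. Hence
  \<open>D\<close> is polynomial in the input length, whatever the depth, and logarithmic word
  length suffices. The same indexing lets the program find every coordinate of a gate from three
  numbers: its index, the index of its right child and its end.\<close>

fun trav :: "('p \<Rightarrow> 'q \<Rightarrow> bool) \<Rightarrow> 'p list \<Rightarrow> 'q list \<Rightarrow> bool" where
  "trav R [] Q \<longleftrightarrow> False"
| "trav R (p # P) [] \<longleftrightarrow> False"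
| "trav R (p # P) (q # Q) \<longleftrightarrow> R p q \<and>
     (P = [] \<and> Q = [] \<or> trav R P (q # Q) \<or> trav R (p # P) Q \<or> trav R P Q)"

lemma trav_Nil [simp]: "\<not> trav R P []" "\<not> trav R [] Q"
  by (cases P) auto

lemma trav_nonempty: "trav R P Q \<Longrightarrow> P \<noteq> [] \<and> Q \<noteq> []"
  by auto

lemma trav_flip: "trav R P Q \<longleftrightarrow> trav (\<lambda>q p. R p q) Q P"
  by (induction R P Q rule: trav.induct) auto

lemma trav_covers_right: "trav R P Q \<Longrightarrow> q \<in> set Q \<Longrightarrow> \<exists>p \<in> set P. R p q"
  by (induction R P Q rule: trav.induct) auto

lemma trav_hd: "trav R P Q \<Longrightarrow> R (hd P) (hd Q)"
  by (induction R P Q rule: trav.induct) auto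

lemma trav_last: "trav R P Q \<Longrightarrow> R (last P) (last Q)"
proof (induction R P Q rule: trav.induct)
  case (3 R p P q Q)
  then show ?case by (cases "P = []"; cases "Q = []") auto
qed auto

lemma trav_singleton_right: "trav R P [q] \<longleftrightarrow> P \<noteq> [] \<and> (\<forall>p \<in> set P. R p q)"
  by (induction P) auto

lemma trav_singleton_left: "trav R [p] Q \<longleftrightarrow> Q \<noteq> [] \<and> (\<forall>q \<in> set Q. R p q)"
  by (induction Q) auto

lemma trav_append: "trav R P1 Q1 \<Longrightarrow> trav R P2 Q2 \<Longrightarrow> trav R (P1 @ P2) (Q1 @ Q2)"
proof (induction R P1 Q1 rule: trav.induct)
  case (3 R p P q Q)
  then show ?case by (cases "P = []"; cases "Q = []") auto
qed auto

lemma trav_append_share_left: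
  "trav R (P1 @ [p]) Q1 \<Longrightarrow> trav R (p # P2) Q2 \<Longrightarrow> trav R (P1 @ p # P2) (Q1 @ Q2)"
proof (induction R "P1 @ [p]" Q1 arbitrary: P1 rule: trav.induct)
  case (3 R p' P q Q)
  then show ?case
    by (cases P1; cases "Q = []") (auto dest: trav_nonempty)
qed auto

lemma trav_append_share_right:
  assumes "trav R P1 (Q1 @ [q])" "trav R P2 (q # Q2)"
  shows "trav R (P1 @ P2) (Q1 @ q # Q2)"
proof -
  have "trav (\<lambda>q p. R p q) (Q1 @ [q]) P1" "trav (\<lambda>q p. R p q) (q # Q2) P2"
    using assms trav_flip by blast+
  then have "trav (\<lambda>q p. R p q) (Q1 @ q # Q2) (P1 @ P2)"
    by (rule trav_append_share_left)
  then show ?thesis using trav_flip by blast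
qed

section \<open>Cutting a lattice path between consecutive pieces of a curve\<close>

definition cut :: "('p \<Rightarrow> 'q \<Rightarrow> bool) \<Rightarrow> 'p list \<Rightarrow> 'p list \<Rightarrow> 'q list \<Rightarrow> bool" where
  "cut R P1 P2 Q \<longleftrightarrow> (\<exists>Q1 Q2. trav R P1 Q1 \<and> trav R P2 Q2 \<and> Q = Q1 @ Q2) \<or>
    (\<exists>Qa q Qb. trav R P1 (Qa @ [q]) \<and> trav R P2 (q # Qb) \<and> Q = Qa @ q # Qb)"

lemma cut_split: "trav R P1 Q1 \<Longrightarrow> trav R P2 Q2 \<Longrightarrow> cut R P1 P2 (Q1 @ Q2)"
  unfolding cut_def by blast

lemma cut_share: "trav R P1 (Qa @ [q]) \<Longrightarrow> trav R P2 (q # Qb) \<Longrightarrow> cut R P1 P2 (Qa @ q # Qb)"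
  unfolding cut_def by blast

lemma cutE:
  assumes "cut R P1 P2 Q"
  obtains (split) Q1 Q2 where "trav R P1 Q1" "trav R P2 Q2" "Q = Q1 @ Q2"
    | (share) Qa q Qb where "trav R P1 (Qa @ [q])" "trav R P2 (q # Qb)" "Q = Qa @ q # Qb"
  using assms unfolding cut_def by blast

lemma cut_Cons_right:
  assumes "cut R (p # P1) P2 Q" "R p q" shows "cut R (p # P1) P2 (q # Q)"
  using assms(1)
proof (cases rule: cutE)
  case (split Q1 Q2)
  then show ?thesis using assms(2) cut_split[of R "p # P1" "q # Q1" P2 Q2] by simp
next
  case (share Qa r Qb)
  then show ?thesis using assms(2) cut_share[of R "p # P1" "q # Qa" r P2 Qb] by simp
qed

lemma cut_Cons_left:
  assumes "cut R P1 P2 (q # Q)" "R p q" shows "cut R (p # P1) P2 (q # Q)"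
  using assms(1)
proof (cases rule: cutE)
  case (split Q1 Q2)
  then obtain Q1' where "Q1 = q # Q1'" by (cases Q1) auto
  then show ?thesis using split assms(2) cut_split[of R "p # P1" Q1 P2 Q2] by simp
next
  case (share Qa r Qb)
  then have "trav R (p # P1) (Qa @ [r])" using assms(2) by (cases Qa) auto
  then show ?thesis using share cut_share[of R "p # P1" Qa r P2 Qb] by simp
qed

lemma cut_Cons_both:
  assumes "cut R P1 P2 Q" "R p q" shows "cut R (p # P1) P2 (q # Q)"
  using assms(1)
proof (cases rule: cutE)
  case (split Q1 Q2)
  then show ?thesis using assms(2) cut_split[of R "p # P1" "q # Q1" P2 Q2] by simp
next
  case (share Qa r Qb)
  then show ?thesis using assms(2) cut_share[of R "p # P1" "q # Qa" r P2 Qb] by simp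
qed

text \<open>The move that takes the left curve from \<open>P1\<close> to \<open>P2\<close> either
  advances the right curve too, and \<open>Q\<close> is split, or it does not, and one vertex of
  \<open>Q\<close> is shared. The induction removes the first move of the path.\<close>

lemma trav_cut:
  assumes "trav R (P1 @ P2) Q" "P1 \<noteq> []" "P2 \<noteq> []"
  shows "cut R P1 P2 Q"
  using assms
proof (induction "length P1 + length Q" arbitrary: P1 Q rule: less_induct)
  case less
  obtain p P1' where P1: "P1 = p # P1'" using less.prems by (cases P1) auto
  obtain q Q' where Q: "Q = q # Q'" using less.prems by (cases Q) auto
  have R: "R p q" using less.prems(1) unfolding P1 Q by simp
  consider (left) "trav R (P1' @ P2) Q" | (right) "trav R (P1 @ P2) Q'" | (both) "trav R (P1' @ P2) Q'"
    using less.prems unfolding P1 Q by auto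
  then show ?case
  proof cases
    case left
    show ?thesis
    proof (cases "P1' = []")
      case True
      with left Q R P1 have "trav R P1 ([] @ [q])" "trav R P2 (q # Q')" "Q = [] @ q # Q'" by simp_all
      then show ?thesis unfolding cut_def by blast
    next
      case False
      have "cut R P1' P2 Q" by (rule less.hyps[OF _ left False less.prems(3)]) (simp add: P1)
      then show ?thesis using R unfolding P1 Q by (rule cut_Cons_left)
    qed
  next
    case right
    have "cut R P1 P2 Q'" by (rule less.hyps[OF _ right less.prems(2,3)]) (simp add: Q)
    then show ?thesis using R unfolding P1 Q by (rule cut_Cons_right)
  next
    case both
    show ?thesis
    proof (cases "P1' = []")
      case True
      with both Q R P1 have "trav R P1 [q]" "trav R P2 Q'" "Q = [q] @ Q'" by simp_all
      then show ?thesis unfolding cut_def by blast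
    next
      case False
      have "cut R P1' P2 Q'" by (rule less.hyps[OF _ both False less.prems(3)]) (simp add: P1 Q)
      then show ?thesis using R unfolding P1 Q by (rule cut_Cons_both)
    qed
  qed
qed

lemma trav_cut_diagonal:
  assumes "trav R (P1 @ P2) Q" "P1 \<noteq> []" "P2 \<noteq> []"
    and "\<And>q. q \<in> set Q \<Longrightarrow> \<not> (R (last P1) q \<and> R (hd P2) q)"
  shows "\<exists>Q1 Q2. trav R P1 Q1 \<and> trav R P2 Q2 \<and> Q = Q1 @ Q2"
proof -
  have "\<not> (\<exists>Qa q Qb. trav R P1 (Qa @ [q]) \<and> trav R P2 (q # Qb) \<and> Q = Qa @ q # Qb)"
    using assms(4) trav_last[of R P1] trav_hd[of R P2] by fastforce
  then show ?thesis using trav_cut[OF assms(1-3)] unfolding cut_def by blast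
qed

text \<open>The part of \<open>Q\<close> met by \<open>P1\<close> avoids \<open>Q2\<close>, and the
  part met by \<open>P2\<close> avoids the last vertex of \<open>Q1\<close>, so the cut falls
  exactly on the boundary. It is essential to ask only about \<open>last Q1\<close>: in the OR
  gadget, \<open>G1\<close> in the role of \<open>P2\<close> is close to the waiting point
  \<open>\<alpha>'\<close> inside \<open>Q1\<close>.\<close>

lemma trav_split_fst:
  assumes "trav R (P1 @ P2) (Q1 @ Q2)" and ne: "P1 \<noteq> []" "P2 \<noteq> []" "Q1 \<noteq> []" "Q2 \<noteq> []"
    and no1: "\<And>p q. p \<in> set P1 \<Longrightarrow> q \<in> set Q2 \<Longrightarrow> \<not> R p q"
    and no2: "\<And>p. p \<in> set P2 \<Longrightarrow> \<not> R p (last Q1)"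
  shows "trav R P1 Q1 \<and> trav R P2 Q2"
proof -
  have no1': "set Qa \<inter> set Q2 = {}" if "trav R P1 Qa" for Qa
    using trav_covers_right[OF that] no1 by blast
  have no2': "last Q1 \<notin> set Qb" if "trav R P2 Qb" for Qb
    using trav_covers_right[OF that] no2 by blast
  have "cut R P1 P2 (Q1 @ Q2)" by (rule trav_cut[OF assms(1) ne(1,2)])
  then show ?thesis
  proof (cases rule: cutE)
    case diag: (split Qa Qb)
    from diag(3) obtain us where "Qa = Q1 @ us \<and> Q2 = us @ Qb \<or> Q1 = Qa @ us \<and> us @ Q2 = Qb"
      unfolding append_eq_append_conv2 by metis
    moreover have "us = []" if "Qa = Q1 @ us" "Q2 = us @ Qb"
      using no1'[OF diag(1)] that by (cases us) auto
    moreover have "us = []" if "Q1 = Qa @ us" "us @ Q2 = Qb"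
      using no2'[OF diag(2)] that by (cases us rule: rev_cases) auto
    ultimately show ?thesis using diag by fastforce
  next
    case (share Qa q Qb)
    from share(3) obtain us where "Qa = Q1 @ us \<and> Q2 = us @ q # Qb \<or> Q1 = Qa @ us \<and> us @ Q2 = q # Qb"
      unfolding append_eq_append_conv2 by metis
    moreover have False if "Q2 = us @ q # Qb"
      using no1'[OF share(1)] that by auto
    moreover have False if "Q1 = Qa @ us" "us @ Q2 = q # Qb" "us \<noteq> []"
    proof -
      have "last Q1 \<in> set (us @ Q2)" using that(1,3) by simp
      then show False using no2'[OF share(2)] that(2) by simp
    qed
    ultimately show ?thesis by fastforce
  qed
qed

text \<open>Mirror image of \<open>trav_split_fst\<close>: \<open>P1\<close> may be close to later
  vertices of \<open>Q2\<close>, as \<open>G2\<close> is to \<open>\<gamma>'\<close>, but not to the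
  first one.\<close>

lemma trav_split_snd:
  assumes "trav R (P1 @ P2) (Q1 @ Q2)" and ne: "P1 \<noteq> []" "P2 \<noteq> []" "Q1 \<noteq> []" "Q2 \<noteq> []"
    and no1: "\<And>p q. p \<in> set P2 \<Longrightarrow> q \<in> set Q1 \<Longrightarrow> \<not> R p q"
    and no2: "\<And>p. p \<in> set P1 \<Longrightarrow> \<not> R p (hd Q2)"
  shows "trav R P1 Q1 \<and> trav R P2 Q2"
proof -
  have no1': "set Qb \<inter> set Q1 = {}" if "trav R P2 Qb" for Qb
    using trav_covers_right[OF that] no1 by blast
  have no2': "hd Q2 \<notin> set Qa" if "trav R P1 Qa" for Qa
    using trav_covers_right[OF that] no2 by blast
  have "cut R P1 P2 (Q1 @ Q2)" by (rule trav_cut[OF assms(1) ne(1,2)])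
  then show ?thesis
  proof (cases rule: cutE)
    case diag: (split Qa Qb)
    from diag(3) obtain us where "Qa = Q1 @ us \<and> Q2 = us @ Qb \<or> Q1 = Qa @ us \<and> us @ Q2 = Qb"
      unfolding append_eq_append_conv2 by metis
    moreover have "us = []" if "Qa = Q1 @ us" "Q2 = us @ Qb"
      using no2'[OF diag(1)] that by (cases us) auto
    moreover have "us = []" if "Q1 = Qa @ us" "us @ Q2 = Qb"
      using no1'[OF diag(2)] that by (cases us rule: rev_cases) auto
    ultimately show ?thesis using diag by fastforce
  next
    case (share Qa q Qb)
    from share(3) obtain us where us: "Qa = Q1 @ us \<and> Q2 = us @ q # Qb \<or> Q1 = Qa @ us \<and> us @ Q2 = q # Qb"
      unfolding append_eq_append_conv2 by metis
    have False if "Qa = Q1 @ us" "Q2 = us @ q # Qb"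
      using no2'[OF share(1)] that by (cases us) auto
    moreover have False if "Q1 = Qa @ us" "us @ Q2 = q # Qb"
    proof (cases us)
      case Nil
      then show ?thesis using no2'[OF share(1)] that by auto
    next
      case (Cons x xs)
      then show ?thesis using no1'[OF share(2)] that by auto
    qed
    ultimately show ?thesis using us by blast
  qed
qed

section \<open>Index maps of traversals versus lattice paths\<close>

lemma mono_onto_step:
  fixes \<phi> :: "nat \<Rightarrow> nat"
  assumes "mono_on {..<k} \<phi>" "\<phi> ` {..<k} = {..<n}" "Suc t < k"
  shows "\<phi> (Suc t) = \<phi> t \<or> \<phi> (Suc t) = Suc (\<phi> t)"
proof (rule ccontr)
  have le: "\<phi> r \<le> \<phi> s" if "r \<le> s" "s < k" for r s
    using monotone_onD[OF assms(1), of r s] that by simp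
  assume "\<not> ?thesis"
  moreover have "\<phi> t \<le> \<phi> (Suc t)" using le assms(3) by simp
  ultimately have gap: "Suc (\<phi> t) < \<phi> (Suc t)" by linarith
  have "\<phi> (Suc t) < n" using assms by blast
  then have "Suc (\<phi> t) \<in> \<phi> ` {..<k}" using gap assms(2) by simp
  then obtain u where u: "u < k" "\<phi> u = Suc (\<phi> t)" by auto
  show False
    using le[of u t] le[of "Suc t" u] u gap assms(3) by (cases "u \<le> t") auto
qed

lemma mono_onto_first:
  fixes \<phi> :: "nat \<Rightarrow> nat"
  assumes "mono_on {..<k} \<phi>" "\<phi> ` {..<k} = {..<n}" "0 < n"
  shows "\<phi> 0 = 0"
proof -
  have "0 \<in> \<phi> ` {..<k}" using assms by simp
  then obtain u where "u < k" "\<phi> u = 0" by auto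
  then show ?thesis using monotone_onD[OF assms(1), of 0 u] by simp
qed

lemma mono_onto_last:
  fixes \<phi> :: "nat \<Rightarrow> nat"
  assumes "mono_on {..<k} \<phi>" "\<phi> ` {..<k} = {..<n}" "0 < n"
  shows "\<phi> (k - 1) = n - 1"
proof -
  have "n - 1 \<in> \<phi> ` {..<k}" using assms by simp
  then obtain u where u: "u < k" "\<phi> u = n - 1" by auto
  have "k - 1 \<in> {..<k}" using u(1) by simp
  then have "\<phi> (k - 1) < n" using assms(2) by blast
  then show ?thesis using monotone_onD[OF assms(1), of u "k - 1"] u by fastforce
qed

lemma trav_snoc:
  assumes "trav R P Q"
  shows "R p (last Q) \<Longrightarrow> trav R (P @ [p]) Q"
    and "R (last P) q \<Longrightarrow> trav R P (Q @ [q])"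
    and "R p q \<Longrightarrow> trav R (P @ [p]) (Q @ [q])"
proof -
  note ne = trav_nonempty[OF assms]
  show "trav R (P @ [p]) (Q @ [q])" if "R p q"
    using that by (intro trav_append[OF assms]) simp
  show "trav R (P @ [p]) Q" if "R p (last Q)"
    using trav_append_share_right[of R P "butlast Q" "last Q" "[p]" "[]"] assms ne that by simp
  show "trav R P (Q @ [q])" if "R (last P) q"
    using trav_append_share_left[of R "butlast P" "last P" Q "[]" "[q]"] assms ne that by simp
qed

text \<open>Induction on time: the prefixes visited up to time \<open>t\<close> are joined by a
  path. Neither map can jump over an index, so each time step either repeats the current pair or
  extends the path by one move.\<close>

lemma traversal_imp_trav:
  assumes "traversal_within P Q \<delta> \<phi> \<psi>" "P \<noteq> []" "Q \<noteq> []"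
  shows "trav (\<lambda>p q. dist p q \<le> \<delta>) P Q"
proof -
  define k where "k = length P + length Q"
  have \<phi>: "mono_on {..<k} \<phi>" "\<phi> ` {..<k} = {..<length P}" "0 < length P"
    and \<psi>: "mono_on {..<k} \<psi>" "\<psi> ` {..<k} = {..<length Q}" "0 < length Q"
    and d: "\<And>t. t < k \<Longrightarrow> dist (P ! \<phi> t) (Q ! \<psi> t) \<le> \<delta>"
    using assms by (auto simp: traversal_within_def Let_def k_def)
  have "k > 0" using assms by (simp add: k_def)
  have main: "trav (\<lambda>p q. dist p q \<le> \<delta>) (take (Suc (\<phi> t)) P) (take (Suc (\<psi> t)) Q)" if "t < k" for t
    using that
  proof (induction t)
    case 0
    then show ?case using d[of 0] mono_onto_first[OF \<phi>] mono_onto_first[OF \<psi>] assms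
      by (simp add: take_Suc_conv_app_nth)
  next
    case (Suc t)
    then have IH: "trav (\<lambda>p q. dist p q \<le> \<delta>) (take (Suc (\<phi> t)) P) (take (Suc (\<psi> t)) Q)" by simp
    have lt: "\<phi> (Suc t) < length P" "\<psi> (Suc t) < length Q"
      using \<phi>(2) \<psi>(2) Suc.prems by blast+
    have lt': "\<phi> t < length P" "\<psi> t < length Q"
      using \<phi>(2) \<psi>(2) Suc_lessD[OF Suc.prems] by blast+
    have l: "last (take (Suc (\<phi> t)) P) = P ! \<phi> t" "last (take (Suc (\<psi> t)) Q) = Q ! \<psi> t"
      using lt' by (simp_all add: take_Suc_conv_app_nth)
    note s = trav_snoc[OF IH, unfolded l]
    consider "\<phi> (Suc t) = \<phi> t" "\<psi> (Suc t) = \<psi> t" | "\<phi> (Suc t) = Suc (\<phi> t)" "\<psi> (Suc t) = \<psi> t"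
      | "\<phi> (Suc t) = \<phi> t" "\<psi> (Suc t) = Suc (\<psi> t)" | "\<phi> (Suc t) = Suc (\<phi> t)" "\<psi> (Suc t) = Suc (\<psi> t)"
      using mono_onto_step[OF \<phi>(1,2) Suc.prems] mono_onto_step[OF \<psi>(1,2) Suc.prems] by blast
    then show ?case
      by cases (use IH s d[OF Suc.prems] lt in \<open>simp_all add: take_Suc_conv_app_nth[of "Suc _"]\<close>)
  qed
  from main[of "k - 1"] \<open>k > 0\<close> mono_onto_last[OF \<phi>] mono_onto_last[OF \<psi>] assms(2,3)
  show ?thesis by simp
qed

lemma onto_shift:
  fixes f :: "nat \<Rightarrow> nat"
  assumes "mono_on {..<k} f" "f ` {..<k} = {..<n}"
  shows "mono_on {..<d + k} (\<lambda>t. if t < d then 0 else Suc (f (t - d)))"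
    and "0 < d \<Longrightarrow> (\<lambda>t. if t < d then 0 else Suc (f (t - d))) ` {..<d + k} = {..<Suc n}"
proof -
  let ?g = "\<lambda>t. if t < d then 0 else Suc (f (t - d))"
  show "mono_on {..<d + k} ?g"
    by (intro mono_onI) (auto intro!: monotone_onD[OF assms(1)])
  assume "0 < d"
  have "?g ` {..<d + k} = ?g ` {..<d} \<union> ?g ` {d..<d + k}"
    by (subst image_Un[symmetric]) (rule arg_cong[of _ _ "image ?g"], auto)
  also have "?g ` {..<d} = {0}" using \<open>0 < d\<close> by auto
  also have "?g ` {d..<d + k} = (\<lambda>t. ?g (t + d)) ` {..<k}"
    by (subst image_image[of ?g, symmetric]) (simp add: lessThan_atLeast0 add.commute)
  also have "\<dots> = Suc ` f ` {..<k}" by (auto simp: image_image)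
  also have "{0} \<union> \<dots> = {..<Suc n}" unfolding assms(2) by (simp add: lessThan_Suc_eq_insert_0)
  finally show "?g ` {..<d + k} = {..<Suc n}" .
qed

lemma onto_stutter:
  fixes f :: "nat \<Rightarrow> nat"
  assumes "mono_on {..<k} f" "f ` {..<k} = {..<n}" "0 < k" "f 0 = 0"
  shows "mono_on {..<Suc k} (\<lambda>t. f (t - 1))"
    and "(\<lambda>t. f (t - 1)) ` {..<Suc k} = {..<n}"
proof -
  show "mono_on {..<Suc k} (\<lambda>t. f (t - 1))"
    by (intro mono_onI monotone_onD[OF assms(1)]) (use assms(3) in auto)
  have "(\<lambda>t. f (t - 1)) ` {..<Suc k} = insert (f 0) (f ` {..<k})"
    by (simp add: lessThan_Suc_eq_insert_0 image_image)
  also have "\<dots> = {..<n}" using assms by auto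
  finally show "(\<lambda>t. f (t - 1)) ` {..<Suc k} = {..<n}" .
qed

lemma traversal_withinD:
  assumes "traversal_within P Q \<delta> \<phi> \<psi>"
  shows "mono_on {..<length P + length Q} \<phi>" "\<phi> ` {..<length P + length Q} = {..<length P}"
    "mono_on {..<length P + length Q} \<psi>" "\<psi> ` {..<length P + length Q} = {..<length Q}"
    "t < length P + length Q \<Longrightarrow> dist (P ! \<phi> t) (Q ! \<psi> t) \<le> \<delta>"
  using assms by (auto simp: traversal_within_def Let_def)

lemma trav_imp_traversal:
  "trav R P Q \<Longrightarrow> R = (\<lambda>p q. dist p q \<le> \<delta>) \<Longrightarrow> \<exists>\<phi> \<psi>. traversal_within P Q \<delta> \<phi> \<psi>"
proof (induction R P Q rule: trav.induct)
  case (3 R p P q Q)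
  have R: "dist p q \<le> \<delta>" using 3 by auto
  let ?s = "\<lambda>d f t. if t < d then 0 else Suc (f (t - d)) :: nat"
  consider (fin) "P = []" "Q = []" | (left) "trav R P (q # Q)" | (right) "trav R (p # P) Q" | (both) "trav R P Q"
    using 3 by auto
  then show ?case
  proof cases
    case fin
    then have "traversal_within (p # P) (q # Q) \<delta> (\<lambda>_. 0) (\<lambda>_. 0)"
      using R by (auto simp: traversal_within_def mono_on_def)
    then show ?thesis by blast
  next
    case left
    with 3 obtain \<phi> \<psi> where *: "traversal_within P (q # Q) \<delta> \<phi> \<psi>" by blast
    note ** = traversal_withinD[OF *]
    have "\<psi> 0 = 0" using mono_onto_first[OF **(3,4)] by simp
    then have "traversal_within (p # P) (q # Q) \<delta> (?s 1 \<phi>) (\<lambda>t. \<psi> (t - 1))"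
      using onto_shift[OF **(1,2), of 1] onto_stutter[OF **(3,4)] **(5) R
      by (auto simp: traversal_within_def Let_def)
    then show ?thesis by blast
  next
    case right
    with 3 obtain \<phi> \<psi> where *: "traversal_within (p # P) Q \<delta> \<phi> \<psi>" by blast
    note ** = traversal_withinD[OF *]
    have "\<phi> 0 = 0" using mono_onto_first[OF **(1,2)] by simp
    then have "traversal_within (p # P) (q # Q) \<delta> (\<lambda>t. \<phi> (t - 1)) (?s 1 \<psi>)"
      using onto_shift[OF **(3,4), of 1] onto_stutter[OF **(1,2)] **(5) R
      by (auto simp: traversal_within_def Let_def)
    then show ?thesis by blast
  next
    case both
    with 3 obtain \<phi> \<psi> where *: "traversal_within P Q \<delta> \<phi> \<psi>" by blast
    note ** = traversal_withinD[OF *]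
    \<comment> \<open>A diagonal move takes one time step but adds two to
      \<open>length P + length Q\<close>; the first pair is therefore held for two steps.\<close>
    have "traversal_within (p # P) (q # Q) \<delta> (?s 2 \<phi>) (?s 2 \<psi>)"
      using onto_shift[OF **(1,2), of 2] onto_shift[OF **(3,4), of 2] **(5) R
      by (auto simp: traversal_within_def Let_def)
    then show ?thesis by blast
  qed
qed auto

text \<open>\<open>LEAST\<close> over the reals needs an attained minimum. Any feasible bound can be
  lowered to the largest distance occurring on the same traversal, which belongs to the finite set
  \<open>S\<close>; so the least bound is the least feasible member of \<open>S\<close>.\<close>

lemma frechet_dist_le_iff:
  assumes "P \<noteq> []" "Q \<noteq> []"
  shows "frechet_dist P Q \<le> \<delta> \<longleftrightarrow> trav (\<lambda>p q. dist p q \<le> \<delta>) P Q"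
proof -
  let ?T = "\<lambda>\<delta>. \<exists>\<phi> \<psi>. traversal_within P Q \<delta> \<phi> \<psi>"
  have mono: "?T \<delta>'" if "?T \<delta>" "\<delta> \<le> \<delta>'" for \<delta> \<delta>'
  proof -
    obtain \<phi> \<psi> where "traversal_within P Q \<delta> \<phi> \<psi>" using \<open>?T \<delta>\<close> by blast
    then have "traversal_within P Q \<delta>' \<phi> \<psi>"
      using \<open>\<delta> \<le> \<delta>'\<close> by (auto simp: traversal_within_def Let_def intro: order_trans)
    then show ?thesis by blast
  qed
  define S where "S = (\<lambda>(p, q). dist p q) ` (set P \<times> set Q)"
  have S: "finite S" "S \<noteq> {}" using assms by (auto simp: S_def)
  have discrete: "\<exists>\<delta>' \<in> S. \<delta>' \<le> \<delta> \<and> ?T \<delta>'" if "?T \<delta>" for \<delta>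
  proof -
    obtain \<phi> \<psi> where *: "traversal_within P Q \<delta> \<phi> \<psi>" using \<open>?T \<delta>\<close> by blast
    define D where "D = (\<lambda>t. dist (P ! \<phi> t) (Q ! \<psi> t)) ` {..<length P + length Q}"
    have D: "finite D" "D \<noteq> {}" using assms by (auto simp: D_def lessThan_empty_iff)
    have "D \<subseteq> S"
    proof
      fix x assume "x \<in> D"
      then obtain t where t: "t < length P + length Q" "x = dist (P ! \<phi> t) (Q ! \<psi> t)"
        by (auto simp: D_def)
      have "\<phi> t < length P" "\<psi> t < length Q"
        using * t(1) by (auto simp: traversal_within_def Let_def)
      then show "x \<in> S" unfolding S_def t(2) by (auto intro!: image_eqI[of _ _ "(P ! \<phi> t, Q ! \<psi> t)"])
    qed
    moreover have "Max D \<le> \<delta>" using D * by (auto simp: traversal_within_def Let_def D_def)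
    moreover have "traversal_within P Q (Max D) \<phi> \<psi>"
      using * D(1) by (auto simp: traversal_within_def Let_def D_def)
    ultimately show ?thesis using Max_in[OF D] by blast
  qed
  have "?T (Max S)"
  proof -
    have all: "dist p q \<le> Max S" if "p \<in> set P" "q \<in> set Q" for p q
      using S that by (intro Max_ge) (auto simp: S_def)
    \<comment> \<open>All pairs being allowed, the left curve runs while the right one waits at its
      first vertex, and the right curve runs while the left one waits at its last vertex.\<close>
    have "trav (\<lambda>p q. dist p q \<le> Max S) P Q"
    proof -
      obtain q Q' where Q: "Q = q # Q'" using assms by (cases Q) auto
      have "trav (\<lambda>p q. dist p q \<le> Max S) P [q]" using all assms Q by (simp add: trav_singleton_right)
      moreover have "trav (\<lambda>p q. dist p q \<le> Max S) [last P] Q" using all assms by (simp add: trav_singleton_left)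
      ultimately show ?thesis
        using trav_append_share_right[of _ "butlast P" "[]" q "[last P]" Q'] Q assms
          trav_append_share_left[of _ "butlast P" "last P" "[q]" "[]" Q']
        by (cases Q') (auto simp: trav_singleton_left)
    qed
    then show ?thesis using trav_imp_traversal by blast
  qed
  define S' where "S' = {\<delta> \<in> S. ?T \<delta>}"
  have "\<exists>x \<in> S'. True" using discrete[OF \<open>?T (Max S)\<close>] by (auto simp: S'_def)
  then have S': "finite S'" "S' \<noteq> {}" using S by (auto simp: S'_def)
  have "frechet_dist P Q = Min S'"
    unfolding frechet_dist_def
  proof (rule Least_equality)
    show "?T (Min S')" using Min_in[OF S'] by (simp add: S'_def)
    fix y assume "?T y"
    then obtain x where "x \<in> S" "x \<le> y" "?T x" using discrete by blast
    then have "x \<in> S'" by (simp add: S'_def)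
    then show "Min S' \<le> y" using Min_le[OF S'(1)] \<open>x \<le> y\<close> by force
  qed
  moreover have "?T (Min S')" using Min_in[OF S'] by (simp add: S'_def)
  moreover have "Min S' \<le> \<delta>" if "?T \<delta>"
  proof -
    obtain x where "x \<in> S" "x \<le> \<delta>" "?T x" using discrete \<open>?T \<delta>\<close> by blast
    then have "x \<in> S'" by (simp add: S'_def)
    then show ?thesis using Min_le[OF S'(1)] \<open>x \<le> \<delta>\<close> by force
  qed
  ultimately have "frechet_dist P Q \<le> \<delta> \<longleftrightarrow> ?T \<delta>" using mono[of "Min S'" \<delta>] by argo
  also have "\<dots> \<longleftrightarrow> trav (\<lambda>p q. dist p q \<le> \<delta>) P Q"
    using traversal_imp_trav[OF _ assms] trav_imp_traversal[OF _ refl] by blast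
  finally show ?thesis .
qed

section \<open>Combinatorial gadgets\<close>

lemma trav_and_gadget:
  assumes "\<And>p q. p \<in> set G1 \<Longrightarrow> q \<in> set H2 \<Longrightarrow> \<not> R p q"
    and "\<And>p q. p \<in> set G2 \<Longrightarrow> q \<in> set H1 \<Longrightarrow> \<not> R p q"
    and "G1 \<noteq> []" "G2 \<noteq> []" "H1 \<noteq> []" "H2 \<noteq> []"
  shows "trav R (G1 @ G2) (H1 @ H2) \<longleftrightarrow> trav R G1 H1 \<and> trav R G2 H2"
  using assms trav_split_fst[of R G1 G2 H1 H2] trav_append[of R G1 H1 G2 H2] by auto

text \<open>While one curve waits at \<open>\<alpha>\<close>, \<open>\<gamma>\<close>, \<open>\<alpha>'\<close> or \<open>\<gamma>'\<close>, the other one passes \<open>H2\<close>, \<open>H1\<close>, \<open>G1\<close> or \<open>G2\<close>,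
  respectively. The points \<open>u\<close>, \<open>u'\<close> allow either curve to start and to finish waiting.\<close>

lemma trav_or_gadget_if_fst:
  assumes "trav R G1 H1" "G2 \<noteq> []" "H2 \<noteq> []"
    and "R u u'" "R u \<alpha>'" "R u \<gamma>'" "R \<gamma> u'"
    and "\<And>q. q \<in> set H2 \<Longrightarrow> R \<alpha> q" "\<And>p. p \<in> set G2 \<Longrightarrow> R p \<gamma>'"
  shows "trav R (u # \<alpha> # G1 @ G2 @ [\<gamma>, u]) (u' # \<alpha>' # H2 @ H1 @ [\<gamma>', u'])"
proof -
  have "trav R [u] [u', \<alpha>']" "trav R [\<alpha>] H2" "trav R G2 [\<gamma>']" "trav R [\<gamma>, u] [u']"
    using assms by (simp_all add: trav_singleton_left trav_singleton_right)
  from trav_append[OF this(1) trav_append[OF this(2) trav_append[OF assms(1) trav_append[OF this(3,4)]]]]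
  show ?thesis by simp
qed

lemma trav_or_gadget_if_snd:
  assumes "trav R G2 H2" "G1 \<noteq> []" "H1 \<noteq> []"
    and "R u u'" "R u \<gamma>'" "R \<alpha> u'"
    and "\<And>p. p \<in> set G1 \<Longrightarrow> R p \<alpha>'" "\<And>q. q \<in> set H1 \<Longrightarrow> R \<gamma> q"
  shows "trav R (u # \<alpha> # G1 @ G2 @ [\<gamma>, u]) (u' # \<alpha>' # H2 @ H1 @ [\<gamma>', u'])"
proof -
  have "trav R [u, \<alpha>] [u']" "trav R G1 [\<alpha>']" "trav R [\<gamma>] H1" "trav R [u] [\<gamma>', u']"
    using assms by (simp_all add: trav_singleton_left trav_singleton_right)
  from trav_append[OF this(1) trav_append[OF this(2) trav_append[OF assms(1) trav_append[OF this(3,4)]]]]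
  show ?thesis by simp
qed

text \<open>No right vertex is close to both \<open>last G1\<close> and \<open>hd G2\<close>, so the
  path passes from \<open>G1\<close> to \<open>G2\<close> by a diagonal move. The right vertex
  before that move is close to \<open>last G1\<close>, which leaves \<open>\<alpha>'\<close> or a
  vertex of \<open>H1\<close>; the one after it is close to \<open>hd G2\<close>, which leaves a
  vertex of \<open>H2\<close> or \<open>\<gamma>'\<close>. In the order of the right curve this
  permits just two places for the move.\<close>

lemma trav_or_gadget_only_if:
  assumes tr: "trav R (u # \<alpha> # G1 @ G2 @ [\<gamma>, u]) (u' # \<alpha>' # H2 @ H1 @ [\<gamma>', u'])"
    and ne: "G1 \<noteq> []" "G2 \<noteq> []" "H1 \<noteq> []" "H2 \<noteq> []"
    and uH: "\<And>q. q \<in> set H1 \<union> set H2 \<Longrightarrow> \<not> R u q"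
    and \<alpha>H: "\<And>q. q \<in> set H1 \<Longrightarrow> \<not> R \<alpha> q" and \<gamma>H: "\<And>q. q \<in> set H2 \<Longrightarrow> \<not> R \<gamma> q"
    and GH: "\<And>p q. p \<in> set G1 \<Longrightarrow> q \<in> set H2 \<Longrightarrow> \<not> R p q" "\<And>p q. p \<in> set G2 \<Longrightarrow> q \<in> set H1 \<Longrightarrow> \<not> R p q"
    and Gu: "\<And>p. p \<in> set G1 \<union> set G2 \<Longrightarrow> \<not> R p u'"
    and G\<gamma>: "\<And>p. p \<in> set G1 \<Longrightarrow> \<not> R p \<gamma>'" and G\<alpha>: "\<And>p. p \<in> set G2 \<Longrightarrow> \<not> R p \<alpha>'"
  shows "trav R G1 H1 \<or> trav R G2 H2"
proof -
  have last1: "last G1 \<in> set G1" and hd2: "hd G2 \<in> set G2" using ne by auto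
  have "\<exists>Q1 Q2. trav R (u # \<alpha> # G1) Q1 \<and> trav R (G2 @ [\<gamma>, u]) Q2 \<and> u' # \<alpha>' # H2 @ H1 @ [\<gamma>', u'] = Q1 @ Q2"
  proof (rule trav_cut_diagonal)
    show "trav R ((u # \<alpha> # G1) @ G2 @ [\<gamma>, u]) (u' # \<alpha>' # H2 @ H1 @ [\<gamma>', u'])" using tr by simp
    fix q assume "q \<in> set (u' # \<alpha>' # H2 @ H1 @ [\<gamma>', u'])"
    then have "q = u' \<or> q = \<alpha>' \<or> q = \<gamma>' \<or> q \<in> set H1 \<or> q \<in> set H2" by auto
    then have "\<not> (R (last G1) q \<and> R (hd G2) q)"
      using last1 hd2 GH Gu G\<gamma> G\<alpha> by blast
    then show "\<not> (R (last (u # \<alpha> # G1)) q \<and> R (hd (G2 @ [\<gamma>, u])) q)" using ne by simp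
  qed auto
  then obtain Q1 Q2 where Q: "trav R (u # \<alpha> # G1) Q1" "trav R (G2 @ [\<gamma>, u]) Q2"
    "u' # \<alpha>' # H2 @ H1 @ [\<gamma>', u'] = Q1 @ Q2" by blast
  have l: "R (last G1) (last Q1)" and h: "R (hd G2) (hd Q2)"
    using trav_last[OF Q(1)] trav_hd[OF Q(2)] ne by auto
  have ne12: "Q1 \<noteq> []" "Q2 \<noteq> []" using Q by auto
  obtain X where X: "Q1 = u' # X" "\<alpha>' # H2 @ H1 @ [\<gamma>', u'] = X @ Q2"
    using Q(3) ne12 by (cases Q1) auto
  have "X \<noteq> []" using l Gu last1 X by auto
  then obtain Y where Y: "X = \<alpha>' # Y" "H2 @ H1 @ [\<gamma>', u'] = Y @ Q2"
    using X(2) by (cases X) auto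
  consider (a) "Y = []" | (b) us where "Y \<noteq> []" "H2 = Y @ us" "us @ H1 @ [\<gamma>', u'] = Q2"
    | (c) us where "Y = H2 @ us" "H1 @ [\<gamma>', u'] = us @ Q2"
    using Y(2) unfolding append_eq_append_conv2 by blast
  then show ?thesis
  proof cases
    \<comment> \<open>The move goes from \<open>\<alpha>'\<close> to the start of \<open>H2\<close>:
      \<open>G1\<close> has been bypassed, and \<open>G2\<close> starts together with
      \<open>H2\<close>.\<close>
    case a
    have "trav R G2 H2 \<and> trav R [\<gamma>, u] (H1 @ [\<gamma>', u'])"
    proof (rule trav_split_snd)
      show "trav R (G2 @ [\<gamma>, u]) (H2 @ H1 @ [\<gamma>', u'])" using Q(2) Y(2) a by simp
      show "\<not> R p q" if "p \<in> set [\<gamma>, u]" "q \<in> set H2" for p q using that uH \<gamma>H by auto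
      have "hd (H1 @ [\<gamma>', u']) \<in> set H1" using ne by simp
      then show "\<not> R p (hd (H1 @ [\<gamma>', u']))" if "p \<in> set G2" for p using that GH by blast
    qed (use ne in simp_all)
    then show ?thesis by blast
  next
    case b
    then have "last Q1 \<in> set H2" using X(1) Y(1) by simp
    then show ?thesis using l GH(1) last1 by blast
  next
    case c
    then consider (c1) zs where "H1 = us @ zs" "zs \<noteq> []" "zs @ [\<gamma>', u'] = Q2"
      | (c2) "us = H1" "Q2 = [\<gamma>', u']" | (c3) zs where "us = H1 @ zs" "zs @ Q2 = [\<gamma>', u']" "zs \<noteq> []"
      unfolding append_eq_append_conv2 by force
    then show ?thesis
    proof cases
      case c1
      then have "hd Q2 \<in> set H1" by (cases zs) auto
      then show ?thesis using h GH(2) hd2 by blast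
    next
      \<comment> \<open>The move goes from the end of \<open>H1\<close> to \<open>\<gamma>'\<close>:
        \<open>G2\<close> is bypassed, and \<open>G1\<close> ends together with
        \<open>H1\<close>.\<close>
      case c2
      have "trav R [u, \<alpha>] (u' # \<alpha>' # H2) \<and> trav R G1 H1"
      proof (rule trav_split_fst)
        show "trav R ([u, \<alpha>] @ G1) ((u' # \<alpha>' # H2) @ H1)" using Q(1) X(1) Y(1) c(1) c2(1) by simp
        show "\<not> R p q" if "p \<in> set [u, \<alpha>]" "q \<in> set H1" for p q using that uH \<alpha>H by auto
        have "last (u' # \<alpha>' # H2) \<in> set H2" using ne by simp
        then show "\<not> R p (last (u' # \<alpha>' # H2))" if "p \<in> set G1" for p using that GH by blast
      qed (use ne in simp_all)
      then show ?thesis by blast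
    next
      case c3
      then have "set zs \<subseteq> {\<gamma>', u'}" by (metis list.set(1) list.simps(15) set_append sup_ge1)
      moreover have "last Q1 = last zs" using X(1) Y(1) c(1) c3(1,3) by simp
      ultimately have "last Q1 \<in> {\<gamma>', u'}" using c3(3) last_in_set by fastforce
      then show ?thesis using l Gu G\<gamma> last1 by blast
    qed
  qed
qed

section \<open>Selecting one pair of blocks\<close>

lemma prefix_before_marker:
  assumes "xs @ y # zs = us @ vs" "y \<notin> set us"
  shows "\<exists>ws. xs = us @ ws"
proof -
  obtain ws where "xs = us @ ws \<and> ws @ y # zs = vs \<or> xs @ ws = us \<and> y # zs = ws @ vs"
    using iffD1[OF append_eq_append_conv2 assms(1)] by metis
  then show ?thesis using assms(2) by (cases ws) auto
qed

text \<open>Turns a vertex into a place in the curve: the marker occurs only at the start of a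
  block, so knowing that the path stands at a marker tells that a whole block lies ahead.\<close>

lemma concat_suffix_at_marker:
  assumes "concat (map (\<lambda>G. x # f G) gs) = X @ x # Y" "\<And>G. G \<in> set gs \<Longrightarrow> x \<notin> set (f G)"
  shows "\<exists>G gs'. G \<in> set gs \<and> set gs' \<subseteq> set gs \<and> Y = f G @ concat (map (\<lambda>G. x # f G) gs')"
  using assms
proof (induction gs arbitrary: X)
  case (Cons G gs)
  show ?case
  proof (cases X)
    case Nil
    then show ?thesis using Cons.prems(1) by (intro exI[of _ G] exI[of _ gs]) auto
  next
    case (Cons x' X')
    then have *: "f G @ concat (map (\<lambda>G. x # f G) gs) = X' @ x # Y" using Cons.prems(1) by auto
    have "x \<notin> set (f G)" using Cons.prems(2) by simp
    then obtain X'' where X'': "X' = f G @ X''"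
      using prefix_before_marker[OF *[symmetric]] by blast
    have "concat (map (\<lambda>G. x # f G) gs) = X'' @ x # Y"
      using * unfolding X'' append_assoc same_append_eq .
    from Cons.IH[OF this Cons.prems(2)[OF list.set_intros(2)]] show ?thesis
      unfolding list.set by blast
  qed
qed simp

text \<open>\<open>x\<close> stands for the vertex just before \<open>us\<close>, which lets the
  condition on the last vertex cover an empty \<open>us\<close> as well.\<close>

lemma prefix_past_marker:
  assumes "us @ vs = xs @ y # zs" "last (x # us) \<notin> insert x (set xs)"
  shows "\<exists>ws. us = xs @ y # ws"
proof -
  obtain ws where "us = xs @ ws \<and> ws @ vs = y # zs \<or> us @ ws = xs \<and> vs = ws @ y # zs"
    using iffD1[OF append_eq_append_conv2 assms(1)] by metis
  moreover have "\<not> us @ ws = xs"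
    using assms(2) by (cases us rule: rev_cases) auto
  moreover have "ws \<noteq> []" if "us = xs @ ws"
    using assms(2) that by (cases xs rule: rev_cases) auto
  ultimately show ?thesis by (cases ws) auto
qed

text \<open>\<open>S\<close> and \<open>T\<close> are close to the whole left curve, \<open>s\<close> and \<open>t\<close> to all right blocks, but \<open>S'\<close> only to \<open>s\<close>
  and \<open>T'\<close> only to \<open>t\<close>. Between \<open>S'\<close> and \<open>T'\<close> the left curve therefore gets from an \<open>s\<close> to a later \<open>t\<close>
  and crosses a left block, which the guards \<open>g\<close>, \<open>g'\<close> synchronize with a right block.\<close>

lemma trav_choice_only_if:
  fixes gs :: "'p list list" and hs :: "'q list list"
  assumes tr: "trav R (concat (map (\<lambda>G. s # g # G @ [g', t]) gs))
      (S # S' # concat (map (\<lambda>H. h # H @ [h']) hs) @ [T', T])"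
    and ne: "\<And>G. G \<in> set gs \<Longrightarrow> G \<noteq> []" "\<And>H. H \<in> set hs \<Longrightarrow> H \<noteq> []"
    and S': "R s S'" "\<And>p. p \<in> {g, g', t} \<union> \<Union> (set ` set gs) \<Longrightarrow> \<not> R p S'"
    and T': "\<And>p. p \<in> {s, g, g'} \<union> \<Union> (set ` set gs) \<Longrightarrow> \<not> R p T'"
    and g: "R g h" "\<And>q. q \<in> insert h' (\<Union> (set ` set hs)) \<Longrightarrow> \<not> R g q"
    and h: "\<And>p. p \<in> insert g' (\<Union> (set ` set gs)) \<Longrightarrow> \<not> R p h"
    and g': "\<And>q. q \<in> insert h (\<Union> (set ` set hs)) \<Longrightarrow> \<not> R g' q"
    and h': "\<And>p. p \<in> insert g (\<Union> (set ` set gs)) \<Longrightarrow> \<not> R p h'"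
  shows "\<exists>G \<in> set gs. \<exists>H \<in> set hs. trav R G H"
proof -
  let ?P = "concat (map (\<lambda>G. s # g # G @ [g', t]) gs)"
  let ?Hs = "concat (map (\<lambda>H. h # H @ [h']) hs)"
  \<comment> \<open>The cut is made in the right curve, hence the flip. \<open>P'\<close> is what
    the left curve traverses from the moment the right curve stands at \<open>S'\<close>; among the
    left vertices only \<open>s\<close> can be close to \<open>S'\<close>.\<close>
  have "trav (\<lambda>q p. R p q) ([S] @ S' # ?Hs @ [T', T]) ?P"
    using iffD1[OF trav_flip tr] by simp
  then have "cut (\<lambda>q p. R p q) [S] (S' # ?Hs @ [T', T]) ?P" by (rule trav_cut) auto
  then obtain X P' where P': "trav (\<lambda>q p. R p q) (S' # ?Hs @ [T', T]) P'" "?P = X @ P'"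
    unfolding cut_def by blast
  have P'1: "trav R P' (S' # ?Hs @ [T', T])" using iffD2[OF trav_flip P'(1)] .
  obtain p Y where pY: "P' = p # Y" using P'1 by (cases P') auto
  have "R p S'" using trav_hd[OF P'1] pY by simp
  moreover have "p \<in> set ?P" using P' pY by simp
  ultimately have "p = s" using S'(2) by (auto split: if_splits)
  have "s \<notin> set (g # G @ [g', t])" if "G \<in> set gs" for G using S' that by auto
  then obtain G gs' where G: "G \<in> set gs" "Y = (g # G @ [g', t]) @ concat (map (\<lambda>G. s # g # G @ [g', t]) gs')"
    using concat_suffix_at_marker[of s "\<lambda>G. g # G @ [g', t]" gs X Y] P'(2) pY \<open>p = s\<close> by blast
  have "cut R (s # g # G @ [g']) (t # concat (map (\<lambda>G. s # g # G @ [g', t]) gs')) (S' # ?Hs @ [T', T])"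
    by (rule trav_cut) (use P'1 pY G \<open>p = s\<close> in auto)
  then obtain Q1 Z where Q1: "trav R (s # g # G @ [g']) Q1" "S' # ?Hs @ [T', T] = Q1 @ Z"
    unfolding cut_def by fastforce
  \<comment> \<open>Only \<open>t\<close> can be close to \<open>T'\<close>. Up to the end of the
    current left block the right curve has thus not reached \<open>T'\<close> and is still among its
    blocks.\<close>
  have "T' \<notin> set Q1" using trav_covers_right[OF Q1(1)] T' G(1) by fastforce
  obtain Q1' where Q1': "Q1 = S' # Q1'" "?Hs @ [T', T] = Q1' @ Z" using Q1 by (cases Q1) auto
  obtain Z' where Z': "?Hs = Q1' @ Z'"
    using prefix_before_marker[OF Q1'(2)] \<open>T' \<notin> set Q1\<close> Q1'(1) by auto
  have "cut R [s] (g # G @ [g']) (S' # Q1')"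
    by (rule trav_cut) (use Q1(1) Q1' in auto)
  then obtain W Q2 where Q2: "trav R (g # G @ [g']) Q2" "S' # Q1' = W @ Q2"
    unfolding cut_def by fastforce
  have "S' \<notin> set Q2" using trav_covers_right[OF Q2(1)] S'(2) G(1) by fastforce
  then obtain W' where W': "Q1' = W' @ Q2" using Q2 by (cases W) auto
  obtain q V where qV: "Q2 = q # V" using Q2 by (cases Q2) auto
  have "?Hs = W' @ (q # V) @ Z'" using W' Z' qV by simp
  then have "q \<in> set ?Hs" by (simp only: set_append list.set) simp
  then have sub: "q = h \<or> q = h' \<or> (\<exists>H \<in> set hs. q \<in> set H)" by (auto split: if_splits)
  have "R g q" using trav_hd[OF Q2(1)] qV by simp
  then have "q = h" using g(2) sub by auto
  have "h \<notin> set (H @ [h'])" if "H \<in> set hs" for H using g that by auto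
  then obtain H hs' where H: "H \<in> set hs" "V @ Z' = (H @ [h']) @ concat (map (\<lambda>H. h # H @ [h']) hs')"
    using concat_suffix_at_marker[of h "\<lambda>H. H @ [h']" hs W' "V @ Z'"] W' Z' qV \<open>q = h\<close> by auto
  have "R g' (last Q2)" using trav_last[OF Q2(1)] by simp
  \<comment> \<open>\<open>g'\<close> is close neither to \<open>h\<close> nor to a vertex of
    \<open>H\<close>, so when the left block ends, the right curve must have gone on to
    \<open>h'\<close>.\<close>
  then have lastQ2: "last Q2 \<notin> insert h (set H)" using g' H(1) by auto
  have "V @ Z' = H @ h' # concat (map (\<lambda>H. h # H @ [h']) hs')" using H(2) by simp
  then obtain V' where V': "V = H @ h' # V'"
    using prefix_past_marker[of V Z' H h'] lastQ2 qV \<open>q = h\<close> by blast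
  \<comment> \<open>The guards are peeled off: \<open>g'\<close> together with everything from
    \<open>h'\<close> on, and afterwards the pair \<open>g\<close>, \<open>h\<close>.\<close>
  have "trav R (g # G) (h # H) \<and> trav R [g'] (h' # V')"
  proof (rule trav_split_snd)
    show "trav R ((g # G) @ [g']) ((h # H) @ h' # V')" using Q2(1) qV V' \<open>q = h\<close> by simp
    show "\<not> R p q" if "p \<in> set [g']" "q \<in> set (h # H)" for p q
      using that g'[of q] H(1) by auto
    show "\<not> R p (hd (h' # V'))" if "p \<in> set (g # G)" for p
      using that h'[of p] G(1) by auto
  qed simp_all
  then have "trav R ([g] @ G) ([h] @ H)" by simp
  then have "trav R [g] [h] \<and> trav R G H"
  proof (rule trav_split_fst)
    show "\<not> R p q" if "p \<in> set [g]" "q \<in> set H" for p q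
      using that g(2)[of q] H(1) by auto
    show "\<not> R p (last [h])" if "p \<in> set G" for p
      using that h[of p] G(1) by auto
  qed (use ne G(1) H(1) in simp_all)
  then show ?thesis using G(1) H(1) by blast
qed

text \<open>The right curve waits at \<open>S\<close> until the left one is at the \<open>s\<close>
  before \<open>G\<close>; the left curve waits there until the right one is before
  \<open>H\<close>. Both blocks are crossed together, and the exit is symmetric with waits at
  \<open>t\<close> and \<open>T\<close>.\<close>

lemma trav_choice_if:
  assumes tr: "trav R G H" and G: "G \<in> set gs" and H: "H \<in> set hs"
    and S: "\<And>p. p \<in> {s, g, g', t} \<union> \<Union> (set ` set gs) \<Longrightarrow> R p S \<and> R p T"
    and st: "R s S'" "R t T'" "\<And>q. q \<in> {h, h'} \<union> \<Union> (set ` set hs) \<Longrightarrow> R s q \<and> R t q"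
    and gh: "R g h" "R g' h'"
  shows "trav R (concat (map (\<lambda>G. s # g # G @ [g', t]) gs))
      (S # S' # concat (map (\<lambda>H. h # H @ [h']) hs) @ [T', T])"
proof -
  obtain gs1 gs2 where gs: "gs = gs1 @ G # gs2" using G by (meson split_list)
  obtain hs1 hs2 where hs: "hs = hs1 @ H # hs2" using H by (meson split_list)
  let ?P = "\<lambda>gs. concat (map (\<lambda>G. s # g # G @ [g', t]) gs)"
  let ?Q = "\<lambda>hs. concat (map (\<lambda>H. h # H @ [h']) hs)"
  have 1: "trav R (?P gs1 @ [s]) [S]" using S gs by (auto simp: trav_singleton_right)
  have 2: "trav R [s] (S' # ?Q hs1)" using st hs by (auto simp: trav_singleton_left)
  have 3: "trav R (?P gs1 @ [s]) (S # S' # ?Q hs1)"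
    using trav_append_share_left[OF 1 2] by simp
  have "trav R ([g] @ G @ [g']) ([h] @ H @ [h'])"
    by (intro trav_append tr) (use gh in auto)
  note 4 = trav_append[OF 3 this]
  have 5: "trav R [t] (?Q hs2 @ [T'])" using st hs by (auto simp: trav_singleton_left)
  have 6: "trav R (t # ?P gs2) [T]" using S gs by (auto simp: trav_singleton_right)
  have 7: "trav R (t # ?P gs2) (?Q hs2 @ [T', T])"
    using trav_append_share_left[of R "[]" t "?Q hs2 @ [T']" "?P gs2" "[T]"] 5 6 by simp
  show ?thesis using trav_append[OF 4 7] by (simp add: gs hs)
qed

section \<open>Geometric realization\<close>

text \<open>\<open>a \<le> b\<close> iff \<open>2 a - (2 b + 1) < 0\<close>, and the left-hand side is never 0. The scale \<open>K\<close> keeps the entries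
  of the vectors negligible compared to the gaps between positions.\<close>

definition leaf_pt :: "bool \<Rightarrow> int \<Rightarrow> int \<Rightarrow> int \<Rightarrow> int \<times> int" where
  "leaf_pt left K j v = (4 * K * j, 2 * v + (if left then 0 else 1))"

text \<open>The circle over the interval from \<open>l - 1/2\<close> to \<open>r + 1/2\<close>,
  magnified by \<open>4 * K\<close>: its center is \<open>2 * K * (l + r)\<close>, its radius
  \<open>2 * K * (r - l + 1)\<close>, and the second coordinate is half the squared radius up to
  sign. The widening by 1/2 makes disjoint integer intervals at worst touch and puts end points
  strictly inside.\<close>

definition interval_pt :: "bool \<Rightarrow> int \<Rightarrow> int \<Rightarrow> int \<Rightarrow> int \<times> int" where
  "interval_pt left K l r = (2 * K * (l + r), (if left then - 1 else 1) * (2 * K\<^sup>2 * (r - l + 1)\<^sup>2))"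

text \<open>Distance at most 1, with denominators cleared.\<close>

definition near :: "int \<Rightarrow> int \<times> int \<Rightarrow> int \<times> int \<Rightarrow> bool" where
  "near D p q \<longleftrightarrow> D\<^sup>2 * ((fst p - fst q)\<^sup>2 + 2 * (snd p - snd q)) + (snd p - snd q)\<^sup>2 \<le> 0"

abbreviation csize :: "formula \<Rightarrow> nat" where
  "csize f \<equiv> length (prefix_code f)"

text \<open>Positions are read off the prefix code: the leaf at index \<open>n\<close> is at \<open>2 n\<close>. If the right child of an
  OR gate starts at index \<open>j\<close>, then the odd position \<open>2 j - 1\<close> separates it from the left child, and
  the two intervals of the gate overlap only there.\<close>

fun gadget :: "bool \<Rightarrow> int \<Rightarrow> int list \<Rightarrow> formula \<Rightarrow> nat \<Rightarrow> (int \<times> int) list" where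
  "gadget left K v (Var i) n = [leaf_pt left K (2 * int n) (v ! i)]"
| "gadget left K v (And f g) n = gadget left K v f (Suc n) @ gadget left K v g (Suc n + csize f)"
| "gadget left K v (Or f g) n =
     (let j = Suc n + csize f; e = j + csize g;
          u = leaf_pt left K (2 * int j - 1) 0;
          fst_iv = interval_pt left K (2 * int n + 2) (2 * int j - 1);
          snd_iv = interval_pt left K (2 * int j - 1) (2 * int e - 2)
      in if left
         then u # snd_iv # gadget left K v f (Suc n) @ gadget left K v g j @ [fst_iv, u]
         else u # fst_iv # gadget left K v g j @ gadget left K v f (Suc n) @ [snd_iv, u])"

section \<open>Location of gadget points on the number line\<close>

definition zone :: "bool \<Rightarrow> int \<Rightarrow> int \<Rightarrow> int \<Rightarrow> int \<Rightarrow> int \<times> int \<Rightarrow> bool" where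
  "zone left K M l r p \<longleftrightarrow>
     (\<exists>j v. l \<le> j \<and> j \<le> r \<and> \<bar>v\<bar> \<le> M \<and> p = leaf_pt left K j v) \<or>
     (\<exists>l' r'. l \<le> l' \<and> l' \<le> r' \<and> r' \<le> r \<and> p = interval_pt left K l' r')"

lemma zone_leaf: "l \<le> j \<Longrightarrow> j \<le> r \<Longrightarrow> \<bar>v\<bar> \<le> M \<Longrightarrow> zone left K M l r (leaf_pt left K j v)"
  unfolding zone_def by blast

lemma zone_interval: "l \<le> l' \<Longrightarrow> l' \<le> r' \<Longrightarrow> r' \<le> r \<Longrightarrow> zone left K M l r (interval_pt left K l' r')"
  unfolding zone_def by blast

lemma zone_mono:
  assumes "zone left K M l r p" "l' \<le> l" "r \<le> r'"
  shows "zone left K M l' r' p"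
  using assms(1) unfolding zone_def[of _ _ _ l r]
  by (elim disjE exE conjE) (use assms(2,3) in \<open>auto intro!: zone_leaf zone_interval\<close>)

lemma csize_pos: "0 < csize f"
  by (cases f) auto

lemma gadget_nonempty: "gadget left K v f n \<noteq> []"
  by (induction f arbitrary: n) (auto simp: Let_def)

text \<open>The zone spans the positions of the symbols of \<open>f\<close>, two units per symbol.
  Zones of siblings are therefore disjoint, and the odd position between them stays free for the
  separator of an OR gate.\<close>

lemma gadget_zone:
  assumes "\<And>i. i \<in> set (leaves f) \<Longrightarrow> \<bar>v ! i\<bar> \<le> M" "0 \<le> M" "p \<in> set (gadget left K v f n)"
  shows "zone left K M (2 * int n) (2 * int (n + csize f) - 2) p"
  using assms
proof (induction f arbitrary: n)
  case (Var i)
  then show ?case by (auto intro!: zone_leaf)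
next
  case (And f g)
  then consider "p \<in> set (gadget left K v f (Suc n))" | "p \<in> set (gadget left K v g (Suc n + csize f))"
    by auto
  then show ?case
  proof cases
    case 1
    show ?thesis by (rule zone_mono[OF And.IH(1)[OF And.prems(1,2) 1]]) auto
  next
    case 2
    show ?thesis by (rule zone_mono[OF And.IH(2)[OF And.prems(1,2) 2]]) auto
  qed
next
  case (Or f g)
  define j where "j = Suc n + csize f"
  define e where "e = j + csize g"
  have e: "e = n + csize (Or f g)" and "n < j" "j < e"
    using csize_pos[of g] by (auto simp: e_def j_def)
  have "p \<in> {leaf_pt left K (2 * int j - 1) 0, interval_pt left K (2 * int n + 2) (2 * int j - 1),
      interval_pt left K (2 * int j - 1) (2 * int e - 2)} \<union> set (gadget left K v f (Suc n)) \<union> set (gadget left K v g j)"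
    using Or.prems(3) by (auto simp: Let_def j_def e_def split: if_splits)
  then consider "p = leaf_pt left K (2 * int j - 1) 0" | "p = interval_pt left K (2 * int n + 2) (2 * int j - 1)"
    | "p = interval_pt left K (2 * int j - 1) (2 * int e - 2)"
    | "p \<in> set (gadget left K v f (Suc n))" | "p \<in> set (gadget left K v g j)"
    by blast
  then show ?case unfolding e[symmetric]
  proof cases
    case 4
    show "zone left K M (2 * int n) (2 * int e - 2) p"
      by (rule zone_mono[OF Or.IH(1)[OF Or.prems(1,2) 4]]) (auto simp: e_def j_def)
  next
    case 5
    show "zone left K M (2 * int n) (2 * int e - 2) p"
      by (rule zone_mono[OF Or.IH(2)[OF Or.prems(1,2) 5]]) (auto simp: e_def j_def)
  next
    case 1
    then show "zone left K M (2 * int n) (2 * int e - 2) p"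
      using \<open>n < j\<close> \<open>j < e\<close> Or.prems(2) by (auto intro!: zone_leaf)
  next
    case 2
    have "n + 1 < j" using csize_pos[of f] by (simp add: j_def)
    with 2 show "zone left K M (2 * int n) (2 * int e - 2) p"
      using \<open>j < e\<close> by (auto intro!: zone_interval)
  next
    case 3
    then show "zone left K M (2 * int n) (2 * int e - 2) p"
      using \<open>n < j\<close> \<open>j < e\<close> by (auto intro!: zone_interval)
  qed
qed

text \<open>With centers and radii doubled, \<open>x\<close> and \<open>y\<close> are the radii of
  the widened intervals. Disjointness puts the centers at least \<open>x + y\<close> apart, and
  \<open>x\<^sup>2 + y\<^sup>2 < (x + y)\<^sup>2\<close>.\<close>

lemma apart_centers:
  fixes l r l' r' :: int
  assumes "l \<le> r" "l' \<le> r'" "r < l' \<or> r' < l"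
  shows "(r - l + 1)\<^sup>2 + (r' - l' + 1)\<^sup>2 < (l + r - l' - r')\<^sup>2"
proof -
  define x y where "x = r - l + 1" and "y = r' - l' + 1"
  have "\<bar>x + y\<bar> \<le> \<bar>l + r - l' - r'\<bar>" using assms unfolding x_def y_def by linarith
  then have "(x + y)\<^sup>2 \<le> (l + r - l' - r')\<^sup>2" by (simp only: abs_le_square_iff)
  moreover have "0 < x * y" using assms by (simp add: x_def y_def)
  ultimately show ?thesis unfolding x_def[symmetric] y_def[symmetric] by (simp add: power2_sum)
qed

lemma outside_center:
  fixes l r j :: int
  assumes "l \<le> r" "j < l \<or> r < j"
  shows "(r - l + 1)\<^sup>2 < (j + j - l - r)\<^sup>2"
proof -
  have "\<bar>r - l + 1\<bar> < \<bar>j + j - l - r\<bar>" using assms by linarith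
  then show ?thesis by (metis abs_le_square_iff linorder_not_le)
qed

lemma nested_centers:
  fixes l r l' r' :: int
  assumes "l \<le> l'" "l' \<le> r'" "r' \<le> r"
  shows "(l + r - l' - r')\<^sup>2 < (r - l + 1)\<^sup>2"
proof -
  have "\<bar>l + r - l' - r'\<bar> < \<bar>r - l + 1\<bar>" using assms by linarith
  then show ?thesis by (metis abs_le_square_iff linorder_not_le)
qed

text \<open>A strict inequality between squares of positions is worth at least
  \<open>4 * K\<^sup>2\<close>, more than the vector entry in \<open>w\<close> can take
  away.\<close>

lemma scaled_pos:
  fixes K n w :: int
  assumes "0 < n" "\<bar>w\<bar> < 4 * K" "0 < K"
  shows "0 < 4 * K\<^sup>2 * n + w"
proof -
  have "K * 1 \<le> K * (K * n)" using assms by (intro mult_left_mono) (auto simp: int_one_le_iff_zero_less)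
  then show ?thesis using assms(2) by (simp add: power2_eq_square algebra_simps)
qed

text \<open>\<open>K = M + 1\<close> makes terms such as \<open>4 * v - 2\<close> smaller than
  \<open>4 * K\<close> in absolute value. \<open>C\<close> will be the number of symbols of the
  formula, so \<open>h\<close> is the order of magnitude of squared first coordinates. All second
  coordinates of the curves will lie between \<open>- 50 * h\<close> and \<open>40 * h\<close>;
  their differences stay below \<open>D\<close>.\<close>

locale scaled_grid =
  fixes K M C h D :: int
  assumes M: "0 \<le> M" and C: "1 \<le> C" and K: "K = M + 1" and h: "h = (K * C)\<^sup>2" and D: "D = 100 * h"
begin

lemma K_pos: "0 < K" using M K by simp

lemma K_le_h: "K \<le> h"
proof -
  have "K * 1 \<le> K * (C * (K * C))" using C K_pos
    by (intro mult_left_mono) (auto simp: int_one_le_iff_zero_less)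
  then show ?thesis by (simp add: h power2_eq_square algebra_simps)
qed

lemma D_pos: "0 < D" using K_pos K_le_h D by simp

text \<open>A negative integer is at most \<open>- 1\<close>; multiplied by \<open>D\<^sup>2\<close>
  it cancels the remaining square.\<close>

lemma near_if:
  assumes "\<bar>snd p - snd q\<bar> \<le> D" "(fst p - fst q)\<^sup>2 + 2 * (snd p - snd q) < 0"
  shows "near D p q"
proof -
  have "D\<^sup>2 * ((fst p - fst q)\<^sup>2 + 2 * (snd p - snd q)) \<le> D\<^sup>2 * (- 1)"
    using assms(2) by (intro mult_left_mono) auto
  moreover have "(snd p - snd q)\<^sup>2 \<le> D\<^sup>2" using assms(1) D_pos by (simp flip: abs_le_square_iff)
  ultimately show ?thesis by (simp add: near_def)
qed

text \<open>The remaining square only adds to the distance, so no size bound is needed here. The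
  borderline value 0 is left open by both criteria and has to be avoided by the
  construction.\<close>

lemma not_near_if:
  assumes "(fst p - fst q)\<^sup>2 + 2 * (snd p - snd q) > 0"
  shows "\<not> near D p q"
proof -
  have "0 < D\<^sup>2 * ((fst p - fst q)\<^sup>2 + 2 * (snd p - snd q))" using assms D_pos by simp
  then show ?thesis unfolding near_def by (smt (verit) zero_le_power2)
qed

text \<open>Positions run from -1 to \<open>2 * C - 1\<close>, guards included. So
  \<open>r' - l' + 1 \<le> 3 * C\<close>, and
  \<open>2 * K\<^sup>2 * (3 * C)\<^sup>2 = 18 * h\<close>. The one-sided bounds hold because
  interval points lie below 0 on the left curve and above 0 on the right one; only leaves can have
  the opposite sign. The \<open>+ 1\<close> leaves room for the first coordinates \<open>- 1\<close>
  and \<open>1\<close> of the end points.\<close>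

lemma zone_bounds:
  assumes "zone left K M l r p" "- 1 \<le> l" "r \<le> 2 * C - 1"
  shows "\<bar>fst p\<bar> + 1 \<le> 8 * (K * C)" "\<bar>snd p\<bar> \<le> 18 * h"
    "left \<Longrightarrow> snd p \<le> 2 * K" "\<not> left \<Longrightarrow> - 2 * K \<le> snd p"
proof -
  have scale: "2 * K * \<bar>n\<bar> + 1 \<le> 8 * (K * C)" if "\<bar>n\<bar> \<le> 4 * C - 2" for n
  proof -
    have "K * \<bar>n\<bar> \<le> K * (4 * C - 2)" using that K_pos by (intro mult_left_mono) auto
    then show ?thesis using K_pos by (simp add: algebra_simps)
  qed
  from assms(1) consider (leaf) j v where "l \<le> j" "j \<le> r" "\<bar>v\<bar> \<le> M" "p = leaf_pt left K j v"
    | (interval) l' r' where "l \<le> l'" "l' \<le> r'" "r' \<le> r" "p = interval_pt left K l' r'"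
    unfolding zone_def by blast
  then have "\<bar>fst p\<bar> + 1 \<le> 8 * (K * C) \<and> \<bar>snd p\<bar> \<le> 18 * h \<and>
    (left \<longrightarrow> snd p \<le> 2 * K) \<and> (\<not> left \<longrightarrow> - 2 * K \<le> snd p)"
  proof cases
    case leaf
    have "\<bar>fst p\<bar> = 2 * K * \<bar>2 * j\<bar>" using leaf(4) K_pos by (simp add: leaf_pt_def abs_mult)
    then have "\<bar>fst p\<bar> + 1 \<le> 8 * (K * C)" using scale[of "2 * j"] leaf assms C by simp
    moreover have "\<bar>snd p\<bar> \<le> 2 * K" using leaf K by (auto simp: leaf_pt_def)
    ultimately show ?thesis using K_le_h K_pos by linarith
  next
    case interval
    have 1: "\<bar>fst p\<bar> = 2 * K * \<bar>l' + r'\<bar>" using interval(4) K_pos by (simp add: interval_pt_def abs_mult)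
    have "\<bar>fst p\<bar> + 1 \<le> 8 * (K * C)" unfolding 1 by (rule scale) (use interval assms C in linarith)
    moreover have "(r' - l' + 1)\<^sup>2 \<le> (3 * C)\<^sup>2"
      by (rule power_mono) (use interval assms C in linarith)+
    then have "2 * K\<^sup>2 * (r' - l' + 1)\<^sup>2 \<le> 2 * K\<^sup>2 * (3 * C)\<^sup>2" by (intro mult_left_mono) auto
    then have "\<bar>snd p\<bar> \<le> 18 * h"
      using interval(4) by (simp add: interval_pt_def h power_mult_distrib abs_mult)
    moreover have "left \<longrightarrow> snd p \<le> 2 * K" "\<not> left \<longrightarrow> - 2 * K \<le> snd p"
    proof -
      define w where "w = 2 * K\<^sup>2 * (r' - l' + 1)\<^sup>2"
      have "0 \<le> w" by (simp add: w_def)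
      then show "left \<longrightarrow> snd p \<le> 2 * K" "\<not> left \<longrightarrow> - 2 * K \<le> snd p"
        using interval(4) K_pos unfolding interval_pt_def w_def[symmetric] by auto
    qed
    ultimately show ?thesis by blast
  qed
  then show "\<bar>fst p\<bar> + 1 \<le> 8 * (K * C)" "\<bar>snd p\<bar> \<le> 18 * h"
    "left \<Longrightarrow> snd p \<le> 2 * K" "\<not> left \<Longrightarrow> - 2 * K \<le> snd p" by auto
qed

lemma zone_apart:
  assumes p: "zone True K M l r p" and q: "zone False K M l' r' q" and apart: "r < l' \<or> r' < l"
  shows "\<not> near D p q"
proof (rule not_near_if)
  from p consider (pl) j v where "l \<le> j" "j \<le> r" "\<bar>v\<bar> \<le> M" "p = leaf_pt True K j v"
    | (pi) l1 r1 where "l \<le> l1" "l1 \<le> r1" "r1 \<le> r" "p = interval_pt True K l1 r1"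
    unfolding zone_def by blast
  note P = this
  from q consider (ql) j v where "l' \<le> j" "j \<le> r'" "\<bar>v\<bar> \<le> M" "q = leaf_pt False K j v"
    | (qi) l1 r1 where "l' \<le> l1" "l1 \<le> r1" "r1 \<le> r'" "q = interval_pt False K l1 r1"
    unfolding zone_def by blast
  note Q = this
  show "0 < (fst p - fst q)\<^sup>2 + 2 * (snd p - snd q)"
  proof (cases rule: P)
    case (pl j v)
    show ?thesis
    proof (cases rule: Q)
      case (ql j' v')
      have "1 \<le> \<bar>j - j'\<bar>" using pl ql apart by linarith
      then have "1\<^sup>2 \<le> (j - j')\<^sup>2" by (simp only: abs_le_square_iff[symmetric])
      \<comment> \<open>The two entries together may exceed \<open>4 * K\<close>, so each of them
        gets one half of \<open>16 * K\<^sup>2 * (j - j')\<^sup>2\<close>.\<close>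
      then have "0 < 4 * K\<^sup>2 * (2 * (j - j')\<^sup>2) + (4 * v - 2)"
        by (intro scaled_pos) (use pl K K_pos in auto)
      moreover have "0 < 4 * K\<^sup>2 * (2 * (j - j')\<^sup>2) + (- 4 * v')"
        by (intro scaled_pos) (use \<open>1\<^sup>2 \<le> (j - j')\<^sup>2\<close> ql K K_pos in auto)
      ultimately show ?thesis using pl ql
        by (simp add: leaf_pt_def power2_eq_square algebra_simps)
    next
      case (qi l1 r1)
      have "0 < 4 * K\<^sup>2 * ((j + j - l1 - r1)\<^sup>2 - (r1 - l1 + 1)\<^sup>2) + 4 * v"
        using outside_center[of l1 r1 j] pl qi apart K K_pos by (intro scaled_pos) auto
      then show ?thesis using pl qi
        by (simp add: leaf_pt_def interval_pt_def power2_eq_square algebra_simps)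
    qed
  next
    case (pi l1 r1)
    show ?thesis
    proof (cases rule: Q)
      case (ql j v)
      have "0 < 4 * K\<^sup>2 * ((j + j - l1 - r1)\<^sup>2 - (r1 - l1 + 1)\<^sup>2) + (- 4 * v - 2)"
        using outside_center[of l1 r1 j] pi ql apart K K_pos by (intro scaled_pos) auto
      then show ?thesis using pi ql
        by (simp add: leaf_pt_def interval_pt_def power2_eq_square algebra_simps)
    next
      case (qi l2 r2)
      have "0 < 4 * K\<^sup>2 * ((l1 + r1 - l2 - r2)\<^sup>2 - (r1 - l1 + 1)\<^sup>2 - (r2 - l2 + 1)\<^sup>2) + 0"
        using apart_centers[of l1 r1 l2 r2] pi qi apart K K_pos by (intro scaled_pos) auto
      then show ?thesis using pi qi
        by (simp add: interval_pt_def power2_eq_square algebra_simps)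
    qed
  qed
qed

text \<open>This is closeness to the interval point of \<open>l\<close>, \<open>r\<close> on the
  opposite curve, stated for both curves at once. The inner center is nearer than the outer radius,
  and an inner radius only helps.\<close>

lemma zone_inside:
  assumes "zone left K M l r p"
  shows "(fst p - 2 * K * (l + r))\<^sup>2 + (if left then 2 else - 2) * snd p < 4 * K\<^sup>2 * (r - l + 1)\<^sup>2"
proof -
  from assms consider (leaf) j v where "l \<le> j" "j \<le> r" "\<bar>v\<bar> \<le> M" "p = leaf_pt left K j v"
    | (interval) l' r' where "l \<le> l'" "l' \<le> r'" "r' \<le> r" "p = interval_pt left K l' r'"
    unfolding zone_def by blast
  then show ?thesis
  proof cases
    case leaf
    have "0 < 4 * K\<^sup>2 * ((r - l + 1)\<^sup>2 - (l + r - j - j)\<^sup>2) + (if left then - 4 * v else 4 * v + 2)"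
      using nested_centers[of l j j r] leaf K K_pos by (intro scaled_pos) auto
    then show ?thesis using leaf(4)
      by (cases left) (simp_all add: leaf_pt_def power2_eq_square algebra_simps)
  next
    case interval
    have "0 < 4 * K\<^sup>2 * ((r - l + 1)\<^sup>2 - (l + r - l' - r')\<^sup>2 + (r' - l' + 1)\<^sup>2) + 0"
      using nested_centers[of l l' r' r] interval K K_pos zero_le_power2[of "r' - l' + 1"]
      by (intro scaled_pos) linarith+
    then show ?thesis using interval(4)
      by (cases left) (simp_all add: interval_pt_def power2_eq_square algebra_simps)
  qed
qed

lemma near_interval_right:
  assumes p: "zone True K M l r p" and lr: "- 1 \<le> l" "l \<le> r" "r \<le> 2 * C - 1"
  shows "near D p (interval_pt False K l r)"
proof (rule near_if)
  have "zone False K M l r (interval_pt False K l r)" by (rule zone_interval) (use lr in auto)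
  then show "\<bar>snd p - snd (interval_pt False K l r)\<bar> \<le> D"
    using zone_bounds(2)[OF p lr(1,3)] zone_bounds(2)[OF _ lr(1,3)] D by fastforce
qed (use zone_inside[OF p] in \<open>simp add: interval_pt_def\<close>)

lemma near_interval_left:
  assumes q: "zone False K M l r q" and lr: "- 1 \<le> l" "l \<le> r" "r \<le> 2 * C - 1"
  shows "near D (interval_pt True K l r) q"
proof (rule near_if)
  have "zone True K M l r (interval_pt True K l r)" by (rule zone_interval) (use lr in auto)
  then show "\<bar>snd (interval_pt True K l r) - snd q\<bar> \<le> D"
    using zone_bounds(2)[OF q lr(1,3)] zone_bounds(2)[OF _ lr(1,3)] D by fastforce
qed (use zone_inside[OF q] in \<open>simp add: interval_pt_def power2_commute\<close>)

lemma near_leaf_iff: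
  assumes "\<bar>a\<bar> \<le> M" "\<bar>b\<bar> \<le> M"
  shows "near D (leaf_pt True K j a) (leaf_pt False K j b) \<longleftrightarrow> a \<le> b"
proof (cases "a \<le> b")
  case True
  have "near D (leaf_pt True K j a) (leaf_pt False K j b)"
    by (rule near_if) (use True assms K K_le_h K_pos D in \<open>auto simp: leaf_pt_def\<close>)
  with True show ?thesis by simp
next
  case False
  have "\<not> near D (leaf_pt True K j a) (leaf_pt False K j b)"
    by (rule not_near_if) (use False in \<open>auto simp: leaf_pt_def\<close>)
  with False show ?thesis by simp
qed

end

section \<open>Correctness of the gadgets and of the choice of vectors\<close>

context scaled_grid begin

text \<open>For OR, the waiting points \<open>\<alpha>\<close> and \<open>\<gamma>'\<close> are the
  interval of the second child, \<open>\<gamma>\<close> and \<open>\<alpha>'\<close> that of the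
  first. Each contains the zone of its child and the separator, hence is close to that child and to
  \<open>u\<close> or \<open>u'\<close> of the other curve, and it is disjoint from the zone of the
  other child.\<close>

lemma gadget_correct:
  assumes "\<And>i. i \<in> set (leaves f) \<Longrightarrow> \<bar>a ! i\<bar> \<le> M" "\<And>i. i \<in> set (leaves f) \<Longrightarrow> \<bar>b ! i\<bar> \<le> M"
    and "int (n + csize f) \<le> C"
  shows "trav (near D) (gadget True K a f n) (gadget False K b f n) \<longleftrightarrow> sat f (\<lambda>i. a ! i \<le> b ! i)"
  using assms
proof (induction f arbitrary: n)
  case (Var i)
  then show ?case using near_leaf_iff by simp
next
  case (And f g)
  define j where "j = Suc n + csize f"
  note za = gadget_zone[where v = a and M = M and left = True and K = K, OF _ M]
  note zb = gadget_zone[where v = b and M = M and left = False and K = K, OF _ M]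
  have apart: "\<not> near D p q" if "p \<in> set (gadget True K a f (Suc n))" "q \<in> set (gadget False K b g j)" for p q
    by (rule zone_apart[OF za[OF _ that(1)] zb[OF _ that(2)]]) (use And.prems in \<open>auto simp: j_def\<close>)
  have apart': "\<not> near D p q" if "p \<in> set (gadget True K a g j)" "q \<in> set (gadget False K b f (Suc n))" for p q
    by (rule zone_apart[OF za[OF _ that(1)] zb[OF _ that(2)]]) (use And.prems in \<open>auto simp: j_def\<close>)
  have "trav (near D) (gadget True K a f (Suc n) @ gadget True K a g j) (gadget False K b f (Suc n) @ gadget False K b g j)
    \<longleftrightarrow> trav (near D) (gadget True K a f (Suc n)) (gadget False K b f (Suc n)) \<and>
      trav (near D) (gadget True K a g j) (gadget False K b g j)"
    by (rule trav_and_gadget) (use apart apart' gadget_nonempty in auto)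
  moreover have "trav (near D) (gadget True K a f (Suc n)) (gadget False K b f (Suc n)) \<longleftrightarrow> sat f (\<lambda>i. a ! i \<le> b ! i)"
    by (rule And.IH(1)) (use And.prems in auto)
  moreover have "trav (near D) (gadget True K a g j) (gadget False K b g j) \<longleftrightarrow> sat g (\<lambda>i. a ! i \<le> b ! i)"
    by (rule And.IH(2)) (use And.prems in \<open>auto simp: j_def\<close>)
  ultimately show ?case by (simp add: j_def)
next
  case (Or f g)
  define j where "j = Suc n + csize f"
  define e where "e = j + csize g"
  have le: "n + 1 < j" "j < e" "int e \<le> C"
    using csize_pos[of g] csize_pos[of f] Or.prems(3) by (auto simp: e_def j_def)
  let ?u = "\<lambda>left. leaf_pt left K (2 * int j - 1) 0"
  let ?i1 = "\<lambda>left. interval_pt left K (2 * int n + 2) (2 * int j - 1)"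
  let ?i2 = "\<lambda>left. interval_pt left K (2 * int j - 1) (2 * int e - 2)"
  let ?G1 = "gadget True K a f (Suc n)" and ?G2 = "gadget True K a g j"
  let ?H1 = "gadget False K b f (Suc n)" and ?H2 = "gadget False K b g j"
  have G1: "zone True K M (2 * int n + 2) (2 * int j - 2) p" if "p \<in> set ?G1" for p
    by (rule zone_mono[OF gadget_zone[OF _ M that]]) (use Or.prems in \<open>auto simp: j_def\<close>)
  have G2: "zone True K M (2 * int j) (2 * int e - 2) p" if "p \<in> set ?G2" for p
    by (rule zone_mono[OF gadget_zone[OF _ M that]]) (use Or.prems in \<open>auto simp: e_def\<close>)
  have H1: "zone False K M (2 * int n + 2) (2 * int j - 2) q" if "q \<in> set ?H1" for q
    by (rule zone_mono[OF gadget_zone[OF _ M that]]) (use Or.prems in \<open>auto simp: j_def\<close>)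
  have H2: "zone False K M (2 * int j) (2 * int e - 2) q" if "q \<in> set ?H2" for q
    by (rule zone_mono[OF gadget_zone[OF _ M that]]) (use Or.prems in \<open>auto simp: e_def\<close>)
  have u: "zone left K M (2 * int j - 1) (2 * int j - 1) (?u left)" for left
    by (rule zone_leaf) (use M in auto)
  have i1: "zone left K M (2 * int n + 2) (2 * int j - 1) (?i1 left)" for left
    by (rule zone_interval) (use le in auto)
  have i2: "zone left K M (2 * int j - 1) (2 * int e - 2) (?i2 left)" for left
    by (rule zone_interval) (use le in auto)
  have lo: "- 1 \<le> 2 * int n + 2" "- 1 \<le> 2 * int j - 1" "2 * int n + 2 \<le> 2 * int j - 1"
    "2 * int j - 1 \<le> 2 * int e - 2" "2 * int j - 1 \<le> 2 * C - 1" "2 * int e - 2 \<le> 2 * C - 1"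
    using le by auto
  have u_u: "near D (?u True) (?u False)" using near_leaf_iff[of 0 0] M by simp
  note near1 = near_interval_right[OF zone_mono lo(1,3,5)] near_interval_left[OF zone_mono lo(1,3,5)]
  note near2 = near_interval_right[OF zone_mono lo(2,4,6)] near_interval_left[OF zone_mono lo(2,4,6)]
  have fst_if: "trav (near D) (?u True # ?i2 True # ?G1 @ ?G2 @ [?i1 True, ?u True])
      (?u False # ?i1 False # ?H2 @ ?H1 @ [?i2 False, ?u False])" if "trav (near D) ?G1 ?H1"
    by (rule trav_or_gadget_if_fst[OF that gadget_nonempty gadget_nonempty u_u])
       (use le in \<open>auto intro!: near1[OF u] near2[OF u] near2(1)[OF G2] near2(2)[OF H2]\<close>)
  have snd_if: "trav (near D) (?u True # ?i2 True # ?G1 @ ?G2 @ [?i1 True, ?u True])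
      (?u False # ?i1 False # ?H2 @ ?H1 @ [?i2 False, ?u False])" if "trav (near D) ?G2 ?H2"
    by (rule trav_or_gadget_if_snd[OF that gadget_nonempty gadget_nonempty u_u])
       (use le in \<open>auto intro!: near1[OF u] near2[OF u] near1(1)[OF G1] near1(2)[OF H1]\<close>)
  have only_if: "trav (near D) ?G1 ?H1 \<or> trav (near D) ?G2 ?H2"
    if "trav (near D) (?u True # ?i2 True # ?G1 @ ?G2 @ [?i1 True, ?u True])
      (?u False # ?i1 False # ?H2 @ ?H1 @ [?i2 False, ?u False])"
  proof (rule trav_or_gadget_only_if[OF that gadget_nonempty gadget_nonempty gadget_nonempty gadget_nonempty])
    show "\<not> near D (?u True) q" if "q \<in> set ?H1 \<union> set ?H2" for q
      using that zone_apart[OF u H1, of q] zone_apart[OF u H2, of q] by auto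
    show "\<not> near D (?i2 True) q" if "q \<in> set ?H1" for q
      by (rule zone_apart[OF i2 H1[OF that]]) auto
    show "\<not> near D (?i1 True) q" if "q \<in> set ?H2" for q
      by (rule zone_apart[OF i1 H2[OF that]]) auto
    show "\<not> near D p q" if "p \<in> set ?G1" "q \<in> set ?H2" for p q
      by (rule zone_apart[OF G1[OF that(1)] H2[OF that(2)]]) auto
    show "\<not> near D p q" if "p \<in> set ?G2" "q \<in> set ?H1" for p q
      by (rule zone_apart[OF G2[OF that(1)] H1[OF that(2)]]) auto
    show "\<not> near D p (?u False)" if "p \<in> set ?G1 \<union> set ?G2" for p
      using that zone_apart[OF G1 u, of p] zone_apart[OF G2 u, of p] by auto
    show "\<not> near D p (?i2 False)" if "p \<in> set ?G1" for p
      by (rule zone_apart[OF G1[OF that] i2]) auto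
    show "\<not> near D p (?i1 False)" if "p \<in> set ?G2" for p
      by (rule zone_apart[OF G2[OF that] i1]) auto
  qed
  have "trav (near D) ?G1 ?H1 \<longleftrightarrow> sat f (\<lambda>i. a ! i \<le> b ! i)"
    by (rule Or.IH(1)) (use Or.prems in auto)
  moreover have "trav (near D) ?G2 ?H2 \<longleftrightarrow> sat g (\<lambda>i. a ! i \<le> b ! i)"
    by (rule Or.IH(2)) (use Or.prems in \<open>auto simp: j_def\<close>)
  moreover have "trav (near D) (gadget True K a (Or f g) n) (gadget False K b (Or f g) n) \<longleftrightarrow>
      trav (near D) ?G1 ?H1 \<or> trav (near D) ?G2 ?H2"
    unfolding gadget.simps Let_def if_True if_False j_def[symmetric] e_def[symmetric]
    using fst_if snd_if only_if by blast
  ultimately show ?case by simp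
qed

end

text \<open>First coordinates of gadget points have absolute value less than \<open>8 K C = 8 sqrt h\<close>, so the offsets
  \<open>50 h\<close> and \<open>40 h\<close> dominate \<open>(x - x')\<^sup>2\<close> for all gadget points, while \<open>- 1\<close> and \<open>1\<close> still tell the two
  kinds of end points apart.\<close>

definition left_points :: "int \<Rightarrow> int \<Rightarrow> formula \<Rightarrow> int list list \<Rightarrow> (int \<times> int) list" where
  "left_points K h F A = concat (map (\<lambda>G. (- 1, - 50 * h) # leaf_pt True K (- 1) 0 # G @
     [leaf_pt True K (2 * int (csize F) - 1) 0, (1, - 50 * h)]) (map (\<lambda>a. gadget True K a F 0) A))"

definition right_points :: "int \<Rightarrow> int \<Rightarrow> formula \<Rightarrow> int list list \<Rightarrow> (int \<times> int) list" where
  "right_points K h F B = (0, 40 * h) # (- 1, 1 - 50 * h) # concat (map (\<lambda>H. leaf_pt False K (- 1) 0 # H @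
     [leaf_pt False K (2 * int (csize F) - 1) 0]) (map (\<lambda>b. gadget False K b F 0) B)) @
     [(1, 1 - 50 * h), (0, 40 * h)]"

context scaled_grid begin

lemma choice_correct:
  assumes size: "C = int (csize F)"
    and A: "\<And>a i. a \<in> set A \<Longrightarrow> i \<in> set (leaves F) \<Longrightarrow> \<bar>a ! i\<bar> \<le> M"
    and B: "\<And>b i. b \<in> set B \<Longrightarrow> i \<in> set (leaves F) \<Longrightarrow> \<bar>b ! i\<bar> \<le> M"
  shows "trav (near D) (left_points K h F A) (right_points K h F B) \<longleftrightarrow> yes_instance F A B"
proof -
  let ?gs = "map (\<lambda>a. gadget True K a F 0) A" and ?hs = "map (\<lambda>b. gadget False K b F 0) B"
  let ?g = "\<lambda>left. leaf_pt left K (- 1) 0" and ?g' = "\<lambda>left. leaf_pt left K (2 * C - 1) 0"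
  let ?s = "(- 1, - 50 * h)" and ?t = "(1, - 50 * h)"
  let ?S = "(0, 40 * h)" and ?S' = "(- 1, 1 - 50 * h)" and ?T' = "(1, 1 - 50 * h)"
  have gs: "zone True K M 0 (2 * C - 2) p" if "p \<in> \<Union> (set ` set ?gs)" for p
  proof -
    from that obtain v where v: "v \<in> set A" "p \<in> set (gadget True K v F 0)" by auto
    show ?thesis by (rule zone_mono[OF gadget_zone[OF A[OF v(1)] M v(2)]]) (simp_all add: size)
  qed
  have hs: "zone False K M 0 (2 * C - 2) p" if "p \<in> \<Union> (set ` set ?hs)" for p
  proof -
    from that obtain v where v: "v \<in> set B" "p \<in> set (gadget False K v F 0)" by auto
    show ?thesis by (rule zone_mono[OF gadget_zone[OF B[OF v(1)] M v(2)]]) (simp_all add: size)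
  qed
  have g: "zone left K M (- 1) (- 1) (?g left)" for left by (rule zone_leaf) (use M in auto)
  have g': "zone left K M (2 * C - 1) (2 * C - 1) (?g' left)" for left by (rule zone_leaf) (use M in auto)
  have C1: "1 \<le> C" by (rule C)
  have le: "- 1 \<le> 2 * C - 1" "2 * C - 2 \<le> 2 * C - 1" "- 1 \<le> (0 :: int)" "- 1 \<le> (- 1 :: int)" "2 * C - 1 \<le> 2 * C - 1"
    using C1 by auto
  have zp: "zone True K M (- 1) (2 * C - 1) p" if "p \<in> {?g True, ?g' True} \<union> \<Union> (set ` set ?gs)" for p
    using zone_mono[OF g[of True], of "- 1" "2 * C - 1"] zone_mono[OF g'[of True], of "- 1" "2 * C - 1"]
      zone_mono[OF gs, of p "- 1" "2 * C - 1"] le that by blast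
  have zq: "zone False K M (- 1) (2 * C - 1) q" if "q \<in> {?g False, ?g' False} \<union> \<Union> (set ` set ?hs)" for q
    using zone_mono[OF g[of False], of "- 1" "2 * C - 1"] zone_mono[OF g'[of False], of "- 1" "2 * C - 1"]
      zone_mono[OF hs, of q "- 1" "2 * C - 1"] le that by blast
  have h_pos: "0 < h" using K_le_h K_pos by simp
  have sq: "(fst p + d)\<^sup>2 \<le> 64 * h" if "\<bar>fst p\<bar> + 1 \<le> 8 * (K * C)" "\<bar>d\<bar> \<le> 1" for p :: "int \<times> int" and d
  proof -
    have "\<bar>fst p + d\<bar> \<le> \<bar>8 * (K * C)\<bar>" using that by linarith
    then show ?thesis unfolding abs_le_square_iff by (simp add: h power_mult_distrib)
  qed
  \<comment> \<open>The second coordinates of left gadget and guard points are at least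
    \<open>- 18 * h\<close>, far above the level \<open>1 - 50 * h\<close> of \<open>S'\<close> and
    \<open>T'\<close>.\<close>
  have zone_S': "\<not> near D p ?S' \<and> \<not> near D p ?T'" if "zone True K M (- 1) (2 * C - 1) p" for p
  proof -
    have "- 18 * h \<le> snd p" using zone_bounds(2)[OF that] by simp
    then have "0 < snd p - (1 - 50 * h)" using h_pos by simp
    then show ?thesis
      by (intro conjI not_near_if) (auto intro!: add_nonneg_pos)
  qed
  \<comment> \<open>The offset contributes \<open>- 80 * h\<close>, against at most
    \<open>64 * h\<close> from the first coordinates and \<open>4 * K \<le> 4 * h\<close> from a
    leaf.\<close>
  have zone_S: "near D p ?S" if "zone True K M (- 1) (2 * C - 1) p" for p
  proof (rule near_if)
    show "\<bar>snd p - snd ?S\<bar> \<le> D" using zone_bounds(2)[OF that] D by simp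
    show "(fst p - fst ?S)\<^sup>2 + 2 * (snd p - snd ?S) < 0"
      using sq[OF zone_bounds(1)[OF that], of 0] zone_bounds(3)[OF that] K_le_h h_pos by simp
  qed
  have st_zone: "near D ?s q \<and> near D ?t q" if "zone False K M (- 1) (2 * C - 1) q" for q
  proof (intro conjI near_if)
    note b = zone_bounds[OF that]
    show "\<bar>snd ?s - snd q\<bar> \<le> D" "\<bar>snd ?t - snd q\<bar> \<le> D" using b(2) D h_pos by auto
    have "(fst ?s - fst q)\<^sup>2 = (fst q + 1)\<^sup>2" "(fst ?t - fst q)\<^sup>2 = (fst q + (- 1))\<^sup>2"
      by (simp_all add: power2_eq_square algebra_simps)
    then show "(fst ?s - fst q)\<^sup>2 + 2 * (snd ?s - snd q) < 0" "(fst ?t - fst q)\<^sup>2 + 2 * (snd ?t - snd q) < 0"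
      using sq[OF b(1), of 1] sq[OF b(1), of "- 1"] b(4) K_le_h h_pos by simp_all
  qed
  have st: "near D ?s ?S" "near D ?t ?S" "near D ?s ?S'" "near D ?t ?T'"
    by (rule near_if; use D h_pos in simp)+
  \<comment> \<open>First coordinates at distance 2 contribute 4, against \<open>- 2\<close> from
    the second coordinates. For the matching pairs in \<open>st\<close> only the \<open>- 2\<close>
    is present.\<close>
  have not_st: "\<not> near D ?t ?S'" "\<not> near D ?s ?T'"
    by (rule not_near_if; simp)+
  have left: "left_points K h F A = concat (map (\<lambda>G. ?s # ?g True # G @ [?g' True, ?t]) ?gs)"
    and right: "right_points K h F B = ?S # ?S' # concat (map (\<lambda>H. ?g False # H @ [?g' False]) ?hs) @ [?T', ?S]"
    by (simp_all add: left_points_def right_points_def size)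
  have "trav (near D) (left_points K h F A) (right_points K h F B) \<longleftrightarrow>
    (\<exists>G \<in> set ?gs. \<exists>H \<in> set ?hs. trav (near D) G H)"
  proof
    assume "trav (near D) (left_points K h F A) (right_points K h F B)"
    then show "\<exists>G \<in> set ?gs. \<exists>H \<in> set ?hs. trav (near D) G H"
      unfolding left right
    proof (rule trav_choice_only_if)
      show "near D ?s ?S'" by (rule st)
      show "near D (?g True) (?g False)" using near_leaf_iff M by simp
      show "G \<noteq> []" if "G \<in> set ?gs" for G using that gadget_nonempty by auto
      show "H \<noteq> []" if "H \<in> set ?hs" for H using that gadget_nonempty by auto
      show "\<not> near D p ?S'" if "p \<in> {?g True, ?g' True, ?t} \<union> \<Union> (set ` set ?gs)" for p
        using that zone_S'[OF zp] not_st by blast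
      show "\<not> near D p ?T'" if "p \<in> {?s, ?g True, ?g' True} \<union> \<Union> (set ` set ?gs)" for p
        using that zone_S'[OF zp] not_st by blast
      show "\<not> near D (?g True) q" if "q \<in> insert (?g' False) (\<Union> (set ` set ?hs))" for q
        using that zone_apart[OF g g'] zone_apart[OF g hs, of q] C1 by auto
      show "\<not> near D p (?g False)" if "p \<in> insert (?g' True) (\<Union> (set ` set ?gs))" for p
        using that zone_apart[OF g' g] zone_apart[OF gs g, of p] C1 by auto
      show "\<not> near D (?g' True) q" if "q \<in> insert (?g False) (\<Union> (set ` set ?hs))" for q
        using that zone_apart[OF g' g] zone_apart[OF g' hs, of q] C1 by auto
      show "\<not> near D p (?g' False)" if "p \<in> insert (?g True) (\<Union> (set ` set ?gs))" for p
        using that zone_apart[OF g g'] zone_apart[OF gs g', of p] C1 by auto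
    qed
  next
    assume "\<exists>G \<in> set ?gs. \<exists>H \<in> set ?hs. trav (near D) G H"
    then obtain G H where GH: "trav (near D) G H" "G \<in> set ?gs" "H \<in> set ?hs" by blast
    show "trav (near D) (left_points K h F A) (right_points K h F B)"
      unfolding left right
    proof (rule trav_choice_if[OF GH])
      show "near D p ?S \<and> near D p ?S" if "p \<in> {?s, ?g True, ?g' True, ?t} \<union> \<Union> (set ` set ?gs)" for p
        using that zone_S[OF zp] st by blast
      show "near D ?s ?S'" "near D ?t ?T'" by (rule st)+
      show "near D ?s q \<and> near D ?t q" if "q \<in> {?g False, ?g' False} \<union> \<Union> (set ` set ?hs)" for q
        using that st_zone[OF zq] by blast
      show "near D (?g True) (?g False)" "near D (?g' True) (?g' False)" using near_leaf_iff M by simp_all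
    qed
  qed
  also have "\<dots> \<longleftrightarrow> (\<exists>a \<in> set A. \<exists>b \<in> set B. trav (near D) (gadget True K a F 0) (gadget False K b F 0))"
    by simp
  also have "\<dots> \<longleftrightarrow> yes_instance F A B"
    unfolding yes_instance_def using gadget_correct[of F _ _ 0] A B size by auto
  finally show ?thesis .
qed

end

section \<open>From integer points to curves in the plane\<close>

definition curve_point :: "bool \<Rightarrow> int \<Rightarrow> int \<times> int \<Rightarrow> real^2" where
  "curve_point left D p = vector [of_int (fst p) / of_int D,
     of_int (if left then snd p else snd p - D * D) / of_int (D * D)]"

text \<open>Shifting the right curve by 1 makes \<open>y\<close> enter the squared distance
  linearly, as \<open>2 * y / d\<^sup>2\<close>; dividing second coordinates by
  \<open>d\<^sup>2\<close> puts this term on the same scale as \<open>(x / d)\<^sup>2\<close>. The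
  equivalence is exact.\<close>

lemma dist_curve_point:
  assumes "0 < D"
  shows "dist (curve_point True D p) (curve_point False D q) \<le> 1 \<longleftrightarrow> near D p q"
proof -
  define x y where "x = real_of_int (fst p - fst q)" and "y = real_of_int (snd p - snd q)"
  define d where "d = real_of_int D"
  have d: "0 < d" using assms by (simp add: d_def)
  have c1: "(curve_point True D p - curve_point False D q) $ 1 = x / d"
    by (simp add: curve_point_def x_def d_def diff_divide_distrib)
  have c2: "(curve_point True D p - curve_point False D q) $ 2 = y / d\<^sup>2 + 1"
    using d by (simp add: curve_point_def y_def d_def power2_eq_square field_simps)
  have "dist (curve_point True D p) (curve_point False D q) = sqrt ((x / d)\<^sup>2 + (y / d\<^sup>2 + 1)\<^sup>2)"
    unfolding dist_norm norm_vec_def L2_set_def sum_2 c1 c2 by (simp only: real_norm_def power2_abs)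
  also have "\<dots> \<le> 1 \<longleftrightarrow> (x / d)\<^sup>2 + (y / d\<^sup>2 + 1)\<^sup>2 \<le> 1" by simp
  also have "(x / d)\<^sup>2 + (y / d\<^sup>2 + 1)\<^sup>2 = 1 + (d\<^sup>2 * (x\<^sup>2 + 2 * y) + y\<^sup>2) / (d\<^sup>2)\<^sup>2"
    using d by (simp add: field_simps power2_eq_square)
  also have "\<dots> \<le> 1 \<longleftrightarrow> d\<^sup>2 * (x\<^sup>2 + 2 * y) + y\<^sup>2 \<le> 0"
    using d by (simp add: divide_le_0_iff)
  also have "d\<^sup>2 * (x\<^sup>2 + 2 * y) + y\<^sup>2 =
      real_of_int (D\<^sup>2 * ((fst p - fst q)\<^sup>2 + 2 * (snd p - snd q)) + (snd p - snd q)\<^sup>2)"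
    by (simp add: x_def y_def d_def)
  finally show ?thesis by (simp only: near_def of_int_le_0_iff)
qed

lemma trav_map: "trav R (map f P) (map g Q) \<longleftrightarrow> trav (\<lambda>p q. R (f p) (g q)) P Q"
  by (induction "\<lambda>p q. R (f p) (g q)" P Q rule: trav.induct) auto

lemma (in scaled_grid) curves_correct:
  assumes "C = int (csize F)" "A \<noteq> []"
    and "\<And>a i. a \<in> set A \<Longrightarrow> i \<in> set (leaves F) \<Longrightarrow> \<bar>a ! i\<bar> \<le> M"
    and "\<And>b i. b \<in> set B \<Longrightarrow> i \<in> set (leaves F) \<Longrightarrow> \<bar>b ! i\<bar> \<le> M"
  shows "frechet_dist (map (curve_point True D) (left_points K h F A))
      (map (curve_point False D) (right_points K h F B)) \<le> 1 \<longleftrightarrow> yes_instance F A B"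
proof -
  have "left_points K h F A \<noteq> []" using assms(2) by (cases A) (auto simp: left_points_def)
  moreover have "right_points K h F B \<noteq> []" by (simp add: right_points_def)
  ultimately show ?thesis
    using choice_correct[OF assms(1,3,4)] D_pos
    by (simp add: frechet_dist_le_iff trav_map dist_curve_point)
qed

section \<open>Straight-line code and loops on the word RAM\<close>

text \<open>If all cells are bounded by \<open>B\<close>, then an expression with \<open>w\<close> leaves has absolute value at most
  \<open>B ^ w\<close>. So with words of size \<open>B ^ 20\<close> it suffices to bound the values that are written.\<close>

fun width :: "expr \<Rightarrow> nat" where
  "width (Const k) = 1"
| "width (Read x e) = width e"
| "width (Bin f e1 e2) = width e1 + width e2"

fun simple_expr :: "expr \<Rightarrow> bool" where
  "simple_expr (Const k) \<longleftrightarrow> \<bar>k\<bar> \<le> 100"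
| "simple_expr (Read x e) \<longleftrightarrow> simple_expr e"
| "simple_expr (Bin f e1 e2) \<longleftrightarrow> f \<noteq> Div \<and> f \<noteq> Mod \<and> simple_expr e1 \<and> simple_expr e2"

fun safe :: "store \<Rightarrow> expr \<Rightarrow> bool" where
  "safe \<sigma> (Const k) \<longleftrightarrow> True"
| "safe \<sigma> (Read x e) \<longleftrightarrow> safe \<sigma> e \<and> 0 \<le> val \<sigma> e"
| "safe \<sigma> (Bin f e1 e2) \<longleftrightarrow> safe \<sigma> e1 \<and> safe \<sigma> e2"

definition bounded :: "int \<Rightarrow> store \<Rightarrow> bool" where
  "bounded B \<sigma> \<longleftrightarrow> (\<forall>x i. \<bar>\<sigma> x i\<bar> \<le> B)"

text \<open>Bounds of at least 2 give \<open>X + Y \<le> X * Y\<close>, so sums obey the bound for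
  products and exponents simply add up along an expression.\<close>

lemma abs_apply_op_le:
  fixes X Y :: int
  assumes "\<bar>x\<bar> \<le> X" "\<bar>y\<bar> \<le> Y" "2 \<le> X" "2 \<le> Y" "f \<noteq> Div" "f \<noteq> Mod"
  shows "\<bar>apply_op f x y\<bar> \<le> X * Y"
proof -
  have "0 \<le> (X - 1) * (Y - 1) - 1"
    using mult_mono[of 1 "X - 1" 1 "Y - 1"] assms by simp
  then have sum: "X + Y \<le> X * Y" by (simp add: algebra_simps)
  show ?thesis
  proof (cases f)
    case Mul
    then show ?thesis using assms by (auto simp: abs_mult intro!: mult_mono)
  qed (use assms sum in auto)
qed

lemma width_pos: "0 < width e"
  by (induction e) auto

lemma abs_val_le:
  assumes "bounded B \<sigma>" "100 \<le> B" "simple_expr e"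
  shows "\<bar>val \<sigma> e\<bar> \<le> B ^ width e"
  using assms(3)
proof (induction e)
  case (Read x e)
  have "\<bar>\<sigma> x (nat (val \<sigma> e))\<bar> \<le> B ^ 1" using assms(1) by (simp add: bounded_def)
  also have "\<dots> \<le> B ^ width e" using width_pos[of e] assms(2) by (intro power_increasing) auto
  finally show ?case by simp
next
  case (Bin f e1 e2)
  have "2 \<le> B ^ width e" for e
  proof -
    have "B ^ 1 \<le> B ^ width e" using width_pos[of e] assms(2) by (intro power_increasing) auto
    then show ?thesis using assms(2) by simp
  qed
  then show ?case using Bin abs_apply_op_le[of "val \<sigma> e1" "B ^ width e1" "val \<sigma> e2" "B ^ width e2"]
    by (simp add: power_add)
qed (use assms in auto)

lemma fits_if_safe:
  assumes "bounded B \<sigma>" "100 \<le> B" "simple_expr e" "safe \<sigma> e" "width e \<le> w"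
  shows "fits (B ^ w) \<sigma> e"
proof -
  have "\<bar>val \<sigma> e\<bar> \<le> B ^ w" if "simple_expr e" "width e \<le> w" for e
  proof -
    have "B ^ width e \<le> B ^ w" using that assms(2) by (intro power_increasing) auto
    then show ?thesis using abs_val_le[OF assms(1,2) that(1)] by linarith
  qed
  then show ?thesis using assms(3-5)
  proof (induction e)
    case (Const k)
    then show ?case using Const.prems(1)[of "Const k"] by simp
  next
    case (Read x e)
    then show ?case using Read.prems(1)[of "Read x e"] by simp
  next
    case (Bin f e1 e2)
    then show ?case using Bin.prems(1)[of "Bin f e1 e2"] by simp
  qed
qed

text \<open>The limit 20 is dictated by the widest expression of the program, the second coordinate
  of an interval point with 17 leaves.\<close>

fun admissible :: "com \<Rightarrow> bool" where
  "admissible Skip \<longleftrightarrow> True"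
| "admissible (Write x e1 e2) \<longleftrightarrow> simple_expr e1 \<and> width e1 \<le> 20 \<and> simple_expr e2 \<and> width e2 \<le> 20"
| "admissible (Seq p q) \<longleftrightarrow> admissible p \<and> admissible q"
| "admissible (Cond e p q) \<longleftrightarrow> simple_expr e \<and> width e \<le> 20 \<and> admissible p \<and> admissible q"
| "admissible (While e p) \<longleftrightarrow> simple_expr e \<and> width e \<le> 20 \<and> admissible p"

text \<open>Meant for loop-free code; loops are left to \<open>runs_While\<close>. The bound on each
  written value keeps \<open>bounded B\<close> invariant, so overflow need not be examined anywhere
  else.\<close>

fun wp :: "int \<Rightarrow> com \<Rightarrow> store \<Rightarrow> (store \<Rightarrow> bool) \<Rightarrow> bool" where
  "wp B Skip \<sigma> Q \<longleftrightarrow> Q \<sigma>"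
| "wp B (Write x e1 e2) \<sigma> Q \<longleftrightarrow> safe \<sigma> e1 \<and> 0 \<le> val \<sigma> e1 \<and> safe \<sigma> e2 \<and> \<bar>val \<sigma> e2\<bar> \<le> B \<and>
     Q (\<sigma>(x := (\<sigma> x)(nat (val \<sigma> e1) := val \<sigma> e2)))"
| "wp B (Seq p q) \<sigma> Q \<longleftrightarrow> wp B p \<sigma> (\<lambda>\<tau>. wp B q \<tau> Q)"
| "wp B (Cond e p q) \<sigma> Q \<longleftrightarrow> safe \<sigma> e \<and> (if val \<sigma> e \<noteq> 0 then wp B p \<sigma> Q else wp B q \<sigma> Q)"
| "wp B (While e p) \<sigma> Q \<longleftrightarrow> False"

fun max_time :: "com \<Rightarrow> nat" where
  "max_time Skip = 1"
| "max_time (Write x e1 e2) = 1 + cost e1 + cost e2"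
| "max_time (Seq p q) = max_time p + max_time q"
| "max_time (Cond e p q) = 1 + cost e + max (max_time p) (max_time q)"
| "max_time (While e p) = 0"

lemma wp_mono: "wp B p \<sigma> Q \<Longrightarrow> (\<And>\<tau>. Q \<tau> \<Longrightarrow> R \<tau>) \<Longrightarrow> wp B p \<sigma> R"
proof (induction p arbitrary: \<sigma> Q R)
  case (Seq p q)
  have "wp B p \<sigma> (\<lambda>\<tau>. wp B q \<tau> Q)" using Seq.prems(1) by simp
  then have "wp B p \<sigma> (\<lambda>\<tau>. wp B q \<tau> R)"
    by (rule Seq.IH(1)) (rule Seq.IH(2)[OF _ Seq.prems(2)])
  then show ?case by simp
next
  case (Cond e p q)
  then show ?case by (cases "val \<sigma> e = 0") (use Cond.IH(1)[of \<sigma> Q R] Cond.IH(2)[of \<sigma> Q R] in auto)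
qed auto

definition runs :: "int \<Rightarrow> com \<Rightarrow> store \<Rightarrow> nat \<Rightarrow> (store \<Rightarrow> bool) \<Rightarrow> bool" where
  "runs B p \<sigma> T Q \<longleftrightarrow> (bounded B \<sigma> \<longrightarrow>
     (\<exists>t \<sigma>'. exec (B ^ 20) p \<sigma> t \<sigma>' \<and> t \<le> T \<and> bounded B \<sigma>' \<and> Q \<sigma>'))"

lemma runs_wp:
  assumes "100 \<le> B" "admissible p" "wp B p \<sigma> Q" "max_time p \<le> T"
  shows "runs B p \<sigma> T Q"
proof -
  have "\<exists>t \<sigma>'. exec (B ^ 20) p \<sigma> t \<sigma>' \<and> t \<le> max_time p \<and> bounded B \<sigma>' \<and> Q \<sigma>'" if "bounded B \<sigma>"
    using assms(2,3) that
  proof (induction p arbitrary: \<sigma> Q)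
    case Skip
    then show ?case using exec.Skip by fastforce
  next
    case (Write x e1 e2)
    then have "exec (B ^ 20) (Write x e1 e2) \<sigma> (1 + cost e1 + cost e2)
        (\<sigma>(x := (\<sigma> x)(nat (val \<sigma> e1) := val \<sigma> e2)))"
      by (intro exec.Write fits_if_safe) (use assms(1) in auto)
    moreover have "bounded B (\<sigma>(x := (\<sigma> x)(nat (val \<sigma> e1) := val \<sigma> e2)))"
      using Write.prems by (auto simp: bounded_def)
    ultimately show ?case using Write.prems(2) by auto
  next
    case (Seq p q)
    then obtain t \<sigma>' where 1: "exec (B ^ 20) p \<sigma> t \<sigma>'" "t \<le> max_time p" "bounded B \<sigma>'" "wp B q \<sigma>' Q"
      by (metis admissible.simps(3) wp.simps(3))
    then obtain t' \<sigma>'' where "exec (B ^ 20) q \<sigma>' t' \<sigma>''" "t' \<le> max_time q" "bounded B \<sigma>''" "Q \<sigma>''"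
      using Seq.IH(2) Seq.prems(1) by (metis admissible.simps(3))
    with 1 show ?case
      by (intro exI[of _ "t + t'"] exI[of _ \<sigma>'']) (auto intro: exec.Seq)
  next
    case (Cond e p q)
    have f: "fits (B ^ 20) \<sigma> e" using Cond.prems assms(1) by (intro fits_if_safe) auto
    show ?case
    proof (cases "val \<sigma> e = 0")
      case True
      then obtain t \<sigma>' where "exec (B ^ 20) q \<sigma> t \<sigma>'" "t \<le> max_time q" "bounded B \<sigma>'" "Q \<sigma>'"
        using Cond.IH(2)[of \<sigma> Q] Cond.prems by auto
      with exec.CondFalse[OF f True] show ?thesis
        by (intro exI[of _ "1 + cost e + t"] exI[of _ \<sigma>']) auto
    next
      case False
      then obtain t \<sigma>' where "exec (B ^ 20) p \<sigma> t \<sigma>'" "t \<le> max_time p" "bounded B \<sigma>'" "Q \<sigma>'"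
        using Cond.IH(1)[of \<sigma> Q] Cond.prems by auto
      with exec.CondTrue[OF f False] show ?thesis
        by (intro exI[of _ "1 + cost e + t"] exI[of _ \<sigma>']) auto
    qed
  next
    case (While e p)
    then show ?case by simp
  qed
  then show ?thesis unfolding runs_def using assms(4) order_trans by blast
qed

lemma runs_Seq:
  assumes "runs B p \<sigma> T1 R" "\<And>\<tau>. R \<tau> \<Longrightarrow> runs B q \<tau> T2 Q" "T1 + T2 \<le> T"
  shows "runs B (Seq p q) \<sigma> T Q"
  unfolding runs_def
proof
  assume "bounded B \<sigma>"
  then obtain t \<sigma>' where 1: "exec (B ^ 20) p \<sigma> t \<sigma>'" "t \<le> T1" "bounded B \<sigma>'" "R \<sigma>'"
    using assms(1) unfolding runs_def by blast
  then obtain t' \<sigma>'' where 2: "exec (B ^ 20) q \<sigma>' t' \<sigma>''" "t' \<le> T2" "bounded B \<sigma>''" "Q \<sigma>''"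
    using assms(2) unfolding runs_def by blast
  have "exec (B ^ 20) (Seq p q) \<sigma> (t + t') \<sigma>''" using 1 2 by (blast intro: exec.Seq)
  moreover have "t + t' \<le> T" using 1 2 assms(3) by linarith
  ultimately show "\<exists>t \<sigma>'. exec (B ^ 20) (Seq p q) \<sigma> t \<sigma>' \<and> t \<le> T \<and> bounded B \<sigma>' \<and> Q \<sigma>'"
    using 2 by blast
qed

text \<open>\<open>I\<close> is indexed by the exact number of iterations left, which makes it
  invariant, termination measure and time bound in one.\<close>

lemma runs_While:
  assumes "100 \<le> B" "simple_expr e" "width e \<le> 20"
    and step: "\<And>n \<sigma>. I (Suc n) \<sigma> \<Longrightarrow> safe \<sigma> e \<and> val \<sigma> e \<noteq> 0 \<and> runs B p \<sigma> T (I n)"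
    and stop: "\<And>\<sigma>. I 0 \<sigma> \<Longrightarrow> safe \<sigma> e \<and> val \<sigma> e = 0"
    and "I n \<sigma>" "n * (1 + cost e + T) + 1 + cost e \<le> T'"
  shows "runs B (While e p) \<sigma> T' (I 0)"
proof -
  have "\<exists>t \<sigma>'. exec (B ^ 20) (While e p) \<sigma> t \<sigma>' \<and> t \<le> n * (1 + cost e + T) + 1 + cost e \<and> bounded B \<sigma>' \<and> I 0 \<sigma>'"
    if "bounded B \<sigma>"
    using \<open>I n \<sigma>\<close> that
  proof (induction n arbitrary: \<sigma>)
    case 0
    have "fits (B ^ 20) \<sigma> e" using stop[OF 0(1)] 0(2) assms(1-3) by (intro fits_if_safe) auto
    then have "exec (B ^ 20) (While e p) \<sigma> (1 + cost e) \<sigma>" using stop[OF 0(1)] by (intro exec.WhileFalse) auto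
    then show ?case using 0 by auto
  next
    case (Suc n)
    have f: "fits (B ^ 20) \<sigma> e" using step[OF Suc(2)] Suc(3) assms(1-3) by (intro fits_if_safe) auto
    obtain t \<sigma>' where 1: "exec (B ^ 20) p \<sigma> t \<sigma>'" "t \<le> T" "bounded B \<sigma>'" "I n \<sigma>'"
      using step[OF Suc(2)] Suc(3) unfolding runs_def by blast
    obtain t' \<sigma>'' where 2: "exec (B ^ 20) (While e p) \<sigma>' t' \<sigma>''" "t' \<le> n * (1 + cost e + T) + 1 + cost e"
        "bounded B \<sigma>''" "I 0 \<sigma>''"
      using Suc.IH[OF 1(4,3)] by blast
    have "exec (B ^ 20) (While e p) \<sigma> (1 + cost e + t + t') \<sigma>''"
      using f step[OF Suc(2)] 1 2 by (intro exec.WhileTrue) auto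
    moreover have "1 + cost e + t + t' \<le> Suc n * (1 + cost e + T) + 1 + cost e"
      using 1 2 by simp
    ultimately show ?case using 2 by blast
  qed
  then show ?thesis unfolding runs_def using assms(7) order_trans by blast
qed

lemma runs_mono: "runs B p \<sigma> T Q \<Longrightarrow> (\<And>\<tau>. Q \<tau> \<Longrightarrow> R \<tau>) \<Longrightarrow> T \<le> T' \<Longrightarrow> runs B p \<sigma> T' R"
  unfolding runs_def by (meson order_trans)

section \<open>The reduction as a program\<close>

abbreviation add_expr (infixl "[+]" 65) where "a [+] b \<equiv> Bin Add a b"
abbreviation sub_expr (infixl "[-]" 65) where "a [-] b \<equiv> Bin Sub a b"
abbreviation mul_expr (infixl "[*]" 70) where "a [*] b \<equiv> Bin Mul a b"
abbreviation leq_expr (infix "[<=]" 50) where "a [<=] b \<equiv> Bin Leq a b"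
abbreviation seq (infixr ";;" 60) where "p ;; q \<equiv> Seq p q"
abbreviation cell :: "nat \<Rightarrow> expr" where "cell x \<equiv> Read x (Const 0)"
abbreviation assign (infix "[:=]" 61) where "x [:=] e \<equiv> Write x (Const 0) e"

text \<open>\<open>ENDS\<close> maps the index of a subformula in the prefix code to the index after its end.\<close>

abbreviation (input) "INPUT \<equiv> 0 :: nat"
abbreviation (input) "ENDS \<equiv> 3 :: nat"
abbreviation (input) "STACK \<equiv> 4 :: nat"
abbreviation (input) "SP \<equiv> 5 :: nat"
abbreviation (input) "COUNT \<equiv> 6 :: nat"
abbreviation (input) "BASE \<equiv> 7 :: nat"
abbreviation (input) "SIZE \<equiv> 8 :: nat"
abbreviation (input) "DENOM \<equiv> 9 :: nat"
abbreviation (input) "PX \<equiv> 10 :: nat"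
abbreviation (input) "PY \<equiv> 11 :: nat"
abbreviation (input) "ITEM \<equiv> 12 :: nat"
abbreviation (input) "SYM \<equiv> 13 :: nat"
abbreviation (input) "MID \<equiv> 14 :: nat"
abbreviation (input) "FIN \<equiv> 15 :: nat"
abbreviation (input) "SCALE \<equiv> 16 :: nat"
abbreviation (input) "LEN \<equiv> 17 :: nat"

definition out :: "bool \<Rightarrow> nat" where
  "out left = (if left then 1 else 2)"

definition written :: "bool \<Rightarrow> int \<Rightarrow> (nat \<Rightarrow> int) \<Rightarrow> (int \<times> int) list \<Rightarrow> bool" where
  "written left D a L \<longleftrightarrow> a 0 = int (length L) \<and> (\<forall>i < length L.
     a (4 * i + 1) = fst (L ! i) \<and> a (4 * i + 2) = D \<and>
     a (4 * i + 3) = (if left then snd (L ! i) else snd (L ! i) - D * D) \<and> a (4 * i + 4) = D * D)"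

text \<open>The vertex count in cell 0 doubles as the write position, so it is incremented
  last.\<close>

definition emit :: "bool \<Rightarrow> com" where
  "emit left = (let a = out left; pos = (\<lambda>k. Const 4 [*] cell a [+] Const k) in
     Write a (pos 1) (cell PX) ;;
     Write a (pos 2) (cell DENOM) ;;
     Write a (pos 3) (if left then cell PY else cell PY [-] cell DENOM [*] cell DENOM) ;;
     Write a (pos 4) (cell DENOM [*] cell DENOM) ;;
     a [:=] cell a [+] Const 1)"

definition put :: "bool \<Rightarrow> expr \<Rightarrow> expr \<Rightarrow> com" where
  "put left ex ey = PX [:=] ex ;; PY [:=] ey ;; emit left"

lemma written_snoc:
  assumes "written left D a L" and n: "n = length L"
  shows "written left D (a(4 * n + 1 := fst p, 4 * n + 2 := D,
    4 * n + 3 := (if left then snd p else snd p - D * D), 4 * n + 4 := D * D, 0 := int n + 1)) (L @ [p])"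
    (is "written _ _ ?a _")
  unfolding written_def
proof (intro conjI allI impI)
  show "?a 0 = int (length (L @ [p]))" by (simp add: n)
  fix i assume "i < length (L @ [p])"
  then have "i < n \<or> i = n" by (auto simp: n)
  then show "?a (4 * i + 1) = fst ((L @ [p]) ! i)" "?a (4 * i + 2) = D"
    "?a (4 * i + 3) = (if left then snd ((L @ [p]) ! i) else snd ((L @ [p]) ! i) - D * D)"
    "?a (4 * i + 4) = D * D"
    using assms by (auto simp: written_def nth_append)
qed

lemma wp_emit:
  assumes "written left D (\<sigma> (out left)) L" "\<sigma> DENOM 0 = D" "\<sigma> PX 0 = fst p" "\<sigma> PY 0 = snd p"
    and "\<bar>fst p\<bar> \<le> B" "0 \<le> D" "\<bar>snd p\<bar> + D * D \<le> B" "D \<le> B" "int (length L) < B"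
  shows "wp B (emit left) \<sigma> (\<lambda>t. written left D (t (out left)) (L @ [p]) \<and> (\<forall>x. x \<noteq> out left \<longrightarrow> t x = \<sigma> x))"
proof -
  define n where "n = length L"
  have cnt: "\<sigma> (out left) 0 = int n" using assms(1) by (simp add: written_def n_def)
  have pos: "nat (4 * int n + 1) = 4 * n + 1" "nat (4 * int n + 2) = 4 * n + 2"
    "nat (4 * int n + 3) = 4 * n + 3" "nat (4 * int n + 4) = 4 * n + 4"
    by linarith+
  have ne: "out left \<noteq> DENOM" "out left \<noteq> PX" "out left \<noteq> PY" by (auto simp: out_def)
  have DD: "0 \<le> D * D" using assms(6) by simp
  then have sb: "\<bar>snd p\<bar> \<le> B" "D * D \<le> B" "\<bar>snd p - D * D\<bar> \<le> B" using assms(7) by linarith+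
  show ?thesis
    using written_snoc[OF assms(1) n_def, of p] assms ne cnt DD sb
    by (cases left) (simp_all add: emit_def Let_def pos n_def[symmetric] del: add_Suc_right One_nat_def)
qed

text \<open>\<open>ey\<close> is evaluated after \<open>PX\<close> has been overwritten, hence its
  hypotheses refer to the updated store.\<close>

lemma wp_put:
  assumes "written left D (\<sigma> (out left)) L" "\<sigma> DENOM 0 = D"
    and ex: "safe \<sigma> ex" "val \<sigma> ex = fst p"
    and ey: "safe (\<sigma>(PX := (\<sigma> PX)(0 := fst p))) ey" "val (\<sigma>(PX := (\<sigma> PX)(0 := fst p))) ey = snd p"
    and bounds: "\<bar>fst p\<bar> \<le> B" "0 \<le> D" "\<bar>snd p\<bar> + D * D \<le> B" "D \<le> B" "int (length L) < B"
    and Q: "\<And>t. written left D (t (out left)) (L @ [p]) \<Longrightarrow>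
      (\<And>x. x \<noteq> PX \<Longrightarrow> x \<noteq> PY \<Longrightarrow> x \<noteq> out left \<Longrightarrow> t x = \<sigma> x) \<Longrightarrow> Q t"
  shows "wp B (put left ex ey) \<sigma> Q"
proof -
  have "0 \<le> D * D" using bounds(2) by simp
  then have sb: "\<bar>snd p\<bar> \<le> B" using bounds(3) by linarith
  have ne: "out left \<noteq> PX" "out left \<noteq> PY" by (auto simp: out_def)
  let ?t = "\<sigma>(PX := (\<sigma> PX)(0 := fst p), PY := (\<sigma> PY)(0 := snd p))"
  have "wp B (emit left) ?t Q"
    by (rule wp_mono[OF wp_emit[of left D ?t L p]]) (use assms ne in auto)
  then show ?thesis using ex ey bounds sb by (simp add: put_def)
qed

definition leaf_x :: "expr \<Rightarrow> expr" where
  "leaf_x j = Const 4 [*] cell SCALE [*] j"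

definition put_leaf :: "bool \<Rightarrow> com" where
  "put_leaf left = put left (leaf_x (Const 2 [*] cell ITEM))
     (Const 2 [*] Read INPUT (cell BASE [+] cell SYM) [+] Const (if left then 0 else 1))"

definition put_between :: "bool \<Rightarrow> com" where
  "put_between left = put left (leaf_x (Const 2 [*] cell MID [-] Const 1)) (Const (if left then 0 else 1))"

definition put_interval :: "bool \<Rightarrow> expr \<Rightarrow> expr \<Rightarrow> com" where
  "put_interval left l r = put left (Const 2 [*] cell SCALE [*] (l [+] r))
     (Const (if left then - 2 else 2) [*] (cell SCALE [*] cell SCALE) [*]
       ((r [-] l [+] Const 1) [*] (r [-] l [+] Const 1)))"

definition put_fst_interval :: "bool \<Rightarrow> com" where
  "put_fst_interval left = put_interval left (Const 2 [*] cell ITEM [+] Const 2) (Const 2 [*] cell MID [-] Const 1)"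

definition put_snd_interval :: "bool \<Rightarrow> com" where
  "put_snd_interval left = put_interval left (Const 2 [*] cell MID [-] Const 1) (Const 2 [*] cell FIN [-] Const 2)"

text \<open>The left child begins right after the gate symbol, and its end is the start of the right
  child.\<close>

definition load_ends :: com where
  "load_ends = MID [:=] Read ENDS (cell ITEM [+] Const 1) ;; FIN [:=] Read ENDS (cell ITEM)"

definition push_and :: com where
  "push_and = Write STACK (cell SP) (cell MID) ;;
     Write STACK (cell SP [+] Const 1) (cell ITEM [+] Const 1) ;; SP [:=] cell SP [+] Const 2"

text \<open>What is pushed last is written next: the left curve continues with the left child, the
  right curve with the right child, and the closing item waits below both.\<close>

definition push_or :: "bool \<Rightarrow> com" where
  "push_or left = Write STACK (cell SP) (Const (- 1) [-] cell ITEM) ;;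
     Write STACK (cell SP [+] Const 1) (if left then cell MID else cell ITEM [+] Const 1) ;;
     Write STACK (cell SP [+] Const 2) (if left then cell ITEM [+] Const 1 else cell MID) ;;
     SP [:=] cell SP [+] Const 3"

text \<open>The map from \<open>x\<close> to \<open>- 1 - x\<close> is an involution, so the
  expression that encoded the item on the stack also decodes it.\<close>

definition close_or :: "bool \<Rightarrow> com" where
  "close_or left = ITEM [:=] Const (- 1) [-] cell ITEM ;; load_ends ;;
     (if left then put_fst_interval left else put_snd_interval left) ;; put_between left"

definition open_or :: "bool \<Rightarrow> com" where
  "open_or left = put_between left ;; (if \<not> left then put_fst_interval left else put_snd_interval left) ;;
     push_or left"

definition open_node :: "bool \<Rightarrow> com" where
  "open_node left = SYM [:=] Read INPUT (Const 3 [+] cell ITEM) ;;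
     Cond (Const 0 [<=] cell SYM) (put_leaf left)
       (load_ends ;;
        Cond (Const (- 1) [<=] cell SYM) push_and (open_or left))"

definition step :: "bool \<Rightarrow> com" where
  "step left = SP [:=] cell SP [-] Const 1 ;; ITEM [:=] Read STACK (cell SP) ;;
     Cond (cell ITEM [<=] Const (- 1)) (close_or left) (open_node left)"

definition write_gadget :: "bool \<Rightarrow> com" where
  "write_gadget left = Write STACK (Const 0) (Const 0) ;; SP [:=] Const 1 ;;
     While (Const 1 [<=] cell SP) (step left)"

section \<open>Subformulas in the prefix code and the explicit stack\<close>

definition code_at :: "int list \<Rightarrow> formula \<Rightarrow> nat \<Rightarrow> bool" where
  "code_at cs f n \<longleftrightarrow> (\<exists>rest. drop n cs = prefix_code f @ rest)"

lemma code_at_size: "code_at cs f n \<Longrightarrow> n + csize f \<le> length cs"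
proof -
  assume "code_at cs f n"
  then obtain rest where "drop n cs = prefix_code f @ rest" by (auto simp: code_at_def)
  from arg_cong[OF this, of length] have "length cs - n = csize f + length rest" by simp
  then show ?thesis using csize_pos[of f] by linarith
qed

lemma code_at_nth: "code_at cs f n \<Longrightarrow> n < length cs \<and> cs ! n = hd (prefix_code f)"
proof -
  assume *: "code_at cs f n"
  then have n: "n < length cs" using code_at_size[OF *] csize_pos[of f] by linarith
  moreover have "cs ! n = hd (drop n cs)" using n by (simp add: hd_drop_conv_nth)
  moreover have "prefix_code f \<noteq> []" using csize_pos[of f] by auto
  ultimately show ?thesis using * by (auto simp: code_at_def)
qed

lemma code_at_children:
  assumes "drop n cs = c # prefix_code f @ prefix_code g @ rest"
  shows "code_at cs f (Suc n)" "code_at cs g (Suc n + csize f)"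
proof -
  have 1: "drop (Suc n) cs = prefix_code f @ prefix_code g @ rest"
    using arg_cong[OF assms, of tl] by (simp add: drop_Suc tl_drop)
  then show "code_at cs f (Suc n)" by (auto simp: code_at_def)
  have "drop (Suc n + csize f) cs = drop (csize f) (drop (Suc n) cs)"
    by (simp add: add.commute)
  also have "\<dots> = prefix_code g @ rest" unfolding 1 by simp
  finally show "code_at cs g (Suc n + csize f)" by (auto simp: code_at_def)
qed

lemma code_at_And:
  assumes "code_at cs (And f g) n"
  shows "code_at cs f (Suc n)" "code_at cs g (Suc n + csize f)"
  using assms code_at_children[of n cs "-1" f g] by (auto simp: code_at_def)

lemma code_at_Or:
  assumes "code_at cs (Or f g) n"
  shows "code_at cs f (Suc n)" "code_at cs g (Suc n + csize f)"
  using assms code_at_children[of n cs "-2" f g] by (auto simp: code_at_def)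

text \<open>\<open>Close f g n\<close> is the part of the OR gate at index \<open>n\<close> that follows both children. On the stack it is
  the negative number \<open>- 1 - n\<close>, which cannot be mistaken for a node.\<close>

datatype item = Node formula nat | Close formula formula nat

fun item_code :: "item \<Rightarrow> int" where
  "item_code (Node f n) = int n"
| "item_code (Close f g n) = - 1 - int n"

fun item_points :: "bool \<Rightarrow> int \<Rightarrow> int list \<Rightarrow> item \<Rightarrow> (int \<times> int) list" where
  "item_points left K v (Node f n) = gadget left K v f n"
| "item_points left K v (Close f g n) = (let j = Suc n + csize f; e = j + csize g in
     [if left then interval_pt left K (2 * int n + 2) (2 * int j - 1)
      else interval_pt left K (2 * int j - 1) (2 * int e - 2),
      leaf_pt left K (2 * int j - 1) 0])"

text \<open>Counts the iterations of the stack loop: one per node, and one more for the closing item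
  of an OR gate.\<close>

fun work :: "formula \<Rightarrow> nat" where
  "work (Var i) = 1"
| "work (And f g) = 1 + work f + work g"
| "work (Or f g) = 2 + work f + work g"

fun item_work :: "item \<Rightarrow> nat" where
  "item_work (Node f n) = work f"
| "item_work (Close f g n) = 1"

fun item_ok :: "int list \<Rightarrow> item \<Rightarrow> bool" where
  "item_ok cs (Node f n) \<longleftrightarrow> code_at cs f n"
| "item_ok cs (Close f g n) \<longleftrightarrow> code_at cs (Or f g) n"

text \<open>The head of the list is the top of the stack. Cells above it are unconstrained, so
  popping only has to lower \<open>SP\<close>.\<close>

fun stack_rep :: "(nat \<Rightarrow> int) \<Rightarrow> item list \<Rightarrow> bool" where
  "stack_rep a [] \<longleftrightarrow> True"
| "stack_rep a (x # xs) \<longleftrightarrow> a (length xs) = item_code x \<and> stack_rep a xs"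

lemma stack_rep_upd [simp]: "length xs \<le> k \<Longrightarrow> stack_rep (a(k := y)) xs \<longleftrightarrow> stack_rep a xs"
  by (induction xs) auto

lemma work_pos: "0 < work f"
  by (cases f) auto

lemma work_le: "work f \<le> 2 * csize f"
  by (induction f) auto

lemma length_le_work: "length st \<le> sum_list (map item_work st)"
proof (induction st)
  case (Cons x xs)
  have "0 < item_work x" by (cases x) (simp_all add: work_pos)
  then show ?case using Cons by simp
qed simp

definition temps :: "bool \<Rightarrow> nat set" where
  "temps left = {STACK, SP, PX, PY, ITEM, SYM, MID, FIN, out left}"

lemma step_admissible: "admissible (step left)"
  by (cases left) (simp_all add: step_def close_or_def open_node_def load_ends_def push_and_def push_or_def
    put_leaf_def put_between_def put_fst_interval_def put_snd_interval_def put_interval_def open_or_def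
    put_def emit_def Let_def leaf_x_def)

lemma step_time: "max_time (step left) \<le> 300"
  by (cases left) (simp_all add: step_def close_or_def open_node_def load_ends_def push_and_def push_or_def
    put_leaf_def put_between_def put_fst_interval_def put_snd_interval_def put_interval_def open_or_def
    put_def emit_def Let_def leaf_x_def)

section \<open>Correctness of the stack loop for one vector\<close>

locale gadget_writer =
  fixes left :: bool and B :: int and s0 :: store and cs :: "int list" and v :: "int list"
    and K D :: int and total :: "(int \<times> int) list" and base m :: nat
  assumes B: "100 \<le> B" "2 * int (length cs) + 2 \<le> B" "int (length total) \<le> B" "int m \<le> B"
    and code: "\<And>n. n < length cs \<Longrightarrow> s0 INPUT (3 + n) = cs ! n"
    and ends: "\<And>f n. code_at cs f n \<Longrightarrow> s0 ENDS n = int (n + csize f)"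
    and scalars: "s0 DENOM 0 = D" "s0 SCALE 0 = K" "s0 BASE 0 = int base"
    and vec: "\<And>i. i < m \<Longrightarrow> s0 INPUT (base + i) = v ! i"
    and vars: "\<And>i n. code_at cs (Var i) n \<Longrightarrow> i < m"
    and D: "0 \<le> D" "D \<le> B"
    and points: "\<And>p. p \<in> set total \<Longrightarrow> \<bar>fst p\<bar> \<le> B \<and> \<bar>snd p\<bar> + D * D \<le> B"
begin

definition state :: "item list \<Rightarrow> (int \<times> int) list \<Rightarrow> store \<Rightarrow> bool" where
  "state st L t \<longleftrightarrow> stack_rep (t STACK) st \<and> t SP 0 = int (length st) \<and>
     written left D (t (out left)) L \<and> (\<forall>x. x \<notin> temps left \<longrightarrow> t x = s0 x)"

text \<open>The vertices already written, followed by those that the stack still promises, always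
  spell \<open>total\<close>. The index \<open>w\<close> is the number of iterations left.\<close>

definition loop_inv :: "nat \<Rightarrow> store \<Rightarrow> bool" where
  "loop_inv w t \<longleftrightarrow> w \<le> 2 * length cs \<and> (\<exists>st L. state st L t \<and> (\<forall>x \<in> set st. item_ok cs x) \<and>
     sum_list (map item_work st) = w \<and> L @ concat (map (item_points left K v) st) = total)"

lemma frame:
  assumes "state st L t"
  shows "t INPUT = s0 INPUT" "t ENDS = s0 ENDS" "t DENOM 0 = D" "t SCALE 0 = K" "t BASE 0 = int base"
  using assms scalars by (auto simp: state_def temps_def out_def)

lemma out_ne [simp]:
  "out left \<noteq> INPUT" "out left \<noteq> ENDS" "out left \<noteq> STACK" "out left \<noteq> SP" "out left \<noteq> ITEM"
  "out left \<noteq> SYM" "out left \<noteq> MID" "out left \<noteq> FIN" "out left \<noteq> DENOM" "out left \<noteq> SCALE" "out left \<noteq> BASE"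
  "out left \<noteq> PX" "out left \<noteq> PY" "out left \<noteq> COUNT" "out left \<noteq> SIZE" "out left \<noteq> LEN"
  by (simp_all add: out_def)

lemmas out_ne_sym [simp] = out_ne[symmetric]

lemma state_cong:
  assumes "state st L t" "\<And>x. x \<notin> {PX, PY, ITEM, SYM, MID, FIN, out left} \<Longrightarrow> t' x = t x"
    "written left D (t' (out left)) L'"
  shows "state st L' t'"
proof -
  have "t' STACK = t STACK" "t' SP = t SP" by (rule assms(2); simp)+
  moreover have "t' x = t x" if "x \<notin> temps left" for x
    by (rule assms(2)) (use that in \<open>auto simp: temps_def\<close>)
  ultimately show ?thesis using assms(1,3) unfolding state_def by simp
qed

lemma state_set_temp [simp]:
  assumes "x \<in> {PX, PY, ITEM, SYM, MID, FIN}"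
  shows "state st L (t(x := a)) \<longleftrightarrow> state st L t"
proof
  have x: "x \<noteq> STACK" "x \<noteq> SP" "x \<noteq> out left" using assms by auto
  show "state st L t" if "state st L (t(x := a))"
    by (rule state_cong[OF that]) (use assms x that in \<open>auto simp: state_def\<close>)
  show "state st L (t(x := a))" if "state st L t"
    by (rule state_cong[OF that]) (use assms x that in \<open>auto simp: state_def\<close>)
qed

text \<open>Membership of \<open>p\<close> in \<open>total\<close> yields all word bounds, so no
  kind of vertex needs an estimate of its own.\<close>

lemma wp_put_state:
  assumes "state st L t" "L @ p # rest = total"
    and ex: "safe t ex" "val t ex = fst p"
    and ey: "safe (t(PX := (t PX)(0 := fst p))) ey" "val (t(PX := (t PX)(0 := fst p))) ey = snd p"
    and Q: "\<And>t'. state st (L @ [p]) t' \<Longrightarrow> t' ITEM = t ITEM \<Longrightarrow> t' MID = t MID \<Longrightarrow> t' FIN = t FIN \<Longrightarrow> Q t'"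
  shows "wp B (put left ex ey) t Q"
proof (rule wp_put[OF _ frame(3)[OF assms(1)] ex ey])
  show "written left D (t (out left)) L" using assms(1) by (simp add: state_def)
  have "p \<in> set total" using assms(2) by auto
  then show "\<bar>fst p\<bar> \<le> B" "\<bar>snd p\<bar> + D * D \<le> B" using points by auto
  show "0 \<le> D" "D \<le> B" by (rule D)+
  have "length L < length total" using assms(2) by auto
  then show "int (length L) < B" using B(3) by linarith
  fix t' assume t': "written left D (t' (out left)) (L @ [p])"
    "\<And>x. x \<noteq> PX \<Longrightarrow> x \<noteq> PY \<Longrightarrow> x \<noteq> out left \<Longrightarrow> t' x = t x"
  show "Q t'"
  proof (rule Q)
    show "state st (L @ [p]) t'"
      by (rule state_cong[of st L t]) (use assms(1) t' in auto)
    show "t' ITEM = t ITEM" "t' MID = t MID" "t' FIN = t FIN"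
      by (rule t'(2); simp)+
  qed
qed

lemma wp_put_between:
  assumes "state st L t" "L @ leaf_pt left K (2 * int j - 1) 0 # rest = total" "t MID 0 = int j"
    and Q: "\<And>t'. state st (L @ [leaf_pt left K (2 * int j - 1) 0]) t' \<Longrightarrow> t' ITEM = t ITEM \<Longrightarrow>
      t' MID = t MID \<Longrightarrow> t' FIN = t FIN \<Longrightarrow> Q t'"
  shows "wp B (put_between left) t Q"
  unfolding put_between_def
proof (rule wp_put_state[OF assms(1,2)], goal_cases)
  case (5 t')
  then show ?case by (rule Q)
qed (use assms(3) frame[OF assms(1)] in \<open>simp_all add: leaf_x_def leaf_pt_def\<close>)

lemma wp_put_leaf:
  assumes "state st L t" "L @ leaf_pt left K (2 * int n) (v ! i) # rest = total" "i < m"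
    and "t ITEM 0 = int n" "t SYM 0 = int i"
    and Q: "\<And>t'. state st (L @ [leaf_pt left K (2 * int n) (v ! i)]) t' \<Longrightarrow> Q t'"
  shows "wp B (put_leaf left) t Q"
proof -
  have pos: "nat (int base + int i) = base + i" by simp
  show ?thesis
    unfolding put_leaf_def
  proof (rule wp_put_state[OF assms(1,2)], goal_cases)
    case (5 t')
    from 5(1) show ?case by (rule Q)
  qed (use assms(3-5) frame[OF assms(1)] vec pos in \<open>simp_all add: leaf_x_def leaf_pt_def\<close>)
qed

lemma wp_put_interval:
  assumes "state st L t" "L @ interval_pt left K a b # rest = total"
    and "\<And>x. safe (t(PX := x)) l \<and> val (t(PX := x)) l = a" "\<And>x. safe (t(PX := x)) r \<and> val (t(PX := x)) r = b"
    and Q: "\<And>t'. state st (L @ [interval_pt left K a b]) t' \<Longrightarrow> t' ITEM = t ITEM \<Longrightarrow>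
      t' MID = t MID \<Longrightarrow> t' FIN = t FIN \<Longrightarrow> Q t'"
  shows "wp B (put_interval left l r) t Q"
  unfolding put_interval_def
proof (rule wp_put_state[OF assms(1,2)], goal_cases)
  case (5 t')
  then show ?case by (rule Q)
qed (use assms(3,4)[of "t PX"] assms(3,4) frame[OF assms(1)]
     in \<open>simp_all add: interval_pt_def power2_eq_square algebra_simps\<close>)

lemma wp_put_or_interval:
  assumes "state st L t" "t ITEM 0 = int n" "t MID 0 = int j" "t FIN 0 = int e"
    and "L @ (if fst_child then interval_pt left K (2 * int n + 2) (2 * int j - 1)
      else interval_pt left K (2 * int j - 1) (2 * int e - 2)) # rest = total"
    and Q: "\<And>t'. state st (L @ [if fst_child then interval_pt left K (2 * int n + 2) (2 * int j - 1)
      else interval_pt left K (2 * int j - 1) (2 * int e - 2)]) t' \<Longrightarrow> t' ITEM = t ITEM \<Longrightarrow>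
      t' MID = t MID \<Longrightarrow> Q t'"
  shows "wp B (if fst_child then put_fst_interval left else put_snd_interval left) t Q"
proof (cases fst_child)
  case True
  have "wp B (put_fst_interval left) t Q"
    unfolding put_fst_interval_def
    by (rule wp_put_interval[OF assms(1), of "2 * int n + 2" "2 * int j - 1" rest]) (use assms True in simp_all)
  then show ?thesis using True by simp
next
  case False
  have "wp B (put_snd_interval left) t Q"
    unfolding put_snd_interval_def
    by (rule wp_put_interval[OF assms(1), of "2 * int j - 1" "2 * int e - 2" rest]) (use assms False in simp_all)
  then show ?thesis using False by simp
qed

lemma wp_load_ends:
  assumes "state st L t" "t ITEM 0 = int n" "drop n cs = c # prefix_code f @ prefix_code g @ rest"
    and "s0 ENDS n = int (Suc n + csize f + csize g)" "n + csize f + csize g < length cs"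
    and Q: "\<And>t'. state st L t' \<Longrightarrow> t' ITEM = t ITEM \<Longrightarrow> t' SYM = t SYM \<Longrightarrow> t' MID 0 = int (Suc n + csize f) \<Longrightarrow>
      t' FIN 0 = int (Suc n + csize f + csize g) \<Longrightarrow> Q t'"
  shows "wp B load_ends t Q"
proof -
  have "s0 ENDS (Suc n) = int (Suc n + csize f)"
    by (rule ends[OF code_at_children(1)[OF assms(3)]])
  moreover have "nat (int n + 1) = Suc n" by simp
  moreover have "\<bar>int (Suc n + csize f)\<bar> \<le> B" "\<bar>int (Suc n + csize f + csize g)\<bar> \<le> B"
    using assms(5) B(2) by linarith+
  moreover have "Q (t(MID := (t MID)(0 := int (Suc n + csize f)),
      FIN := (t FIN)(0 := int (Suc n + csize f + csize g))))"
    by (rule Q) (use assms(1) in auto)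
  ultimately show ?thesis
    using assms(2,4) frame[OF assms(1)] by (simp add: load_ends_def)
qed

end

context gadget_writer begin

lemma loop_invI:
  assumes "state st L t" "\<And>x. x \<in> set st \<Longrightarrow> item_ok cs x" "sum_list (map item_work st) = w"
    "L @ concat (map (item_points left K v) st) = total" "w \<le> 2 * length cs"
  shows "loop_inv w t"
  using assms unfolding loop_inv_def by blast

lemma state_push:
  assumes "state xs L t" "stack_rep a (ys @ xs)" "k = int (length ys + length xs)"
  shows "state (ys @ xs) L (t(STACK := a, SP := (t SP)(0 := k)))"
proof -
  have "(t(STACK := a, SP := (t SP)(0 := k))) x = t x" if "x \<notin> temps left" for x
    using that by (auto simp: temps_def)
  then show ?thesis using assms unfolding state_def by simp
qed

lemma length_stack_le:
  assumes "sum_list (map item_work st) = w" "w \<le> 2 * length cs"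
  shows "int (length st) \<le> B"
  using length_le_work[of st] assms B(2) by linarith

lemma wp_push_and:
  assumes "state xs L t" "t ITEM 0 = int n" "t MID 0 = int j" "j \<le> length cs" "n < length cs"
    and "int (length xs) + 2 \<le> B"
    and Q: "\<And>t'. state (Node f (Suc n) # Node g j # xs) L t' \<Longrightarrow> Q t'"
  shows "wp B push_and t Q"
proof -
  define l where "l = length xs"
  have sp: "t SP 0 = int l" and rep: "stack_rep (t STACK) xs" using assms(1) by (auto simp: state_def l_def)
  have nat: "nat (int l + 1) = Suc l" by simp
  have "state ([Node f (Suc n), Node g j] @ xs) L (t(STACK := (t STACK)(l := int j, Suc l := int n + 1),
      SP := (t SP)(0 := int l + 2)))"
    by (rule state_push[OF assms(1)]) (use rep in \<open>simp_all add: l_def\<close>)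
  then have "Q (t(STACK := (t STACK)(l := int j, Suc l := int n + 1), SP := (t SP)(0 := int l + 2)))"
    by (intro Q) simp
  then show ?thesis using assms(2-6) sp B(2) nat by (simp add: push_and_def l_def[symmetric])
qed

lemma wp_push_or:
  assumes "state xs L t" "t ITEM 0 = int n" "t MID 0 = int j" "j \<le> length cs" "n < length cs"
    and "int (length xs) + 3 \<le> B"
    and Q: "\<And>t'. state ((if left then [Node f (Suc n), Node g j] else [Node g j, Node f (Suc n)])
        @ Close f g n # xs) L t' \<Longrightarrow> Q t'"
  shows "wp B (push_or left) t Q"
proof -
  define l where "l = length xs"
  define a where "a = (t STACK)(l := - 1 - int n, Suc l := (if left then int j else int n + 1),
      Suc (Suc l) := (if left then int n + 1 else int j))"
  have sp: "t SP 0 = int l" and rep: "stack_rep (t STACK) xs" using assms(1) by (auto simp: state_def l_def)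
  have nat: "nat (int l + 1) = Suc l" "nat (int l + 2) = Suc (Suc l)" by simp_all
  have "state (((if left then [Node f (Suc n), Node g j] else [Node g j, Node f (Suc n)]) @ [Close f g n]) @ xs) L
      (t(STACK := a, SP := (t SP)(0 := int l + 3)))"
    by (rule state_push[OF assms(1)]) (use rep in \<open>auto simp: l_def a_def\<close>)
  then have "Q (t(STACK := a, SP := (t SP)(0 := int l + 3)))"
    by (intro Q) simp
  then show ?thesis using assms(2-6) sp B(2) nat
    by (cases left) (simp_all add: push_or_def l_def[symmetric] a_def)
qed

lemma wp_close_or:
  assumes s: "state xs L t" and item: "t ITEM 0 = - 1 - int n" and ok: "code_at cs (Or f g) n"
    and total: "L @ item_points left K v (Close f g n) @ rest = total"
    and Q: "\<And>t'. state xs (L @ item_points left K v (Close f g n)) t' \<Longrightarrow> Q t'"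
  shows "wp B (close_or left) t Q"
proof -
  let ?j = "Suc n + csize f" and ?e = "Suc n + csize f + csize g"
  let ?i = "if left then interval_pt left K (2 * int n + 2) (2 * int ?j - 1)
      else interval_pt left K (2 * int ?j - 1) (2 * int ?e - 2)"
  let ?u = "leaf_pt left K (2 * int ?j - 1) 0"
  have pts: "item_points left K v (Close f g n) = [?i, ?u]" by (simp add: Let_def)
  have size: "n + csize f + csize g < length cs" using code_at_size[OF ok] by simp
  obtain r where r: "drop n cs = -2 # prefix_code f @ prefix_code g @ r" using ok by (auto simp: code_at_def)
  have e: "s0 ENDS n = int ?e" using ends[OF ok] by simp
  define t1 where "t1 = t(ITEM := (t ITEM)(0 := int n))"
  have s1: "state xs L t1" using s by (simp add: t1_def)
  have "wp B (load_ends ;; (if left then put_fst_interval left else put_snd_interval left) ;; put_between left) t1 Q"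
    unfolding wp.simps(3)
  proof (rule wp_load_ends[OF s1 _ r e size])
    show "t1 ITEM 0 = int n" by (simp add: t1_def)
    fix t2 assume t2: "state xs L t2" "t2 ITEM = t1 ITEM" "t2 MID 0 = int ?j" "t2 FIN 0 = int ?e"
    have i2: "t2 ITEM 0 = int n" by (simp add: t2(2) t1_def)
    have last: "wp B (put_between left) t3 Q" if "state xs (L @ [?i]) t3" "t3 MID = t2 MID" for t3
    proof (rule wp_put_between[OF that(1)])
      show "(L @ [?i]) @ ?u # rest = total" using total unfolding pts by simp
      show "t3 MID 0 = int ?j" using that(2) t2(3) by simp
      show "Q t'" if "state xs ((L @ [?i]) @ [?u]) t'" for t'
        by (rule Q) (use that in \<open>simp only: pts append_assoc append_Cons append_Nil\<close>)
    qed
    show "wp B (if left then put_fst_interval left else put_snd_interval left) t2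
        (\<lambda>t. wp B (put_between left) t Q)"
    proof (rule wp_put_or_interval[OF t2(1) i2 t2(3,4)])
      show "L @ ?i # ?u # rest = total" using total unfolding pts by simp
    qed (rule last)
  qed
  moreover have "int n \<le> B" using size B(2) by linarith
  ultimately show ?thesis using item by (simp add: close_or_def t1_def)
qed

lemma wp_open_or:
  assumes s: "state xs L t" and item: "t ITEM 0 = int n" and sym: "t SYM 0 = - 2"
    and ok: "code_at cs (Or f g) n" and space: "int (length xs) + 3 \<le> B"
    and total: "L @ gadget left K v (Or f g) n @ rest = total"
    and Q: "\<And>t' L'. state ((if left then [Node f (Suc n), Node g (Suc n + csize f)]
        else [Node g (Suc n + csize f), Node f (Suc n)]) @ Close f g n # xs) L' t' \<Longrightarrow>
      L' @ (if left then gadget left K v f (Suc n) @ gadget left K v g (Suc n + csize f)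
        else gadget left K v g (Suc n + csize f) @ gadget left K v f (Suc n))
        @ item_points left K v (Close f g n) @ rest = total \<Longrightarrow> Q t'"
  shows "wp B (load_ends ;; Cond (Const (- 1) [<=] cell SYM) push_and (open_or left)) t Q"
  unfolding wp.simps(3)
proof -
  let ?j = "Suc n + csize f" and ?e = "Suc n + csize f + csize g"
  let ?i = "if \<not> left then interval_pt left K (2 * int n + 2) (2 * int ?j - 1)
      else interval_pt left K (2 * int ?j - 1) (2 * int ?e - 2)"
  let ?u = "leaf_pt left K (2 * int ?j - 1) 0"
  let ?mid = "(if left then gadget left K v f (Suc n) @ gadget left K v g ?j
        else gadget left K v g ?j @ gadget left K v f (Suc n)) @ item_points left K v (Close f g n)"
  have pts: "gadget left K v (Or f g) n = ?u # ?i # ?mid" by (simp add: Let_def)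
  have size: "n + csize f + csize g < length cs" using code_at_size[OF ok] by simp
  obtain r where r: "drop n cs = -2 # prefix_code f @ prefix_code g @ r" using ok by (auto simp: code_at_def)
  have e: "s0 ENDS n = int ?e" using ends[OF ok] by simp
  show "wp B load_ends t (\<lambda>t. wp B (Cond (Const (- 1) [<=] cell SYM) push_and (open_or left)) t Q)"
  proof (rule wp_load_ends[OF s item r e size])
    fix t2 assume t2: "state xs L t2" "t2 ITEM = t ITEM" "t2 SYM = t SYM" "t2 MID 0 = int ?j" "t2 FIN 0 = int ?e"
    have last: "wp B (push_or left) t4 Q" if "state xs (L @ [?u, ?i]) t4" "t4 MID 0 = int ?j" "t4 ITEM 0 = int n" for t4
    proof (rule wp_push_or[OF that(1,3,2) _ _ space])
      show "?j \<le> length cs" "n < length cs" using size by auto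
      show "Q t'" if "state ((if left then [Node f (Suc n), Node g ?j] else [Node g ?j, Node f (Suc n)])
        @ Close f g n # xs) (L @ [?u, ?i]) t'" for t'
        by (rule Q[OF that]) (use total in \<open>simp only: pts append_assoc append_Cons append_Nil\<close>)
    qed
    have second: "wp B (if \<not> left then put_fst_interval left else put_snd_interval left) t3
        (\<lambda>t. wp B (push_or left) t Q)"
      if t3: "state xs (L @ [?u]) t3" "t3 ITEM 0 = int n" "t3 MID 0 = int ?j" "t3 FIN 0 = int ?e" for t3
    proof (rule wp_put_or_interval[OF t3])
      show "(L @ [?u]) @ ?i # ?mid @ rest = total" using total unfolding pts by simp
    qed (use last t3 in simp)
    have "wp B (open_or left) t2 Q"
      unfolding open_or_def wp.simps(3)
    proof (rule wp_put_between[OF t2(1) _ t2(4)], goal_cases)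
      case 1
      show "L @ ?u # ?i # ?mid @ rest = total" using total unfolding pts by simp
    next
      case (2 t3)
      show ?case by (rule second[OF 2(1)]) (use 2 t2 item in simp_all)
    qed
    then show "wp B (Cond (Const (- 1) [<=] cell SYM) push_and (open_or left)) t2 Q"
      unfolding wp.simps(4) using t2(3) sym by simp
  qed
qed

text \<open>Replacing a node by its children and possibly a closing item uses up one unit of work;
  the vertices written at once and those promised afterwards together are those of the node.\<close>

lemma wp_open_node:
  assumes s: "state xs L t" and item: "t ITEM 0 = int n" and ok: "code_at cs f n"
    and xs: "\<And>x. x \<in> set xs \<Longrightarrow> item_ok cs x" "work f + sum_list (map item_work xs) = Suc w" "w \<le> 2 * length cs"
    and total: "L @ gadget left K v f n @ concat (map (item_points left K v) xs) = total"
  shows "wp B (open_node left) t (loop_inv w)"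
proof -
  have n: "n < length cs" and hd: "cs ! n = hd (prefix_code f)" using code_at_nth[OF ok] by auto
  define t1 where "t1 = t(SYM := (t SYM)(0 := hd (prefix_code f)))"
  have s1: "state xs L t1" using s by (simp add: t1_def)
  have i1: "t1 ITEM 0 = int n" and sym: "t1 SYM 0 = hd (prefix_code f)" using item by (simp_all add: t1_def)
  have nat: "nat (3 + int n) = 3 + n" by simp
  have "t INPUT (3 + n) = hd (prefix_code f)" using frame(1)[OF s] code[OF n] hd by simp
  then have start: "wp B (open_node left) t Q \<longleftrightarrow> \<bar>hd (prefix_code f)\<bar> \<le> B \<and>
      wp B (Cond (Const 0 [<=] cell SYM) (put_leaf left)
       (load_ends ;; Cond (Const (- 1) [<=] cell SYM) push_and (open_or left))) t1 Q" for Q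
    using item nat by (simp add: open_node_def t1_def del: wp.simps(4))
  show ?thesis
  proof (cases f)
    case (Var i)
    have "i < m" using vars[of i n] ok Var by simp
    have "wp B (put_leaf left) t1 (loop_inv w)"
    proof (rule wp_put_leaf[OF s1 _ \<open>i < m\<close> i1])
      show "L @ leaf_pt left K (2 * int n) (v ! i) # concat (map (item_points left K v) xs) = total"
        using total Var by simp
      show "t1 SYM 0 = int i" using sym Var by simp
      show "loop_inv w t'" if "state xs (L @ [leaf_pt left K (2 * int n) (v ! i)]) t'" for t'
        by (rule loop_invI[OF that xs(1) _ _ xs(3)]) (use xs total Var in auto)
    qed
    then show ?thesis unfolding start using sym Var \<open>i < m\<close> B(4) by simp
  next
    case (And f1 f2)
    note ok' = ok[unfolded And]
    let ?j = "Suc n + csize f1" and ?e = "Suc n + csize f1 + csize f2"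
    have size: "n + csize f1 + csize f2 < length cs" using code_at_size[OF ok'] by simp
    obtain r where r: "drop n cs = -1 # prefix_code f1 @ prefix_code f2 @ r" using ok' by (auto simp: code_at_def)
    have e: "s0 ENDS n = int ?e" using ends[OF ok'] by simp
    have "wp B load_ends t1 (\<lambda>t. wp B (Cond (Const (- 1) [<=] cell SYM) push_and (open_or left)) t (loop_inv w))"
    proof (rule wp_load_ends[OF s1 i1 r e size])
      fix t2 assume t2: "state xs L t2" "t2 ITEM = t1 ITEM" "t2 SYM = t1 SYM" "t2 MID 0 = int ?j" "t2 FIN 0 = int ?e"
      have new: "sum_list (map item_work (Node f1 (Suc n) # Node f2 ?j # xs)) = w" using xs(2) And by simp
      have "wp B push_and t2 (loop_inv w)"
      proof (rule wp_push_and[OF t2(1) _ t2(4)])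
        show "t2 ITEM 0 = int n" using t2(2) i1 by simp
        show "?j \<le> length cs" "n < length cs" using size by auto
        show "int (length xs) + 2 \<le> B" using length_stack_le[OF new xs(3)] by simp
        show "loop_inv w t'" if "state (Node f1 (Suc n) # Node f2 ?j # xs) L t'" for t'
          by (rule loop_invI[OF that _ new _ xs(3)]) (use xs(1) code_at_And[OF ok'] total And in auto)
      qed
      then show "wp B (Cond (Const (- 1) [<=] cell SYM) push_and (open_or left)) t2 (loop_inv w)"
        unfolding wp.simps(4) using t2(3) sym And by simp
    qed
    then show ?thesis unfolding start wp.simps(4)[of B "Const 0 [<=] cell SYM"] wp.simps(3)[of B load_ends]
      using sym And B(1) by simp
  next
    case (Or f1 f2)
    note ok' = ok[unfolded Or]
    let ?j = "Suc n + csize f1"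
    let ?new = "(if left then [Node f1 (Suc n), Node f2 ?j] else [Node f2 ?j, Node f1 (Suc n)]) @ Close f1 f2 n # xs"
    have new: "sum_list (map item_work ?new) = w" using xs(2) Or by simp
    have "wp B (load_ends ;; Cond (Const (- 1) [<=] cell SYM) push_and (open_or left)) t1 (loop_inv w)"
    proof (rule wp_open_or[OF s1 i1 _ ok'])
      show "t1 SYM 0 = - 2" using sym Or by simp
      show "int (length xs) + 3 \<le> B" using length_stack_le[OF new xs(3)] by (simp split: if_splits)
      show "L @ gadget left K v (Or f1 f2) n @ concat (map (item_points left K v) xs) = total" using total Or by simp
      fix t' L' assume *: "state ?new L' t'"
        "L' @ (if left then gadget left K v f1 (Suc n) @ gadget left K v f2 ?j
        else gadget left K v f2 ?j @ gadget left K v f1 (Suc n))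
        @ item_points left K v (Close f1 f2 n) @ concat (map (item_points left K v) xs) = total"
      show "loop_inv w t'"
      proof (rule loop_invI[OF *(1) _ new _ xs(3)])
        show "item_ok cs x" if "x \<in> set ?new" for x
          using that xs(1) code_at_Or[OF ok'] ok' by (auto split: if_splits)
        show "L' @ concat (map (item_points left K v) ?new) = total"
          using *(2) by (cases left) (simp_all del: item_points.simps(2))
      qed
    qed
    then show ?thesis unfolding start wp.simps(4)[of B "Const 0 [<=] cell SYM"]
      using sym Or B(1) by simp
  qed
qed

lemma wp_step:
  assumes "loop_inv (Suc w) t"
  shows "wp B (step left) t (loop_inv w)"
proof -
  obtain st L where st: "state st L t" "\<And>x. x \<in> set st \<Longrightarrow> item_ok cs x" "sum_list (map item_work st) = Suc w"
    "L @ concat (map (item_points left K v) st) = total" and w: "Suc w \<le> 2 * length cs"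
    using assms unfolding loop_inv_def by blast
  obtain x xs where x: "st = x # xs" using st(3) by (cases st) auto
  have w': "w \<le> 2 * length cs" using w by simp
  define t1 where "t1 = t(SP := (t SP)(0 := int (length xs)))"
  define t2 where "t2 = t1(ITEM := (t1 ITEM)(0 := item_code x))"
  have "state ([] @ xs) L (t1(STACK := t STACK, SP := (t1 SP)(0 := int (length xs))))"
  proof -
    have "t1 x = t x" if "x \<notin> temps left" for x using that by (auto simp: temps_def t1_def)
    then show ?thesis using st(1) x unfolding state_def by (auto simp: t1_def temps_def)
  qed
  moreover have "t1(STACK := t STACK, SP := (t1 SP)(0 := int (length xs))) = t1"
    by (auto simp: t1_def fun_eq_iff)
  ultimately have s1: "state xs L t1" by simp
  then have s2: "state xs L t2" by (simp add: t2_def)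
  have sp: "t SP 0 = int (length xs) + 1" and top: "t STACK (length xs) = item_code x"
    using st(1) x by (auto simp: state_def)
  have len: "int (length xs) \<le> B" using length_stack_le[OF st(3) w] x by simp
  have ok: "item_ok cs x" using st(2) x by simp
  have item: "\<bar>item_code x\<bar> \<le> B"
  proof (cases x)
    case (Node f n)
    then show ?thesis using ok code_at_nth[of cs f n] B(2) by simp
  next
    case (Close f g n)
    then show ?thesis using ok code_at_nth[of cs "Or f g" n] B(2) by simp
  qed
  have "wp B (Cond (cell ITEM [<=] Const (- 1)) (close_or left) (open_node left)) t2 (loop_inv w)"
  proof (cases x)
    case (Node f n)
    have "wp B (open_node left) t2 (loop_inv w)"
      by (rule wp_open_node[OF s2]) (use Node ok st x w' in \<open>auto simp: t2_def\<close>)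
    then show ?thesis using Node by (simp add: t2_def)
  next
    case (Close f g n)
    have ok': "code_at cs (Or f g) n" using ok Close by simp
    have tot: "L @ item_points left K v (Close f g n) @ concat (map (item_points left K v) xs) = total"
      using st(4) x Close by simp
    have "wp B (close_or left) t2 (loop_inv w)"
    proof (rule wp_close_or[OF s2 _ ok' tot])
      show "t2 ITEM 0 = - 1 - int n" by (simp add: t2_def Close)
      show "loop_inv w t'" if "state xs (L @ item_points left K v (Close f g n)) t'" for t'
        by (rule loop_invI[OF that _ _ _ w'])
           (use st(2,3) x Close tot in \<open>simp_all del: item_points.simps\<close>)
    qed
    then show ?thesis using Close by (simp add: t2_def)
  qed
  then show ?thesis
    using sp top len item by (simp add: step_def t1_def t2_def del: wp.simps(4))
qed

lemma runs_write_gadget: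
  assumes f: "code_at cs f 0" and L: "written left D (\<sigma> (out left)) L" and frame: "\<And>x. x \<notin> temps left \<Longrightarrow> \<sigma> x = s0 x"
    and total: "L @ gadget left K v f 0 = total"
  shows "runs B (write_gadget left) \<sigma> (700 * length cs) (\<lambda>t. written left D (t (out left)) total \<and>
      (\<forall>x. x \<notin> temps left \<longrightarrow> t x = s0 x))"
proof -
  define \<sigma>1 where "\<sigma>1 = \<sigma>(STACK := (\<sigma> STACK)(0 := 0), SP := (\<sigma> SP)(0 := 1))"
  have len: "0 < length cs" using code_at_nth[OF f] by auto
  have "work f \<le> 2 * length cs" using work_le[of f] code_at_size[OF f] by linarith
  have s1: "state [Node f 0] L \<sigma>1"
  proof -
    have "\<sigma>1 x = s0 x" if "x \<notin> temps left" for x using that frame[OF that] by (auto simp: temps_def \<sigma>1_def)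
    then show ?thesis using L unfolding state_def by (simp add: \<sigma>1_def)
  qed
  have inv: "loop_inv (work f) \<sigma>1"
    by (rule loop_invI[OF s1]) (use f total \<open>work f \<le> 2 * length cs\<close> in auto)
  have loop: "runs B (While (Const 1 [<=] cell SP) (step left)) \<sigma>1 (2 * length cs * (5 + 300) + 5) (loop_inv 0)"
  proof (rule runs_While[OF B(1)])
    show "loop_inv (work f) \<sigma>1" by (rule inv)
    show "simple_expr (Const 1 [<=] cell SP)" "width (Const 1 [<=] cell SP) \<le> 20" using B(1) by auto
    fix w t assume *: "loop_inv (Suc w) t"
    then obtain st L where "state st L t" "sum_list (map item_work st) = Suc w"
      unfolding loop_inv_def by blast
    then have "1 \<le> t SP 0" by (cases st) (auto simp: state_def)
    moreover have "runs B (step left) t 300 (loop_inv w)"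
      by (rule runs_wp[OF B(1) step_admissible wp_step[OF *] step_time])
    ultimately show "safe t (Const 1 [<=] cell SP) \<and> val t (Const 1 [<=] cell SP) \<noteq> 0 \<and>
        runs B (step left) t 300 (loop_inv w)" by simp
  next
    fix t assume "loop_inv 0 t"
    then obtain st L where st: "state st L t" "sum_list (map item_work st) = 0"
      unfolding loop_inv_def by blast
    then have "st = []" using length_le_work[of st] unfolding st(2) by simp
    then show "safe t (Const 1 [<=] cell SP) \<and> val t (Const 1 [<=] cell SP) = 0"
      using st(1) by (simp add: state_def)
  next
    have "work f * 305 \<le> 2 * length cs * 305" using \<open>work f \<le> 2 * length cs\<close> by (rule mult_right_mono) simp
    then show "work f * (1 + cost (Const 1 [<=] cell SP) + 300) + 1 + cost (Const 1 [<=] cell SP) \<le> 2 * length cs * (5 + 300) + 5"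
      by simp
  qed
  have post: "written left D (t (out left)) total \<and> (\<forall>x. x \<notin> temps left \<longrightarrow> t x = s0 x)" if "loop_inv 0 t" for t
  proof -
    from that obtain st L where st: "state st L t" "sum_list (map item_work st) = 0" "L @ concat (map (item_points left K v) st) = total"
      unfolding loop_inv_def by blast
    have "st = []" using length_le_work[of st] unfolding st(2) by simp
    then show ?thesis using st by (simp add: state_def)
  qed
  have "runs B (write_gadget left) \<sigma> (3 + (3 + (2 * length cs * (5 + 300) + 5))) (loop_inv 0)"
    unfolding write_gadget_def
  proof (rule runs_Seq)
    show "runs B (Write STACK (Const 0) (Const 0)) \<sigma> 3 (\<lambda>t. t = \<sigma>(STACK := (\<sigma> STACK)(0 := 0)))"
      by (rule runs_wp[OF B(1)]) (use B(1) in auto)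
    fix t assume t: "t = \<sigma>(STACK := (\<sigma> STACK)(0 := 0))"
    show "runs B (SP [:=] Const 1 ;; While (Const 1 [<=] cell SP) (step left)) t (3 + (2 * length cs * (5 + 300) + 5)) (loop_inv 0)"
    proof (rule runs_Seq)
      show "runs B (SP [:=] Const 1) t 3 (\<lambda>t. t = \<sigma>1)"
        by (rule runs_wp[OF B(1)]) (use B(1) t in \<open>auto simp: \<sigma>1_def\<close>)
    qed (use loop in auto)
  qed simp
  then show ?thesis
  proof (rule runs_mono[OF _ post])
    \<comment> \<open>The exact bound is \<open>610 * length cs + 11\<close>; a nonempty code lets
      700 absorb the summand.\<close>
    have "1 \<le> length cs" using len by linarith
    then show "3 + (3 + (2 * length cs * (5 + 300) + 5)) \<le> 700 * length cs" by simp
  qed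
qed

end

text \<open>A formula with \<open>m\<close> leaves has \<open>m - 1\<close> binary gates, so its
  code has \<open>2 * m - 1\<close> symbols and the length need not be found by parsing.\<close>

definition prelude :: com where
  "prelude = LEN [:=] Const 2 [*] Read INPUT (Const 1) [-] Const 1 ;;
     SCALE [:=] Read INPUT (Const 2) [+] Const 1 ;;
     SIZE [:=] (cell SCALE [*] cell LEN) [*] (cell SCALE [*] cell LEN) ;;
     DENOM [:=] Const 100 [*] cell SIZE ;;
     COUNT [:=] cell LEN"

text \<open>The code is scanned from right to left: a gate ends where its right child ends, and its right child
  starts where its left child ends.\<close>

definition find_end :: com where
  "find_end = COUNT [:=] cell COUNT [-] Const 1 ;;
     Cond (Const 0 [<=] Read INPUT (Const 3 [+] cell COUNT))
       (Write ENDS (cell COUNT) (cell COUNT [+] Const 1))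
       (Write ENDS (cell COUNT) (Read ENDS (Read ENDS (cell COUNT [+] Const 1))))"

definition find_ends :: com where
  "find_ends = While (Const 1 [<=] cell COUNT) find_end"

definition put_if :: "bool \<Rightarrow> expr \<Rightarrow> expr \<Rightarrow> com" where
  "put_if left ex ey = (if left then put left ex ey else Skip)"

definition put_guard :: "bool \<Rightarrow> expr \<Rightarrow> com" where
  "put_guard left j = put left (leaf_x j) (Const (if left then 0 else 1))"

definition write_vector :: "bool \<Rightarrow> com" where
  "write_vector left = put_if left (Const (- 1)) (Const (- 50) [*] cell SIZE) ;;
     put_guard left (Const (- 1)) ;; write_gadget left ;;
     put_guard left (Const 2 [*] cell LEN [-] Const 1) ;;
     put_if left (Const 1) (Const (- 50) [*] cell SIZE) ;;
     BASE [:=] cell BASE [+] Read INPUT (Const 1) ;; COUNT [:=] cell COUNT [+] Const 1"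

definition write_vectors :: "bool \<Rightarrow> com" where
  "write_vectors left = COUNT [:=] Const 0 ;;
     While (cell COUNT [+] Const 1 [<=] Read INPUT (Const 0)) (write_vector left)"

text \<open>\<open>BASE\<close> is set only once: after the vectors of \<open>A\<close> it points to
  the first vector of \<open>B\<close>.\<close>

definition reduction :: com where
  "reduction = prelude ;; find_ends ;; BASE [:=] Const 3 [+] cell LEN ;; write_vectors True ;;
     put False (Const 0) (Const 40 [*] cell SIZE) ;;
     put False (Const (- 1)) (Const 1 [-] Const 50 [*] cell SIZE) ;;
     write_vectors False ;;
     put False (Const 1) (Const 1 [-] Const 50 [*] cell SIZE) ;;
     put False (Const 0) (Const 40 [*] cell SIZE)"

section \<open>Unique readability of the prefix code, sizes of code and gadgets\<close>

lemma prefix_code_unique: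
  "prefix_code f @ r = prefix_code g @ r' \<Longrightarrow> f = g"
proof (induction f arbitrary: g r r')
  case (Var i)
  then show ?case by (cases g) auto
next
  case (And f1 f2)
  then obtain g1 g2 where g: "g = And g1 g2" by (cases g) auto
  have "prefix_code f1 @ (prefix_code f2 @ r) = prefix_code g1 @ (prefix_code g2 @ r')" using And.prems g by simp
  moreover from this have "f1 = g1" by (rule And.IH(1))
  ultimately show ?case using And.IH(2) g by simp
next
  case (Or f1 f2)
  then obtain g1 g2 where g: "g = Or g1 g2" by (cases g) auto
  have "prefix_code f1 @ (prefix_code f2 @ r) = prefix_code g1 @ (prefix_code g2 @ r')" using Or.prems g by simp
  moreover from this have "f1 = g1" by (rule Or.IH(1))
  ultimately show ?case using Or.IH(2) g by simp
qed

lemma code_at_unique: "code_at cs f n \<Longrightarrow> code_at cs g n \<Longrightarrow> f = g"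
  unfolding code_at_def using prefix_code_unique by metis

lemma subtree_index:
  fixes i a b :: nat
  assumes "i < Suc (a + b)"
  shows "i = 0 \<or> (\<exists>k < a. i = Suc k) \<or> (\<exists>k < b. i = Suc (a + k))"
  using assms by presburger

lemma code_at_exists_in_node:
  assumes "\<And>n i. code_at cs f n \<Longrightarrow> i < csize f \<Longrightarrow> \<exists>h. code_at cs h (n + i)"
    and "\<And>n i. code_at cs g n \<Longrightarrow> i < csize g \<Longrightarrow> \<exists>h. code_at cs h (n + i)"
    and "code_at cs F n" "code_at cs f (Suc n)" "code_at cs g (Suc n + csize f)"
    and "i < Suc (csize f + csize g)"
  shows "\<exists>h. code_at cs h (n + i)"
  using subtree_index[OF assms(6)] assms(1)[OF assms(4)] assms(2)[OF assms(5)] assms(3)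
  by (elim disjE exE conjE) (auto simp: add_ac)

text \<open>Needed for the right-to-left scan, which treats every index and must find a subformula
  there.\<close>

lemma code_at_exists:
  "code_at cs F n \<Longrightarrow> i < csize F \<Longrightarrow> \<exists>f. code_at cs f (n + i)"
proof (induction F arbitrary: n i)
  case (Var j)
  then show ?case by auto
next
  case (And f g)
  show ?case by (rule code_at_exists_in_node[OF And.IH And.prems(1) code_at_And[OF And.prems(1)]])
    (use And.prems(2) in auto)
next
  case (Or f g)
  show ?case by (rule code_at_exists_in_node[OF Or.IH Or.prems(1) code_at_Or[OF Or.prems(1)]])
    (use Or.prems(2) in auto)
qed

lemma set_prefix_code:
  "x \<in> set (prefix_code F) \<Longrightarrow> x = - 1 \<or> x = - 2 \<or> (\<exists>i \<in> set (leaves F). x = int i)"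
  by (induction F) auto

lemma csize_leaves: "csize F + 1 = 2 * length (leaves F)"
  by (induction F) auto

text \<open>Each leaf gives one vertex and each of the at most \<open>length (leaves f) - 1\<close>
  OR gates gives four.\<close>

lemma length_gadget: "length (gadget left K v f n) + 4 \<le> 5 * length (leaves f)"
proof (induction f arbitrary: n)
  case (And f g)
  from And.IH(1)[of "Suc n"] And.IH(2)[of "Suc n + csize f"] show ?case by simp
next
  case (Or f g)
  from Or.IH(1)[of "Suc n"] Or.IH(2)[of "Suc n + csize f"] show ?case
    by (cases left) (simp_all add: Let_def)
qed simp

lemma concat_uniform:
  assumes "\<And>v. v \<in> set V \<Longrightarrow> length v = m"
  shows "length (concat V) = length V * m"
    and "k < length V \<Longrightarrow> i < m \<Longrightarrow> concat V ! (k * m + i) = V ! k ! i"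
  using assms
proof (induction V arbitrary: k)
  case (Cons v V)
  {
    case 1
    then show ?case using Cons.IH(1) by simp
  next
    case 2
    then show ?case using Cons.IH(2)[of "k - 1"] by (cases k) (auto simp: nth_append)
  }
qed auto

section \<open>Memory layout of an instance, sizes and coordinates of its curves\<close>

locale reduction_run =
  fixes k n m M :: nat and F :: formula and A Bs :: "int list list" and B :: int
  assumes wf: "ineq_formula_pair k n m M F A Bs"
begin

definition C :: int where "C = int (csize F)"
definition K :: int where "K = int M + 1"
definition h :: int where "h = (K * C)\<^sup>2"
definition D :: int where "D = 100 * h"
definition input :: store where "input = initial_store (encode n m M F A Bs)"

lemma wfD:
  "1 \<le> n" "M \<le> n ^ k" "set (leaves F) = {..<m}" "length A = n" "length Bs = n" "length (leaves F) = m"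
  "v \<in> set A \<union> set Bs \<Longrightarrow> length v = m"
  "v \<in> set A \<union> set Bs \<Longrightarrow> i < m \<Longrightarrow> \<bar>v ! i\<bar> \<le> int M"
proof -
  show "1 \<le> n" "M \<le> n ^ k" "set (leaves F) = {..<m}" "length A = n" "length Bs = n"
    "v \<in> set A \<union> set Bs \<Longrightarrow> length v = m"
    using wf by (auto simp: ineq_formula_pair_def)
  have "distinct (leaves F)" "set (leaves F) = {..<m}" using wf by (auto simp: ineq_formula_pair_def)
  then show "length (leaves F) = m" using distinct_card by fastforce
  assume v: "v \<in> set A \<union> set Bs" "i < m"
  then have "v ! i \<in> set v" using wf by (auto simp: ineq_formula_pair_def)
  moreover have "\<forall>x \<in> set v. - int M \<le> x \<and> x \<le> int M"
    using wf v(1) unfolding ineq_formula_pair_def by blast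
  ultimately show "\<bar>v ! i\<bar> \<le> int M" by (meson abs_leI minus_le_iff)
qed

lemma C_eq: "C = 2 * int m - 1" and m_pos: "1 \<le> m" and csize_F: "csize F = 2 * m - 1"
  using csize_leaves[of F] wfD(6) csize_pos[of F] unfolding C_def by linarith+

sublocale scaled_grid K "int M" C h D
  by unfold_locales (use C_eq m_pos in \<open>auto simp: K_def h_def D_def\<close>)

definition start :: "bool \<Rightarrow> nat" where
  "start left = 3 + csize F + (if left then 0 else n * m)"

definition vectors :: "bool \<Rightarrow> int list list" where
  "vectors left = (if left then A else Bs)"

lemma length_encode: "length (encode n m M F A Bs) = 3 + csize F + 2 * (n * m)"
  using concat_uniform(1)[of A m] concat_uniform(1)[of Bs m] wfD by (simp add: encode_def)

lemma input_header: "input INPUT 0 = int n" "input INPUT (Suc 0) = int m" "input INPUT 2 = int M"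
  by (simp_all add: input_def initial_store_def encode_def)

lemma input_code: "i < csize F \<Longrightarrow> input INPUT (3 + i) = prefix_code F ! i"
  by (simp add: input_def initial_store_def encode_def nth_append)

lemma input_vectors:
  assumes "j < n" "i < m"
  shows "input INPUT (start left + j * m + i) = vectors left ! j ! i"
proof -
  have lt: "j * m + i < n * m"
  proof -
    have "j * m + i < Suc j * m" using assms by simp
    also have "\<dots> \<le> n * m" using assms by (intro mult_le_mono1) simp
    finally show ?thesis .
  qed
  have lA: "length (concat A) = n * m" and lB: "length (concat Bs) = n * m"
    using concat_uniform(1)[of A m] concat_uniform(1)[of Bs m] wfD by simp_all
  have "start left + j * m + i < length (encode n m M F A Bs)"
    unfolding length_encode start_def using lt by (cases left; simp only: if_True if_False; linarith)
  then have "input INPUT (start left + j * m + i) = encode n m M F A Bs ! (start left + j * m + i)"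
    by (simp add: input_def initial_store_def)
  also have "\<dots> = (([int n, int m, int M] @ prefix_code F) @ concat A @ concat Bs) !
      (length ([int n, int m, int M] @ prefix_code F) + ((if left then 0 else n * m) + (j * m + i)))"
    by (rule arg_cong2[of _ _ _ _ nth]) (simp_all add: start_def encode_def)
  also have "\<dots> = (concat A @ concat Bs) ! ((if left then 0 else n * m) + (j * m + i))"
    by (rule nth_append_length_plus)
  also have "\<dots> = vectors left ! j ! i"
    using lt lA concat_uniform(2)[of A m j i] concat_uniform(2)[of Bs m j i] wfD assms
    by (simp add: nth_append vectors_def)
  finally show ?thesis .
qed

text \<open>What the writing phases only read: the input, the finished table of ends and the
  constants.\<close>

definition static :: "store \<Rightarrow> bool" where
  "static t \<longleftrightarrow> t INPUT = input INPUT \<and> (\<forall>f j. code_at (prefix_code F) f j \<longrightarrow> t ENDS j = int (j + csize f)) \<and>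
     t LEN 0 = C \<and> t SCALE 0 = K \<and> t SIZE 0 = h \<and> t DENOM 0 = D"

definition vector_points :: "bool \<Rightarrow> int list \<Rightarrow> (int \<times> int) list" where
  "vector_points left v = (if left then [(- 1, - 50 * h)] else []) @ [leaf_pt left K (- 1) 0] @
     gadget left K v F 0 @ [leaf_pt left K (2 * C - 1) 0] @ (if left then [(1, - 50 * h)] else [])"

definition initial_points :: "bool \<Rightarrow> (int \<times> int) list" where
  "initial_points left = (if left then [] else [(0, 40 * h), (- 1, 1 - 50 * h)])"

definition final_points :: "bool \<Rightarrow> (int \<times> int) list" where
  "final_points left = (if left then [] else [(1, 1 - 50 * h), (0, 40 * h)])"

definition all_points :: "bool \<Rightarrow> (int \<times> int) list" where
  "all_points left = initial_points left @ concat (map (vector_points left) (vectors left)) @ final_points left"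

lemma all_points_left: "all_points True = left_points K h F A"
  by (simp add: all_points_def initial_points_def final_points_def vector_points_def[abs_def] left_points_def vectors_def C_def comp_def)

lemma all_points_right: "all_points False = right_points K h F Bs"
  by (simp add: all_points_def initial_points_def final_points_def vector_points_def[abs_def] right_points_def vectors_def C_def comp_def)

text \<open>A gadget and its guards and end points contribute at most \<open>5 * m\<close> vertices
  per vector, and four more end points enclose the right curve; 9 and 13 are generous.\<close>

lemma length_all_points: "length (all_points left) \<le> 13 * (n * m)"
proof -
  have "length (vector_points left v) \<le> 9 * m" for v
    using length_gadget[of left K v F 0] wfD(6) m_pos by (cases left) (simp_all add: vector_points_def)
  then have "length (concat (map (vector_points left) V)) \<le> length V * (9 * m)" for V
    by (induction V) (auto simp: add_le_mono)
  from this[of "vectors left"] have "length (concat (map (vector_points left) (vectors left))) \<le> 9 * (n * m)"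
    using wfD(4,5) by (simp add: vectors_def split: if_splits)
  moreover have "1 \<le> n * m" using wfD(1) m_pos by simp
  moreover have "length (all_points left) \<le> length (concat (map (vector_points left) (vectors left))) + 4"
    by (simp add: all_points_def initial_points_def final_points_def)
  ultimately show ?thesis by linarith
qed

lemma all_points_bounds:
  assumes "p \<in> set (all_points left)"
  shows "\<bar>fst p\<bar> \<le> 8 * (K * C)" "\<bar>snd p\<bar> \<le> D"
proof -
  have h: "1 \<le> h" using K_le_h K_pos by linarith
  have KC: "1 \<le> K * C" using K_pos C_eq m_pos by (simp add: int_one_le_iff_zero_less)
  have "p \<in> {(- 1, - 50 * h), (1, - 50 * h), (0, 40 * h), (- 1, 1 - 50 * h), (1, 1 - 50 * h)} \<or>
     p \<in> {leaf_pt left K (- 1) 0, leaf_pt left K (2 * C - 1) 0} \<or> (\<exists>v \<in> set (vectors left). p \<in> set (gadget left K v F 0))"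
    using assms by (auto simp: all_points_def initial_points_def final_points_def vector_points_def split: if_splits)
  moreover have "zone left K (int M) (- 1) (2 * C - 1) p" if "p \<in> {leaf_pt left K (- 1) 0, leaf_pt left K (2 * C - 1) 0}"
    using that C_eq m_pos by (auto intro!: zone_leaf)
  moreover have "zone left K (int M) (- 1) (2 * C - 1) p" if v: "v \<in> set (vectors left)" "p \<in> set (gadget left K v F 0)" for v
  proof (rule zone_mono[OF gadget_zone[OF _ _ v(2)]])
    show "\<bar>v ! i\<bar> \<le> int M" if "i \<in> set (leaves F)" for i
      using that wfD(3) wfD(8)[of v i] v(1) by (auto simp: vectors_def split: if_splits)
  qed (auto simp: C_def)
  ultimately consider "p \<in> {(- 1, - 50 * h), (1, - 50 * h), (0, 40 * h), (- 1, 1 - 50 * h), (1, 1 - 50 * h)}"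
    | "zone left K (int M) (- 1) (2 * C - 1) p" by blast
  then have "\<bar>fst p\<bar> \<le> 8 * (K * C) \<and> \<bar>snd p\<bar> \<le> D"
  proof cases
    case 1
    then show ?thesis using h KC by (auto simp: D_def)
  next
    case 2
    then show ?thesis using zone_bounds(1,2)[OF 2] h by (simp add: D_def)
  qed
  then show "\<bar>fst p\<bar> \<le> 8 * (K * C)" "\<bar>snd p\<bar> \<le> D" by auto
qed

end

section \<open>Execution of the whole program\<close>

locale reduction_exec = reduction_run +
  assumes B: "100 \<le> B" "D + D * D \<le> B" "8 * (K * C) \<le> B" "13 * int (n * m) < B"
    "2 * int (length (encode n m M F A Bs)) \<le> B"
begin

lemma small: "int n \<le> B" "int m \<le> B" "K \<le> B" "C \<le> B" "h \<le> B" "D \<le> B" "2 * int (csize F) + 2 \<le> B"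
    "int (3 + csize F + 2 * (n * m)) \<le> B"
proof -
  have nm: "n * 1 \<le> n * m" "1 * m \<le> n * m" using wfD(1) m_pos by (auto intro: mult_le_mono)
  then show "int n \<le> B" "int m \<le> B" using B(4) by linarith+
  show "2 * int (csize F) + 2 \<le> B" "int (3 + csize F + 2 * (n * m)) \<le> B"
  proof -
    have "csize F + 1 \<le> length (encode n m M F A Bs)" by (simp add: length_encode)
    then show "2 * int (csize F) + 2 \<le> B" using B(5) by linarith
    show "int (3 + csize F + 2 * (n * m)) \<le> B" unfolding length_encode[symmetric] using B(5) by linarith
  qed
  have "K * 1 \<le> K * C" "1 * C \<le> K * C" using K_pos C_eq m_pos by (auto intro!: mult_mono)
  then show "K \<le> B" "C \<le> B" using B(3) K_pos C_eq m_pos by linarith+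
  have "0 \<le> D * D" by simp
  then show "D \<le> B" using B(2) by linarith
  then show "h \<le> B" using D_pos unfolding D_def by linarith
qed

text \<open>Numerators on the right curve are shifted by \<open>D * D\<close>, which is why the
  bound adds \<open>D * D\<close> to the second coordinate.\<close>

lemma points_bounded:
  assumes "p \<in> set (all_points left)"
  shows "\<bar>fst p\<bar> \<le> B \<and> \<bar>snd p\<bar> + D * D \<le> B"
  using all_points_bounds[OF assms] B(2,3) by linarith

lemma length_points: "int (length (all_points left)) < B"
  using length_all_points[of left] B(4) by linarith

text \<open>Indices from \<open>r\<close> on have been scanned. The zero counts in arrays 1 and 2
  say that both curves are still empty.\<close>

definition ends_inv :: "nat \<Rightarrow> store \<Rightarrow> bool" where
  "ends_inv r t \<longleftrightarrow> t COUNT 0 = int r \<and> r \<le> csize F \<and> t INPUT = input INPUT \<and>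
     t LEN 0 = C \<and> t SCALE 0 = K \<and> t SIZE 0 = h \<and> t DENOM 0 = D \<and> t 1 0 = 0 \<and> t 2 0 = 0 \<and>
     (\<forall>f j. r \<le> j \<longrightarrow> code_at (prefix_code F) f j \<longrightarrow> t ENDS j = int (j + csize f))"

lemma runs_prelude: "runs B prelude input 100 (ends_inv (csize F))"
proof (rule runs_wp[OF B(1)])
  have "h = K * C * (K * C)" "D = 100 * h" "2 * int m - 1 = C" "int M + 1 = K"
    by (simp_all add: h_def power2_eq_square D_def C_eq K_def)
  note eqs = this
  have "input x 0 = 0" if "x \<noteq> 0" for x using that by (simp add: input_def initial_store_def)
  note zero = this
  have no: "\<not> code_at (prefix_code F) f j" if "csize F \<le> j" for f j
    using that code_at_nth[of "prefix_code F" f j] by auto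
  have pos: "0 \<le> C" "0 \<le> K" "0 \<le> h" "0 \<le> D" using C_eq m_pos K_pos K_le_h D_pos by linarith+
  have inv: "ends_inv (csize F) (input(LEN := (input LEN)(0 := C), SCALE := (input SCALE)(0 := K),
      SIZE := (input SIZE)(0 := h), DENOM := (input DENOM)(0 := D), COUNT := (input COUNT)(0 := C)))"
    using zero no unfolding ends_inv_def by (auto simp: C_def)
  show "wp B prelude input (ends_inv (csize F))"
    using inv pos small(1-6) unfolding prelude_def
    by (simp add: input_header eqs(1)[symmetric] eqs(2)[symmetric] eqs(3,4))
qed (simp_all add: prelude_def)

lemma wp_find_end:
  assumes "ends_inv (Suc r) t"
  shows "wp B find_end t (ends_inv r)"
proof -
  note inv = assms[unfolded ends_inv_def]
  have r: "r < csize F" using inv by simp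
  obtain f where f: "code_at (prefix_code F) f r"
    using code_at_exists[of "prefix_code F" F 0 r] r by (auto simp: code_at_def)
  define e where "e = r + csize f"
  have e: "e \<le> csize F" using code_at_size[OF f] by (simp add: e_def)
  define t1 where "t1 = t(COUNT := (t COUNT)(0 := int r))"
  define t2 where "t2 = t1(ENDS := (t1 ENDS)(r := int e))"
  have post: "ends_inv r t2"
  proof -
    \<comment> \<open>The new entry is correct for every subformula at \<open>r\<close> because
      there is only one; the entries behind it are untouched.\<close>
    have "t2 ENDS j = int (j + csize g)" if "r \<le> j" "code_at (prefix_code F) g j" for g j
    proof (cases "j = r")
      case True
      then have "g = f" using code_at_unique f that(2) by blast
      then show ?thesis using True by (simp add: t2_def e_def)
    next
      case False
      then have "t ENDS j = int (j + csize g)" using inv that by simp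
      then show ?thesis using False by (simp add: t2_def t1_def)
    qed
    then show ?thesis using inv unfolding ends_inv_def by (simp add: t2_def t1_def)
  qed
  have sym: "input INPUT (3 + r) = hd (prefix_code f)"
    using input_code[OF r] code_at_nth[OF f] by simp
  have nat: "nat (3 + int r) = 3 + r" "nat (int r + 1) = Suc r" by simp_all
  have eB: "int e \<le> B" "int r \<le> B" using e r small(7) by linarith+
  have start: "wp B find_end t Q \<longleftrightarrow> wp B (Cond (Const 0 [<=] Read INPUT (Const 3 [+] cell COUNT))
       (Write ENDS (cell COUNT) (cell COUNT [+] Const 1))
       (Write ENDS (cell COUNT) (Read ENDS (Read ENDS (cell COUNT [+] Const 1))))) t1 Q" for Q
    using inv eB by (simp add: find_end_def t1_def del: wp.simps(4))
  have t1: "t1 COUNT 0 = int r" "t1 INPUT = input INPUT" "t1 ENDS = t ENDS"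
    using inv by (simp_all add: t1_def)
  have inner: "wp B (Write ENDS (cell COUNT) (Read ENDS (Read ENDS (cell COUNT [+] Const 1)))) t1 (ends_inv r)"
    if g: "code_at (prefix_code F) g1 (Suc r)" "code_at (prefix_code F) g2 (Suc r + csize g1)"
      "csize f = Suc (csize g1 + csize g2)" for g1 g2
  proof -
    define j where "j = Suc r + csize g1"
    have 1: "t ENDS (Suc r) = int j" using inv g(1) by (simp add: j_def)
    have 2: "t ENDS j = int e" using inv g(2,3) by (simp add: j_def e_def)
    show ?thesis using t1 1 2 eB post nat by (simp add: t2_def)
  qed
  show ?thesis
  proof (cases f)
    case (Var i)
    then have "int e = int r + 1" by (simp add: e_def)
    then show ?thesis unfolding start using t1 sym Var eB post nat by (simp add: t2_def)
  next
    case (And f1 f2)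
    have "wp B (Write ENDS (cell COUNT) (Read ENDS (Read ENDS (cell COUNT [+] Const 1)))) t1 (ends_inv r)"
      by (rule inner[OF code_at_And[OF f[unfolded And]]]) (simp add: And)
    then show ?thesis unfolding start wp.simps(4) using t1 sym And nat by simp
  next
    case (Or f1 f2)
    have "wp B (Write ENDS (cell COUNT) (Read ENDS (Read ENDS (cell COUNT [+] Const 1)))) t1 (ends_inv r)"
      by (rule inner[OF code_at_Or[OF f[unfolded Or]]]) (simp add: Or)
    then show ?thesis unfolding start wp.simps(4) using t1 sym Or nat by simp
  qed
qed

lemma runs_find_ends:
  assumes "ends_inv (csize F) t"
  shows "runs B find_ends t (100 * csize F) (ends_inv 0)"
  unfolding find_ends_def
proof (rule runs_While[OF B(1), where n = "csize F" and T = 60])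
  fix r t assume *: "ends_inv (Suc r) t"
  have "runs B find_end t 60 (ends_inv r)"
    by (rule runs_wp[OF B(1) _ wp_find_end[OF *]]) (simp_all add: find_end_def)
  then show "safe t (Const 1 [<=] cell COUNT) \<and> val t (Const 1 [<=] cell COUNT) \<noteq> 0 \<and> runs B find_end t 60 (ends_inv r)"
    using * by (simp add: ends_inv_def)
next
  have "1 \<le> csize F" using csize_pos[of F] by linarith
  then show "csize F * (1 + cost (Const 1 [<=] cell COUNT) + 60) + 1 + cost (Const 1 [<=] cell COUNT) \<le> 100 * csize F"
    by simp
qed (use assms in \<open>auto simp: ends_inv_def\<close>)

end

context reduction_exec begin

lemma static_temps:
  assumes "static \<sigma>" "\<And>x. x \<notin> temps left \<union> {COUNT, BASE} \<Longrightarrow> t x = \<sigma> x"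
  shows "static t"
proof -
  have "t x = \<sigma> x" if "x \<in> {INPUT, ENDS, LEN, SCALE, SIZE, DENOM}" for x
    by (rule assms(2)) (use that in \<open>auto simp: temps_def out_def\<close>)
  then have "t INPUT = \<sigma> INPUT" "t ENDS = \<sigma> ENDS" "t LEN = \<sigma> LEN" "t SCALE = \<sigma> SCALE"
    "t SIZE = \<sigma> SIZE" "t DENOM = \<sigma> DENOM" by auto
  then show ?thesis using assms(1) unfolding static_def by simp
qed

text \<open>The reference store \<open>\<sigma>\<close> stays fixed over a stretch of code, so the
  frame conditions of consecutive writes compose.\<close>

definition emitted :: "bool \<Rightarrow> store \<Rightarrow> (int \<times> int) list \<Rightarrow> store \<Rightarrow> bool" where
  "emitted left \<sigma> L t \<longleftrightarrow> written left D (t (out left)) L \<and> (\<forall>x. x \<notin> temps left \<longrightarrow> t x = \<sigma> x)"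

lemma emitted_static: "static \<sigma> \<Longrightarrow> emitted left \<sigma> L t \<Longrightarrow> static t"
  by (rule static_temps[of \<sigma> left]) (auto simp: emitted_def)

lemma runs_emit:
  assumes "admissible (put left ex ey)" "max_time (put left ex ey) \<le> 200"
    and "static \<sigma>" "emitted left \<sigma> L t" "L @ p # rest = all_points left"
    and "\<And>t. static t \<Longrightarrow> safe t ex \<and> val t ex = fst p \<and> safe t ey \<and> val t ey = snd p"
  shows "runs B (put left ex ey) t 200 (emitted left \<sigma> (L @ [p]))"
proof -
  have st: "static t" by (rule emitted_static[OF assms(3,4)])
  have st': "static (t(PX := (t PX)(0 := fst p)))"
    by (rule static_temps[OF st, of True]) (auto simp: temps_def)
  have "wp B (put left ex ey) t (emitted left \<sigma> (L @ [p]))"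
  proof (rule wp_put)
    show "written left D (t (out left)) L" "t DENOM 0 = D"
      using assms(4) st by (auto simp: emitted_def static_def)
    show "safe t ex" "val t ex = fst p" "safe (t(PX := (t PX)(0 := fst p))) ey"
      "val (t(PX := (t PX)(0 := fst p))) ey = snd p"
      using assms(6)[OF st] assms(6)[OF st'] by auto
    have "p \<in> set (all_points left)" unfolding assms(5)[symmetric] by simp
    then show "\<bar>fst p\<bar> \<le> B" "\<bar>snd p\<bar> + D * D \<le> B" using points_bounded by blast+
    show "0 \<le> D" "D \<le> B" using D_pos small by simp_all
    have "length L < length (all_points left)" unfolding assms(5)[symmetric] by simp
    then show "int (length L) < B" using length_points[of left] by linarith
    fix t' assume "written left D (t' (out left)) (L @ [p])"
      "\<And>x. x \<noteq> PX \<Longrightarrow> x \<noteq> PY \<Longrightarrow> x \<noteq> out left \<Longrightarrow> t' x = t x"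
    then show "emitted left \<sigma> (L @ [p]) t'" using assms(4) by (simp add: emitted_def temps_def)
  qed
  then show ?thesis by (rule runs_wp[OF B(1) assms(1) _ assms(2)])
qed

lemma runs_put_guard:
  assumes "admissible (put_guard left e)" "max_time (put_guard left e) \<le> 200"
    and "static \<sigma>" "emitted left \<sigma> L t" "L @ leaf_pt left K j 0 # rest = all_points left"
    and "\<And>t. static t \<Longrightarrow> safe t e \<and> val t e = j"
  shows "runs B (put_guard left e) t 200 (emitted left \<sigma> (L @ [leaf_pt left K j 0]))"
  unfolding put_guard_def
  by (rule runs_emit[OF assms(1,2)[unfolded put_guard_def] assms(3-5)])
     (use assms(6) in \<open>auto simp: leaf_x_def leaf_pt_def static_def\<close>)

lemma runs_put_if:
  assumes "admissible (put left ex ey)" "max_time (put left ex ey) \<le> 200"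
    and "static \<sigma>" "emitted left \<sigma> L t" "L @ (if left then [p] else []) @ rest = all_points left"
    and "\<And>t. static t \<Longrightarrow> safe t ex \<and> val t ex = fst p \<and> safe t ey \<and> val t ey = snd p"
  shows "runs B (put_if left ex ey) t 200 (emitted left \<sigma> (L @ (if left then [p] else [])))"
proof (cases left)
  case True
  then have "L @ p # rest = all_points left" using assms(5) by simp
  from runs_emit[OF assms(1-4) this assms(6)] show ?thesis using True by (simp add: put_if_def)
next
  case False
  have "runs B Skip t 200 (emitted left \<sigma> L)"
    by (rule runs_wp[OF B(1)]) (use assms(4) in auto)
  then show ?thesis using False by (simp add: put_if_def)
qed

definition vectors_inv :: "bool \<Rightarrow> store \<Rightarrow> nat \<Rightarrow> store \<Rightarrow> bool" where
  "vectors_inv left \<sigma> r t \<longleftrightarrow> (\<exists>i. i + r = n \<and> t COUNT 0 = int i \<and> t BASE 0 = int (start left + i * m) \<and>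
     written left D (t (out left))
       (initial_points left @ concat (map (vector_points left) (take i (vectors left)))) \<and>
     (\<forall>x. x \<notin> temps left \<union> {COUNT, BASE} \<longrightarrow> t x = \<sigma> x))"

lemma runs_write_vector:
  assumes \<sigma>: "static \<sigma>" and inv: "vectors_inv left \<sigma> (Suc r) t"
  shows "runs B (write_vector left) t (700 * csize F + 900) (vectors_inv left \<sigma> r)"
proof -
  obtain i where i: "i + Suc r = n" "t COUNT 0 = int i" "t BASE 0 = int (start left + i * m)"
    and L: "written left D (t (out left)) (initial_points left @ concat (map (vector_points left) (take i (vectors left))))"
    and frame: "\<And>x. x \<notin> temps left \<union> {COUNT, BASE} \<Longrightarrow> t x = \<sigma> x"
    using inv unfolding vectors_inv_def by blast
  have t: "static t" by (rule static_temps[OF \<sigma> frame])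
  have "i < length (vectors left)" using i(1) wfD(4,5) by (simp add: vectors_def)
  note ilt = this
  define v where "v = vectors left ! i"
  define L0 where "L0 = initial_points left @ concat (map (vector_points left) (take i (vectors left)))"
  define rest where "rest = concat (map (vector_points left) (drop (Suc i) (vectors left))) @ final_points left"
  let ?s = "if left then [(- 1, - 50 * h)] else []" and ?t = "if left then [(1, - 50 * h)] else []"
  let ?g = "leaf_pt left K (- 1) 0" and ?g' = "leaf_pt left K (2 * C - 1) 0" and ?G = "gadget left K v F 0"
  have take: "take (Suc i) (vectors left) = take i (vectors left) @ [v]"
    using ilt by (simp add: take_Suc_conv_app_nth v_def)
  have "vectors left = take i (vectors left) @ v # drop (Suc i) (vectors left)"
    unfolding v_def by (rule id_take_nth_drop[OF ilt])
  then have "map (vector_points left) (vectors left) =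
      map (vector_points left) (take i (vectors left)) @ vector_points left v # map (vector_points left) (drop (Suc i) (vectors left))"
    by (metis list.map(2) map_append)
  then have all: "L0 @ ?s @ [?g] @ ?G @ [?g'] @ ?t @ rest = all_points left"
    unfolding all_points_def L0_def rest_def by (simp add: vector_points_def)
  have next_L: "L0 @ ?s @ [?g] @ ?G @ [?g'] @ ?t =
      initial_points left @ concat (map (vector_points left) (take (Suc i) (vectors left)))"
    unfolding take L0_def by (simp add: vector_points_def)
  have v_len: "v \<in> set A \<union> set Bs" using ilt unfolding v_def by (auto simp: vectors_def)
  have e0: "emitted left t L0 t" using L by (simp add: emitted_def L0_def)
  let ?L1 = "L0 @ ?s" and ?L2 = "L0 @ ?s @ [?g]" and ?L3 = "L0 @ ?s @ [?g] @ ?G"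
    and ?L4 = "L0 @ ?s @ [?g] @ ?G @ [?g']" and ?L5 = "L0 @ ?s @ [?g] @ ?G @ [?g'] @ ?t"
  let ?p1 = "put_if left (Const (- 1)) (Const (- 50) [*] cell SIZE)"
  let ?p5 = "put_if left (Const 1) (Const (- 50) [*] cell SIZE)"
  have 1: "runs B ?p1 t 200 (emitted left t ?L1)"
    by (rule runs_put_if[OF _ _ t e0, of _ _ _ "[?g] @ ?G @ [?g'] @ ?t @ rest"])
       (use all in \<open>simp_all add: put_def emit_def Let_def static_def\<close>)
  have 2: "runs B (put_guard left (Const (- 1))) \<rho> 200 (emitted left t ?L2)"
    if "emitted left t ?L1 \<rho>" for \<rho>
  proof -
    have "runs B (put_guard left (Const (- 1))) \<rho> 200 (emitted left t (?L1 @ [?g]))"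
      by (rule runs_put_guard[OF _ _ t that, of _ _ "?G @ [?g'] @ ?t @ rest"])
         (use all in \<open>simp_all add: put_guard_def leaf_x_def put_def emit_def Let_def\<close>)
    then show ?thesis by simp
  qed
  have 3: "runs B (write_gadget left) \<rho> (700 * csize F) (emitted left t ?L3)"
    if \<rho>: "emitted left t ?L2 \<rho>" for \<rho>
  proof -
    define total where "total = ?L2 @ ?G"
    have sub: "total @ [?g'] @ ?t @ rest = all_points left" using all unfolding total_def by simp
    have st: "static \<rho>" by (rule emitted_static[OF t \<rho>])
    have base: "\<rho> BASE 0 = int (start left + i * m)"
      using \<rho> i(3) by (simp add: emitted_def temps_def out_def)
    \<comment> \<open>\<open>total\<close> ends with the current gadget but includes everything
      written before it; the base is the cell of the first entry of \<open>v\<close>.\<close>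
    interpret w: gadget_writer left B \<rho> "prefix_code F" v K D total "start left + i * m" m
    proof
      show "100 \<le> B" "int m \<le> B" "2 * int (csize F) + 2 \<le> B" by (rule B(1) small)+
      have "length total \<le> length (all_points left)" unfolding sub[symmetric] by simp
      then show "int (length total) \<le> B" using length_points[of left] by linarith
      show "\<rho> INPUT (3 + j) = prefix_code F ! j" if "j < csize F" for j
        using st input_code[OF that] by (simp add: static_def)
      show "\<rho> ENDS j = int (j + csize f)" if "code_at (prefix_code F) f j" for f j
        using st that by (simp add: static_def)
      show "\<rho> DENOM 0 = D" "\<rho> SCALE 0 = K" using st by (simp_all add: static_def)
      show "\<rho> BASE 0 = int (start left + i * m)" by (rule base)
      show "\<rho> INPUT (start left + i * m + j) = v ! j" if "j < m" for j
        using st input_vectors[of i j left] that i(1) by (simp add: static_def v_def)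
      show "j < m" if at: "code_at (prefix_code F) (Var j) l" for j l
      proof -
        have "int j = prefix_code F ! l" "l < csize F" using code_at_nth[OF at] by simp_all
        then have "int j \<in> set (prefix_code F)" by simp
        then show ?thesis using set_prefix_code[of "int j" F] wfD(3) by auto
      qed
      show "0 \<le> D" "D \<le> B" using D_pos small by simp_all
      show "\<bar>fst p\<bar> \<le> B \<and> \<bar>snd p\<bar> + D * D \<le> B" if "p \<in> set total" for p
        by (rule points_bounded[of _ left]) (use that in \<open>simp add: sub[symmetric]\<close>)
    qed
    have "runs B (write_gadget left) \<rho> (700 * csize F) (\<lambda>t. written left D (t (out left)) total \<and>
      (\<forall>x. x \<notin> temps left \<longrightarrow> t x = \<rho> x))"
      by (rule w.runs_write_gadget[of F _ "?L2"])
         (use \<rho> in \<open>auto simp: code_at_def total_def emitted_def\<close>)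
    then show ?thesis by (rule runs_mono) (use \<rho> in \<open>auto simp: emitted_def total_def\<close>)
  qed
  have 4: "runs B (put_guard left (Const 2 [*] cell LEN [-] Const 1)) \<rho> 200 (emitted left t ?L4)"
    if "emitted left t ?L3 \<rho>" for \<rho>
  proof -
    have "runs B (put_guard left (Const 2 [*] cell LEN [-] Const 1)) \<rho> 200 (emitted left t (?L3 @ [?g']))"
      by (rule runs_put_guard[OF _ _ t that, of _ _ "?t @ rest"])
         (use all in \<open>simp_all add: put_guard_def leaf_x_def put_def emit_def Let_def static_def\<close>)
    then show ?thesis by simp
  qed
  have 5: "runs B ?p5 \<rho> 200 (emitted left t ?L5)"
    if "emitted left t ?L4 \<rho>" for \<rho>
  proof -
    have "runs B ?p5 \<rho> 200 (emitted left t (?L4 @ ?t))"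
      by (rule runs_put_if[OF _ _ t that, of _ _ _ "rest"])
         (use all in \<open>simp_all add: put_def emit_def Let_def static_def\<close>)
    then show ?thesis by simp
  qed
  have 6: "runs B (BASE [:=] cell BASE [+] Read INPUT (Const 1) ;; COUNT [:=] cell COUNT [+] Const 1) \<rho> 50 (vectors_inv left \<sigma> r)"
    if \<rho>: "emitted left t ?L5 \<rho>" for \<rho>
  proof (rule runs_wp[OF B(1)])
    have st: "static \<rho>" by (rule emitted_static[OF t \<rho>])
    have base: "\<rho> BASE 0 = int (start left + i * m)" and count: "\<rho> COUNT 0 = int i"
      using \<rho> i by (simp_all add: emitted_def temps_def out_def)
    have m: "\<rho> INPUT (Suc 0) = int m" using st input_header by (simp add: static_def)
    define b c where "b = int (start left + Suc i * m)" and "c = int (Suc i)"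
    define \<rho>1 where "\<rho>1 = \<rho>(BASE := (\<rho> BASE)(0 := b))"
    define \<rho>2 where "\<rho>2 = \<rho>1(COUNT := (\<rho>1 COUNT)(0 := c))"
    have "vectors_inv left \<sigma> r \<rho>2"
      unfolding vectors_inv_def
    proof (intro exI[of _ "Suc i"] conjI allI impI)
      show "Suc i + r = n" using i(1) by simp
      show "\<rho>2 COUNT 0 = int (Suc i)" by (simp add: \<rho>2_def c_def)
      show "\<rho>2 BASE 0 = int (start left + Suc i * m)" by (simp add: \<rho>2_def \<rho>1_def b_def)
      have "\<rho>2 (out left) = \<rho> (out left)" by (simp add: \<rho>2_def \<rho>1_def out_def)
      then show "written left D (\<rho>2 (out left)) (initial_points left @ concat (map (vector_points left) (take (Suc i) (vectors left))))"
        using \<rho> unfolding next_L[symmetric] emitted_def by simp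
      fix x assume "x \<notin> temps left \<union> {COUNT, BASE}"
      then show "\<rho>2 x = \<sigma> x" using \<rho> frame by (simp add: \<rho>2_def \<rho>1_def emitted_def)
    qed
    moreover have "start left + Suc i * m \<le> 3 + csize F + 2 * (n * m)"
    proof -
      have "Suc i * m \<le> n * m" using i(1) by (intro mult_le_mono1) simp
      then show ?thesis unfolding start_def by (cases left; simp only: if_True if_False; linarith)
    qed
    then have "\<bar>b\<bar> \<le> B" using small(8) unfolding b_def by linarith
    moreover have "\<bar>c\<bar> \<le> B" using i(1) small(1) unfolding c_def by linarith
    moreover have "int (start left + i * m) + int m = b" by (simp add: b_def)
    moreover have "int i + 1 = c" by (simp add: c_def)
    moreover have "0 \<le> b" "0 \<le> c" unfolding b_def c_def by (rule of_nat_0_le_iff)+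
    ultimately show "wp B (BASE [:=] cell BASE [+] Read INPUT (Const 1) ;; COUNT [:=] cell COUNT [+] Const 1) \<rho> (vectors_inv left \<sigma> r)"
      using base count m by (simp add: \<rho>2_def \<rho>1_def)
  qed simp_all
  show ?thesis unfolding write_vector_def
    by (rule runs_Seq[where T = "700 * csize F + 900", OF 1
          runs_Seq[where T = "700 * csize F + 700", OF 2
          runs_Seq[where T = "700 * csize F + 500", OF 3
          runs_Seq[where T = 450, OF 4 runs_Seq[where T = 250, OF 5 6]]]]]) (assumption | simp)+
qed

lemma runs_write_vectors:
  assumes \<sigma>: "static \<sigma>" and L: "written left D (\<sigma> (out left)) (initial_points left)"
    and base: "\<sigma> BASE 0 = int (start left)"
  shows "runs B (write_vectors left) \<sigma> (n * (700 * csize F + 920) + 20) (\<lambda>t. static t \<and>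
      written left D (t (out left)) (initial_points left @ concat (map (vector_points left) (vectors left))) \<and>
      t BASE 0 = int (start left + n * m) \<and> t (out (\<not> left)) = \<sigma> (out (\<not> left)))"
proof -
  define \<sigma>1 where "\<sigma>1 = \<sigma>(COUNT := (\<sigma> COUNT)(0 := 0))"
  have inv: "vectors_inv left \<sigma> n \<sigma>1"
    unfolding vectors_inv_def by (rule exI[of _ 0]) (use L base in \<open>simp add: \<sigma>1_def out_def\<close>)
  have hd: "t INPUT 0 = int n" if "vectors_inv left \<sigma> r t" for r t
  proof -
    have "static t" by (rule static_temps[OF \<sigma>, of left]) (use that in \<open>auto simp: vectors_inv_def\<close>)
    then show ?thesis using input_header by (simp add: static_def)
  qed
  have loop: "runs B (While (cell COUNT [+] Const 1 [<=] Read INPUT (Const 0)) (write_vector left)) \<sigma>1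
      (n * (700 * csize F + 920) + 10) (vectors_inv left \<sigma> 0)"
  proof (rule runs_While[OF B(1), where T = "700 * csize F + 900" and I = "vectors_inv left \<sigma>" and n = n])
    show "vectors_inv left \<sigma> n \<sigma>1" by (rule inv)
  next
    fix r t assume *: "vectors_inv left \<sigma> (Suc r) t"
    show "safe t (cell COUNT [+] Const 1 [<=] Read INPUT (Const 0)) \<and>
        val t (cell COUNT [+] Const 1 [<=] Read INPUT (Const 0)) \<noteq> 0 \<and>
        runs B (write_vector left) t (700 * csize F + 900) (vectors_inv left \<sigma> r)"
      using runs_write_vector[OF \<sigma> *] hd[OF *] * by (auto simp: vectors_inv_def)
  next
    fix t assume *: "vectors_inv left \<sigma> 0 t"
    show "safe t (cell COUNT [+] Const 1 [<=] Read INPUT (Const 0)) \<and>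
        val t (cell COUNT [+] Const 1 [<=] Read INPUT (Const 0)) = 0"
      using hd[OF *] * by (auto simp: vectors_inv_def)
  next
    have cost: "cost (cell COUNT [+] Const 1 [<=] Read INPUT (Const 0)) = 7" by simp
    have "n * (1 + 7 + (700 * csize F + 900)) \<le> n * (700 * csize F + 920)"
      by (intro mult_le_mono2) simp
    then show "n * (1 + cost (cell COUNT [+] Const 1 [<=] Read INPUT (Const 0)) + (700 * csize F + 900)) + 1 +
        cost (cell COUNT [+] Const 1 [<=] Read INPUT (Const 0)) \<le> n * (700 * csize F + 920) + 10"
      unfolding cost by linarith
  qed simp_all
  have post: "static t \<and>
      written left D (t (out left)) (initial_points left @ concat (map (vector_points left) (vectors left))) \<and>
      t BASE 0 = int (start left + n * m) \<and> t (out (\<not> left)) = \<sigma> (out (\<not> left))" if "vectors_inv left \<sigma> 0 t" for t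
  proof -
    have "take n (vectors left) = vectors left" using wfD(4,5) by (simp add: vectors_def)
    moreover have "static t" by (rule static_temps[OF \<sigma>, of left]) (use that in \<open>auto simp: vectors_inv_def\<close>)
    moreover have "out (\<not> left) \<notin> temps left \<union> {COUNT, BASE}" by (auto simp: temps_def out_def)
    ultimately show ?thesis using that unfolding vectors_inv_def by auto
  qed
  have "runs B (COUNT [:=] Const 0) \<sigma> 10 (\<lambda>t. t = \<sigma>1)"
    by (rule runs_wp[OF B(1)]) (use B(1) in \<open>auto simp: \<sigma>1_def\<close>)
  then have "runs B (write_vectors left) \<sigma> (n * (700 * csize F + 920) + 20) (vectors_inv left \<sigma> 0)"
    unfolding write_vectors_def by (rule runs_Seq) (use loop in auto)
  then show ?thesis by (rule runs_mono[OF _ post]) simp_all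
qed

definition curves_written :: "store \<Rightarrow> bool" where
  "curves_written t \<longleftrightarrow> written True D (t 1) (all_points True) \<and> written False D (t 2) (all_points False)"

lemma runs_reduction:
  "runs B reduction input (5800 * (n * m))
     curves_written"
proof -
  let ?T = "n * (700 * csize F + 920) + 20"
  let ?V = "\<lambda>left. concat (map (vector_points left) (vectors left))"
  let ?S = "(0, 40 * h)" and ?S' = "(- 1, 1 - 50 * h)" and ?T' = "(1, 1 - 50 * h)"
  let ?pS = "put False (Const 0) (Const 40 [*] cell SIZE)"
  let ?pS' = "put False (Const (- 1)) (Const 1 [-] Const 50 [*] cell SIZE)"
  let ?pT' = "put False (Const 1) (Const 1 [-] Const 50 [*] cell SIZE)"
  have all_right: "?S # ?S' # ?V False @ [?T', ?S] = all_points False"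
    by (simp add: all_points_def initial_points_def final_points_def)
  have all_left: "?V True = all_points True"
    by (simp add: all_points_def initial_points_def final_points_def)
  have adm: "admissible ?pS" "admissible ?pS'" "admissible ?pT'"
    "max_time ?pS \<le> 200" "max_time ?pS' \<le> 200" "max_time ?pT' \<le> 200"
    by (simp_all add: put_def emit_def Let_def)
  have ends: "runs B (BASE [:=] Const 3 [+] cell LEN) t 10 (\<lambda>t. static t \<and> t BASE 0 = int (start True) \<and> t 1 0 = 0 \<and> t 2 0 = 0)"
    if "ends_inv 0 t" for t
  proof (rule runs_wp[OF B(1)])
    have "\<bar>3 + C\<bar> \<le> B" using small(8) unfolding C_def by linarith
    then show "wp B (BASE [:=] Const 3 [+] cell LEN) t (\<lambda>t. static t \<and> t BASE 0 = int (start True) \<and> t 1 0 = 0 \<and> t 2 0 = 0)"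
      using that by (simp add: ends_inv_def static_def start_def C_def)
  qed simp_all
  define left_done where "left_done t \<longleftrightarrow> static t \<and> written True D (t 1) (all_points True) \<and>
      t BASE 0 = int (start False) \<and> t 2 0 = 0" for t
  have left: "runs B (write_vectors True) t ?T left_done"
    if "static t \<and> t BASE 0 = int (start True) \<and> t 1 0 = 0 \<and> t 2 0 = 0" for t
  proof (rule runs_mono[OF runs_write_vectors])
    show "static t" "t BASE 0 = int (start True)" using that by auto
    show "written True D (t (out True)) (initial_points True)"
      using that by (simp add: written_def initial_points_def out_def)
  qed (use that all_left in \<open>auto simp: left_done_def out_def initial_points_def start_def\<close>)
  have right: "runs B (?pS ;; ?pS' ;; write_vectors False ;; ?pT' ;; ?pS) \<sigma> (?T + 800)
      curves_written"
    if \<sigma>: "left_done \<sigma>" for \<sigma>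
  proof -
    have st: "static \<sigma>" using \<sigma> by (simp add: left_done_def)
    have e0: "emitted False \<sigma> [] \<sigma>"
      using \<sigma> by (simp add: left_done_def emitted_def written_def out_def)
    have 1: "runs B ?pS \<sigma> 200 (emitted False \<sigma> ([] @ [?S]))"
      by (rule runs_emit[OF adm(1,4) st e0, of _ "?S' # ?V False @ [?T', ?S]"])
         (use all_right in \<open>simp_all add: static_def\<close>)
    have 2: "runs B ?pS' t 200 (emitted False \<sigma> (([] @ [?S]) @ [?S']))" if "emitted False \<sigma> ([] @ [?S]) t" for t
      by (rule runs_emit[OF adm(2,5) st that, of _ "?V False @ [?T', ?S]"])
         (use all_right in \<open>simp_all add: static_def\<close>)
    define right_done where "right_done t \<longleftrightarrow> static t \<and> written True D (t 1) (all_points True) \<and>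
      written False D (t 2) (initial_points False @ ?V False)" for t
    have 3: "runs B (write_vectors False) t ?T right_done" if e: "emitted False \<sigma> (([] @ [?S]) @ [?S']) t" for t
    proof (rule runs_mono[OF runs_write_vectors])
      show "static t" by (rule emitted_static[OF st e])
      show "written False D (t (out False)) (initial_points False)"
        using e by (simp add: emitted_def initial_points_def)
      show "t BASE 0 = int (start False)"
        using e \<sigma> by (simp add: emitted_def left_done_def temps_def out_def)
      have "t 1 = \<sigma> 1" using e by (simp add: emitted_def temps_def out_def)
      then show "right_done \<rho>" if "static \<rho> \<and>
          written False D (\<rho> (out False)) (initial_points False @ concat (map (vector_points False) (vectors False))) \<and>
          \<rho> BASE 0 = int (start False + n * m) \<and> \<rho> (out (\<not> False)) = t (out (\<not> False))" for \<rho>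
        using that \<sigma> by (simp add: right_done_def left_done_def out_def)
    qed simp
    have 4: "runs B (?pT' ;; ?pS) t 400
      curves_written"
      if t: "right_done t" for t
    proof -
      let ?L = "initial_points False @ ?V False"
      have st: "static t" using t by (simp add: right_done_def)
      have e: "emitted False t ?L t" using t by (simp add: right_done_def emitted_def out_def)
      have 5: "runs B ?pT' t 200 (emitted False t (?L @ [?T']))"
        by (rule runs_emit[OF adm(3,6) st e, of _ "[?S]"])
           (use all_right in \<open>simp_all add: static_def initial_points_def\<close>)
      have 6: "runs B ?pS \<rho> 200 (emitted False t ((?L @ [?T']) @ [?S]))" if "emitted False t (?L @ [?T']) \<rho>" for \<rho>
        by (rule runs_emit[OF adm(1,4) st that, of _ "[]"])
           (use all_right in \<open>simp_all add: static_def initial_points_def\<close>)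
      have "runs B (?pT' ;; ?pS) t 400 (emitted False t ((?L @ [?T']) @ [?S]))"
        by (rule runs_Seq[OF 5 6]) simp_all
      moreover have "(?L @ [?T']) @ [?S] = all_points False"
        unfolding all_right[symmetric] by (simp add: initial_points_def)
      ultimately show ?thesis
        by (elim runs_mono) (use t in \<open>auto simp: curves_written_def emitted_def right_done_def out_def temps_def\<close>)
    qed
    show ?thesis
      by (rule runs_Seq[where T = "?T + 800", OF 1 runs_Seq[where T = "?T + 600", OF 2 runs_Seq[where T = "?T + 400", OF 3 4]]])
         (assumption | simp)+
  qed
  have main: "runs B reduction input (100 + (100 * csize F + (10 + (?T + (?T + 800)))))
     curves_written"
    unfolding reduction_def
    by (rule runs_Seq[where T = "100 + (100 * csize F + (10 + (?T + (?T + 800))))", OF runs_prelude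
          runs_Seq[where T = "100 * csize F + (10 + (?T + (?T + 800)))", OF runs_find_ends
          runs_Seq[where T = "10 + (?T + (?T + 800))", OF ends
          runs_Seq[where T = "?T + (?T + 800)", OF left right]]]])
       (assumption | simp)+
  have "csize F \<le> 2 * m" using csize_F by simp
  then have "n * (700 * csize F + 920) \<le> n * (1400 * m + 920 * m)"
    using m_pos by (intro mult_le_mono2 add_mono) auto
  then have "n * (700 * csize F + 920) \<le> 2320 * (n * m)" by (simp add: algebra_simps)
  moreover have "1 * m \<le> n * m" using wfD(1) by (intro mult_le_mono1) simp
  \<comment> \<open>The two writing phases take at most \<open>4640 * (n * m)\<close> steps apart
    from constants, the scan \<open>200 * m\<close>, and the constants add up to 950; all of it is
    absorbed because \<open>1 \<le> m \<le> n * m\<close>.\<close>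
  ultimately show ?thesis
    by (intro runs_mono[OF main]) (use m_pos \<open>csize F \<le> 2 * m\<close> in linarith)+
qed

end

section \<open>Choice of the word size and conclusion\<close>

lemma holds_curve_if_written:
  "written left D a L \<Longrightarrow> 0 < D \<Longrightarrow> holds_curve a (map (curve_point left D) L)"
  unfolding written_def holds_curve_def by (auto simp: curve_point_def)

theorem theoremF1:
  fixes k :: nat
  shows "\<exists>(prog :: com) (c :: nat). \<forall>n m M F A B. ineq_formula_pair k n m M F A B \<longrightarrow>
    (let input = encode n m M F A B; N = length input in
      \<exists>t \<sigma> P Q.
        exec (int N ^ c) prog (initial_store input) t \<sigma> \<and> t \<le> c * N \<and>
        holds_curve (\<sigma> 1) P \<and> holds_curve (\<sigma> 2) Q \<and>
        P \<noteq> [] \<and> Q \<noteq> [] \<and>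
        length P \<le> c * (n * m) \<and> length Q \<le> c * (n * m) \<and>
        (frechet_dist P Q \<le> 1 \<longleftrightarrow> yes_instance F A B))"
proof (intro exI[of _ reduction] exI[of _ "(4 * k + 400) * 20"] allI impI)
  fix n m M F A Bs
  assume wf: "ineq_formula_pair k n m M F A Bs"
  interpret r: reduction_run k n m M F A Bs by unfold_locales (rule wf)
  define N where "N = length (encode n m M F A Bs)"
  define b where "b = 4 * k + 400"
  \<comment> \<open>\<open>D\<^sup>2 \<le> N ^ (4 * k + 14)\<close>; the rest is slack for the running time \<open>5800 * (n * m)\<close>\<close>
  have N_eq: "N = 3 + csize F + 2 * (n * m)" by (simp add: N_def r.length_encode)
  have nm: "n * 1 \<le> n * m" "1 * m \<le> n * m" using r.wfD(1) r.m_pos by (auto intro: mult_le_mono)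
  \<comment> \<open>Attained for \<open>n = m = 1\<close>. Powers of \<open>N\<close> now absorb
    numerical factors, as in \<open>8 \<le> N\<^sup>2\<close> and
    \<open>100 \<le> N\<^sup>3\<close>, so the exponents depend on \<open>k\<close> alone.\<close>
  have N6: "6 \<le> int N" using N_eq nm r.wfD(1) r.m_pos r.csize_F by linarith
  have pow: "int N ^ i \<le> int N ^ j" if "i \<le> j" for i j using N6 that by (intro power_increasing) auto
  have C: "0 \<le> r.C" "r.C \<le> int N" unfolding r.C_def N_eq by simp_all
  have "n \<le> N" using N_eq nm r.wfD(1) r.m_pos by linarith
  \<comment> \<open>The polynomial bound on the entries makes \<open>K\<close>, and through it
    \<open>D\<close>, polynomial in \<open>N\<close>.\<close>
  then have "int M \<le> int N ^ k"
    using r.wfD(2) power_mono[of n N k] by (metis le_trans of_nat_le_iff of_nat_power zero_le)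
  moreover have "1 \<le> int N ^ k" using N6 by (intro one_le_power) simp
  ultimately have "r.K \<le> 2 * int N ^ k" unfolding r.K_def by linarith
  also have "\<dots> \<le> int N * int N ^ k" using N6 by (intro mult_right_mono) auto
  finally have K: "r.K \<le> int N ^ (k + 1)" by simp
  have KC: "r.K * r.C \<le> int N ^ (k + 2)"
  proof -
    have "r.K * r.C \<le> int N ^ (k + 1) * int N" using K C r.K_pos by (intro mult_mono) auto
    then show ?thesis by (simp add: mult.commute)
  qed
  have KC0: "0 \<le> r.K * r.C" using C r.K_pos by simp
  have "r.h \<le> (int N ^ (k + 2))\<^sup>2" unfolding r.h_def using KC KC0 by (rule power_mono)
  moreover have "2 * k + 4 = (k + 2) * 2" by simp
  ultimately have h: "r.h \<le> int N ^ (2 * k + 4)" by (simp only: power_mult)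
  have h0: "0 \<le> r.h" by (simp add: r.h_def)
  have sq: "36 \<le> int N ^ 2" using power_mono[OF N6, of 2] by simp
  have cube: "216 \<le> int N ^ 3" using power_mono[OF N6, of 3] by simp
  have "r.D \<le> int N ^ 3 * int N ^ (2 * k + 4)"
    unfolding r.D_def using cube h h0 by (intro mult_mono) auto
  moreover have "2 * k + 7 = 3 + (2 * k + 4)" by simp
  ultimately have D: "r.D \<le> int N ^ (2 * k + 7)" by (simp only: power_add)
  have DD: "r.D * r.D \<le> int N ^ (4 * k + 14)"
  proof -
    have "r.D * r.D \<le> int N ^ (2 * k + 7) * int N ^ (2 * k + 7)"
      using D r.D_pos by (intro mult_mono) auto
    moreover have "4 * k + 14 = (2 * k + 7) + (2 * k + 7)" by simp
    ultimately show ?thesis by (simp only: power_add)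
  qed
  interpret e: reduction_exec k n m M F A Bs "int N ^ b"
  proof
    show "100 \<le> int N ^ b" using cube pow[of 3 b] by (simp add: b_def)
    have "r.D \<le> int N ^ (4 * k + 14)" using D pow[of "2 * k + 7" "4 * k + 14"] by simp
    then have "r.D + r.D * r.D \<le> 2 * int N ^ (4 * k + 14)" using DD by simp
    also have "\<dots> \<le> int N * int N ^ (4 * k + 14)" using N6 by (intro mult_right_mono) auto
    also have "\<dots> = int N ^ (1 + (4 * k + 14))" by (simp only: power_add power_one_right)
    also have "\<dots> \<le> int N ^ b" by (rule pow) (simp add: b_def)
    finally show "r.D + r.D * r.D \<le> int N ^ b" .
    have "8 * (r.K * r.C) \<le> int N ^ 2 * int N ^ (k + 2)" using sq KC KC0 by (intro mult_mono) auto
    also have "\<dots> = int N ^ (2 + (k + 2))" by (simp only: power_add)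
    also have "\<dots> \<le> int N ^ b" by (rule pow) (simp add: b_def)
    finally show "8 * (r.K * r.C) \<le> int N ^ b" .
    have "13 * x < 36 * (3 + csize F + 2 * x)" for x :: nat by simp
    then have "13 * (n * m) < 36 * N" unfolding N_eq .
    then have "int (13 * (n * m)) < int (36 * N)" by (simp only: of_nat_less_iff)
    then have "13 * int (n * m) < 36 * int N" by simp
    also have "\<dots> \<le> int N ^ 2 * int N" using sq by (intro mult_right_mono) auto
    also have "\<dots> = int N ^ (2 + 1)" by (simp only: power_add power_one_right)
    also have "\<dots> \<le> int N ^ b" by (rule pow) (simp add: b_def)
    finally show "13 * int (n * m) < int N ^ b" .
    have "2 * int N \<le> int N * int N" using N6 by (intro mult_right_mono) auto
    also have "\<dots> = int N ^ (1 + 1)" by (simp only: power_add power_one_right)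
    also have "\<dots> \<le> int N ^ b" by (rule pow) (simp add: b_def)
    finally show "2 * int (length (encode n m M F A Bs)) \<le> int N ^ b" by (simp add: N_def)
  qed
  have "bounded (int N ^ b) r.input"
  proof -
    have "int N \<le> int N ^ b" using pow[of 1 b] by (simp add: b_def)
    have "int M \<le> int N ^ b" using e.small(3) unfolding r.K_def by linarith
    have code: "\<bar>x\<bar> \<le> int N ^ b" if x: "x \<in> set (prefix_code F)" for x
    proof -
      consider "x = - 1" | "x = - 2" | i where "i < m" "x = int i"
        using set_prefix_code[OF x] r.wfD(3) by blast
      then show ?thesis by cases (use e.small(2) e.B(1) in linarith)+
    qed
    have vec: "\<bar>x\<bar> \<le> int N ^ b" if "v \<in> set A \<union> set Bs" "x \<in> set v" for v x
    proof -
      have "- int M \<le> x \<and> x \<le> int M" using wf that unfolding ineq_formula_pair_def by blast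
      then show ?thesis using \<open>int M \<le> int N ^ b\<close> by linarith
    qed
    have entries: "\<bar>x\<bar> \<le> int N ^ b" if x: "x \<in> set (encode n m M F A Bs)" for x
    proof -
      consider "x = int n" | "x = int m" | "x = int M" | "x \<in> set (prefix_code F)"
        | v where "v \<in> set A \<union> set Bs" "x \<in> set v"
        using x unfolding encode_def by auto
      then show ?thesis
        by cases (use code vec e.small(1,2) \<open>int M \<le> int N ^ b\<close> in \<open>simp_all only: abs_of_nat\<close>)
    qed
    show ?thesis
      unfolding bounded_def r.input_def initial_store_def using entries[OF nth_mem] e.B(1) by auto
  qed
  then obtain t \<sigma> where run: "exec ((int N ^ b) ^ 20) reduction r.input t \<sigma>" "t \<le> 5800 * (n * m)"
    and left: "written True r.D (\<sigma> 1) (r.all_points True)"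
    and right: "written False r.D (\<sigma> 2) (r.all_points False)"
    using e.runs_reduction unfolding runs_def e.curves_written_def by blast
  define P where "P = map (curve_point True r.D) (r.all_points True)"
  define Q where "Q = map (curve_point False r.D) (r.all_points False)"
  have A: "A \<noteq> []" using r.wfD(1,4) by auto
  have "exec (int N ^ (b * 20)) reduction r.input t \<sigma>" using run(1) by (simp add: power_mult)
  moreover have "t \<le> (b * 20) * N"
  proof -
    \<comment> \<open>\<open>8000 = 400 * 20\<close> is the constant part of \<open>b * 20\<close>,
      which serves as exponent of the word size and as factor for both time and length.\<close>
    have "5800 * x \<le> 8000 * (3 + csize F + 2 * x)" for x :: nat by simp
    then have "5800 * (n * m) \<le> 8000 * N" unfolding N_eq .
    with run(2) have "t \<le> 8000 * N" by (rule le_trans)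
    also have "\<dots> \<le> (b * 20) * N" by (intro mult_le_mono1) (simp add: b_def)
    finally show ?thesis .
  qed
  moreover have "holds_curve (\<sigma> 1) P" "holds_curve (\<sigma> 2) Q"
    unfolding P_def Q_def using left right r.D_pos by (auto intro: holds_curve_if_written)
  moreover have "P \<noteq> []" "Q \<noteq> []"
    using A unfolding P_def Q_def r.all_points_left r.all_points_right
    by (cases A; simp add: left_points_def right_points_def)+
  moreover have "length (r.all_points left) \<le> (b * 20) * (n * m)" for left
  proof -
    have "13 * (n * m) \<le> (b * 20) * (n * m)" by (intro mult_le_mono1) (simp add: b_def)
    then show ?thesis using r.length_all_points[of left] by linarith
  qed
  then have "length P \<le> (b * 20) * (n * m)" "length Q \<le> (b * 20) * (n * m)" by (simp_all add: P_def Q_def)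
  moreover have "frechet_dist P Q \<le> 1 \<longleftrightarrow> yes_instance F A Bs"
    unfolding P_def Q_def r.all_points_left r.all_points_right
    by (rule r.curves_correct[OF r.C_def A]) (use r.wfD(3,8) in auto)
  ultimately show "let input = encode n m M F A Bs; N = length input in
      \<exists>t \<sigma> P Q.
        exec (int N ^ ((4 * k + 400) * 20)) reduction (initial_store input) t \<sigma> \<and> t \<le> (4 * k + 400) * 20 * N \<and>
        holds_curve (\<sigma> 1) P \<and> holds_curve (\<sigma> 2) Q \<and>
        P \<noteq> [] \<and> Q \<noteq> [] \<and>
        length P \<le> (4 * k + 400) * 20 * (n * m) \<and> length Q \<le> (4 * k + 400) * 20 * (n * m) \<and>
        (frechet_dist P Q \<le> 1 \<longleftrightarrow> yes_instance F A Bs)"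
    unfolding Let_def N_def[symmetric] b_def[symmetric] r.input_def[symmetric] by blast
qed

end
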